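(* Let $A\in\mathbb R^{n\times d}$ with rows $a_1,\dots,a_n\in\mathbb R^d$, and let $\varepsilon>0$. There exists a subset $S\subseteq[n]$ of size $|S|=O(d\log\log d+d/\varepsilon)$, which can be computed in $\tilde O((d/\varepsilon)(\mathrm{nnz}(A)+d^2))$ time, such that $\{a_i\}_{i\in S}$ is a $(1+\varepsilon)$-approximate $\ell_2$-well-conditioned spanning set; that is, for every $i\in[n]$ there exists $x\in\mathbb R^S$ with $a_i=(A|_S)^\top x$ and $\|x\|_2\le 1+\varepsilon$.
   Context: For $S\subseteq[n]$, $A|_S$ is the matrix formed by the rows of $A$ indexed by $S$, and $\mathbb R^S$ is the set of vectors with entries indexed by $S$. $\mathrm{nnz}(A)$ is the number of nonzero entries of $A$. $\tilde O(\cdot)$ hides polylogarithmic factors. $\log\log d$ is read as at least $1$. (In the paper, $S$ is the set produced by a known algorithm for coresets of Löwner–John ellipsoids: there are nonnegative weights $u\in\mathbb R^n$ supported on $S$ with $\|u\|_\infty\le1$, $\|u\|_1=d$ and $(1+\varepsilon)\{x: x^\top(A^\top\mathrm{diag}(u)A)^{-1}x\le1\}\supseteq\mathrm{conv}(\{\pm a_i\}_{i=1}^n)$.)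
   Formalization: In the running time, d/ε is read as d·max(1, 1/ε): unchanged for ε ≤ 1, while for ε > 1 the literal bound would tend to 0 as ε grows for a fixed A, which no algorithm can meet; the size bound and the spanning property hold for all ε > 0 as stated. *)

theory Defs
  imports Complex_Main "HOL-Analysis.L2_Norm"
    "Jordan_Normal_Form.Matrix" "Jordan_Normal_Form.DL_Submatrix"
begin

section \<open>Well-conditioned spanning sets\<close>

definition nnz :: "real mat \<Rightarrow> nat" where
  "nnz A = card {(i, j). i < dim_row A \<and> j < dim_col A \<and> A $$ (i, j) \<noteq> 0}"

text \<open>
  \<open>submatrix A S UNIV\<close> consists of the rows of \<open>A\<close> with index in \<open>S\<close>, in increasing order;
  along that ordering \<open>\<real>\<^sup>S\<close> is \<open>carrier_vec (card S)\<close>.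
\<close>

definition well_conditioned_spanning_set :: "real mat \<Rightarrow> nat set \<Rightarrow> real \<Rightarrow> bool" where
  "well_conditioned_spanning_set A S \<kappa> \<longleftrightarrow>
     S \<subseteq> {..<dim_row A} \<and>
     (\<forall>i<dim_row A. \<exists>x \<in> carrier_vec (card S).
        row A i = (submatrix A S UNIV)\<^sup>T *\<^sub>v x \<and>
        L2_set (\<lambda>k. x $ k) {..<card S} \<le> \<kappa>)"


section \<open>Running time on a real RAM\<close>

text \<open>
  Running time is counted on a real RAM programmed by a structured language. The memory
  consists of named arrays of integer cells (used for addresses and counters) and named arrays of
  real cells; a scalar is an array of which only cell 0 is used. Real cells admit exact
  arithmetic and comparisons. To keep the model from being unrealistically strong, there are no
  real constants besides integers, no rounding from reals to integers, and the only integer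
  operations are addition and truncated subtraction, so that unit-cost integers cannot be used
  to pack data.
\<close>

datatype nexp =
    NConst nat
  | NCell string nexp
  | NAdd nexp nexp
  | NSub nexp nexp

datatype rexp =
    ROfNat nexp
  | RCell string nexp
  | RAdd rexp rexp
  | RSub rexp rexp
  | RMul rexp rexp
  | RDiv rexp rexp

datatype bexp =
    NLess nexp nexp
  | RLess rexp rexp
  | BNot bexp
  | BAnd bexp bexp

datatype com =
    Skip
  | NAssign string nexp nexp
  | RAssign string nexp rexp
  | Seq com com
  | Cond bexp com com
  | While bexp com

record store =
  nmem :: "string \<Rightarrow> nat \<Rightarrow> nat"
  rmem :: "string \<Rightarrow> nat \<Rightarrow> real"

primrec nval :: "nexp \<Rightarrow> store \<Rightarrow> nat" where
  "nval (NConst c) s = c"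
| "nval (NCell a e) s = nmem s a (nval e s)"
| "nval (NAdd e1 e2) s = nval e1 s + nval e2 s"
| "nval (NSub e1 e2) s = nval e1 s - nval e2 s"

text \<open>Division by zero yields 0, as everywhere in HOL; a program can test the divisor anyway.\<close>

primrec rval :: "rexp \<Rightarrow> store \<Rightarrow> real" where
  "rval (ROfNat e) s = real (nval e s)"
| "rval (RCell a e) s = rmem s a (nval e s)"
| "rval (RAdd e1 e2) s = rval e1 s + rval e2 s"
| "rval (RSub e1 e2) s = rval e1 s - rval e2 s"
| "rval (RMul e1 e2) s = rval e1 s * rval e2 s"
| "rval (RDiv e1 e2) s = rval e1 s / rval e2 s"

primrec bval :: "bexp \<Rightarrow> store \<Rightarrow> bool" where
  "bval (NLess e1 e2) s \<longleftrightarrow> nval e1 s < nval e2 s"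
| "bval (RLess e1 e2) s \<longleftrightarrow> rval e1 s < rval e2 s"
| "bval (BNot b) s \<longleftrightarrow> \<not> bval b s"
| "bval (BAnd b1 b2) s \<longleftrightarrow> bval b1 s \<and> bval b2 s"

definition nupdate :: "string \<Rightarrow> nat \<Rightarrow> nat \<Rightarrow> store \<Rightarrow> store" where
  "nupdate a i v s = s\<lparr>nmem := (nmem s)(a := (nmem s a)(i := v))\<rparr>"

definition rupdate :: "string \<Rightarrow> nat \<Rightarrow> real \<Rightarrow> store \<Rightarrow> store" where
  "rupdate a i v s = s\<lparr>rmem := (rmem s)(a := (rmem s a)(i := v))\<rparr>"

text \<open>
  \<open>exec c s T t\<close>: started in store \<open>s\<close>, program \<open>c\<close> halts in store \<open>t\<close> after \<open>T\<close> steps. Each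
  assignment and each evaluation of a test counts as one step; since the expressions in a fixed
  program have bounded size, charging for the individual operations in them would change \<open>T\<close> by
  at most a constant factor.
\<close>

inductive exec :: "com \<Rightarrow> store \<Rightarrow> nat \<Rightarrow> store \<Rightarrow> bool" where
  exec_Skip: "exec Skip s 1 s"
| exec_NAssign: "exec (NAssign a e1 e2) s 1 (nupdate a (nval e1 s) (nval e2 s) s)"
| exec_RAssign: "exec (RAssign a e1 e2) s 1 (rupdate a (nval e1 s) (rval e2 s) s)"
| exec_Seq: "exec c1 s T1 s' \<Longrightarrow> exec c2 s' T2 t \<Longrightarrow> exec (Seq c1 c2) s (T1 + T2) t"
| exec_CondTrue: "bval b s \<Longrightarrow> exec c1 s T t \<Longrightarrow> exec (Cond b c1 c2) s (T + 1) t"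
| exec_CondFalse: "\<not> bval b s \<Longrightarrow> exec c2 s T t \<Longrightarrow> exec (Cond b c1 c2) s (T + 1) t"
| exec_WhileFalse: "\<not> bval b s \<Longrightarrow> exec (While b c) s 1 s"
| exec_WhileTrue: "bval b s \<Longrightarrow> exec c s T1 s' \<Longrightarrow> exec (While b c) s' T2 t \<Longrightarrow>
    exec (While b c) s (T1 + T2 + 1) t"

text \<open>
  For a running time in terms of \<open>nnz A\<close> the matrix has to be given in sparse form. Here it is a
  list of the nonzero entries with their positions, in arbitrary order.
\<close>

definition coordinate_listing :: "real mat \<Rightarrow> (nat \<times> nat \<times> real) list \<Rightarrow> bool" where
  "coordinate_listing A es \<longleftrightarrow>
     distinct es \<and>
     set es = {(i, j, A $$ (i, j)) | i j. i < dim_row A \<and> j < dim_col A \<and> A $$ (i, j) \<noteq> 0}"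

definition scalar :: "'a::zero \<Rightarrow> nat \<Rightarrow> 'a" where
  "scalar v = (\<lambda>_. 0)(0 := v)"

definition array :: "'a::zero list \<Rightarrow> nat \<Rightarrow> 'a" where
  "array xs = (\<lambda>k. if k < length xs then xs ! k else 0)"

definition input_store :: "nat \<Rightarrow> nat \<Rightarrow> (nat \<times> nat \<times> real) list \<Rightarrow> real \<Rightarrow> store" where
  "input_store n d es \<epsilon> =
     \<lparr>nmem = (\<lambda>_ _. 0)
        (''n'' := scalar n, ''d'' := scalar d, ''nnz'' := scalar (length es),
         ''row'' := array (map (\<lambda>(i, j, v). i) es),
         ''col'' := array (map (\<lambda>(i, j, v). j) es)),
      rmem = (\<lambda>_ _. 0)
        (''val'' := array (map (\<lambda>(i, j, v). v) es),
         ''eps'' := scalar \<epsilon>)\<rparr>"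

text \<open>The computed index set is returned as an array \<open>out\<close> together with its length.\<close>

definition output_set :: "store \<Rightarrow> nat set" where
  "output_set t = nmem t ''out'' ` {..<nmem t ''len'' 0}"

definition computes_within :: "com \<Rightarrow> store \<Rightarrow> nat set \<Rightarrow> real \<Rightarrow> bool" where
  "computes_within P s S B \<longleftrightarrow> (\<exists>T t. exec P s T t \<and> output_set t = S \<and> real T \<le> B)"

text \<open>
  \<open>g = soft_O(f)\<close> means that \<open>g \<le> soft_O_bound C k f\<close> for some constants \<open>C\<close> and \<open>k\<close>. The
  logarithmic factor is at least a positive constant for \<open>f \<ge> 1\<close>. A time bound proportional to
  \<open>d / \<epsilon>\<close> is meant for \<open>\<epsilon> \<le> 1\<close>: for a fixed matrix it tends to 0 as \<open>\<epsilon>\<close> grows. Used with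
  \<open>d * max 1 (1 / \<epsilon>)\<close> in its place, it is meaningful for all \<open>\<epsilon> > 0\<close> and unchanged for \<open>\<epsilon> \<le> 1\<close>.
\<close>

definition soft_O_bound :: "real \<Rightarrow> nat \<Rightarrow> real \<Rightarrow> real" where
  "soft_O_bound C k f = C * f * ln (2 + f) ^ k"

end

theory Submission
  imports Defs "HOL-Analysis.Convex" "Jordan_Normal_Form.Determinant"
begin

text \<open>
  Instead of the weights of a Loewner-John ellipsoid the proof grows the set \<open>S\<close> directly. Let \<open>K\<close> be
  the Gram matrix of the selected rows and \<open>H = K\<^sup>-\<^sup>1\<close>. A row \<open>a\<close> is the combination of the selected
  rows \<open>s\<close> with coefficients \<open>s \<bullet> H a\<close>, whose squared norm is the leverage \<open>a \<bullet> H a\<close>. So it suffices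
  to make all leverages at most 1, and the algorithm adds the row of largest leverage until this holds.

  Adding a row of leverage \<open>\<lambda>\<close> multiplies \<open>det K\<close> by \<open>1 + \<lambda>\<close>. On the other hand, if all leverages
  are at most \<open>\<lambda>\<close>, then \<open>t\<close> further rows multiply it by at most \<open>(1 + t \<lambda> / d) ^ d\<close>, by Hadamard and AM-GM.
  Comparing the two for \<open>t = 2 d\<close> shows that \<open>2 d\<close> steps roughly replace \<open>\<lambda>\<close> by \<open>sqrt (2 \<lambda>)\<close>.
  The initial basis comes from simplex pivoting with the row of maximal entry in each coordinate;
  in suitable coordinates all rows then have entries at most 1 while \<open>det K = 1\<close>, so that \<open>\<lambda>\<close> is of order
  \<open>sqrt d\<close> after the first \<open>2 d\<close> steps and at most 1 after \<open>O(log log d)\<close> rounds. If the rows do not span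
  \<open>\<real>\<^sup>d\<close>, unit vectors complete the basis; they stay \<open>H\<close>-orthogonal to all rows and get coefficient 0.

  Each step costs \<open>O(nnz A + d\<^sup>2)\<close>, because the rank-one updates of \<open>H\<close> and of the leverages need only
  one product of \<open>A\<close> with a vector.
\<close>

section \<open>Determinants and Hadamard's inequality\<close>

text \<open>The bound \<open>O(d log log d)\<close> needs the leverages to be a power of
  \<open>d\<close> early on, and the pivot basis alone does not give that. In the coordinates
  \<open>F\<close> it is unit triangular with entries at most 1, but the inverse of such a matrix
  can have entries of order \<open>2 ^ d\<close>; halving the logarithm of the leverage from there
  would take about \<open>log d\<close> rounds. So the first round measures determinants in the
  fixed coordinates \<open>F\<close> and not relative to the initial leverages: \<open>3 * d\<close>
  vectors with entries at most 1 have Gram determinant at most \<open>(3 * d) ^ d\<close>, however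
  badly conditioned the basis is.

  The threshold 1 has two reasons. It is what the norm bound asks for, since a leverage is the
  squared norm of a coefficient vector. And selected vectors always have leverage at most 1, so a
  row above the threshold is new and no row is taken twice.\<close>

definition fdet :: "nat \<Rightarrow> (nat \<Rightarrow> nat \<Rightarrow> real) \<Rightarrow> real" where
  "fdet n G = det (mat n n (\<lambda>(i, j). G i j))"

lemma sum_delta_mult:
  fixes f :: "nat \<Rightarrow> real"
  shows "(\<Sum>k<n. (if i = k then 1 else 0) * f k) = (if i < n then f i else 0)"
    and "(\<Sum>k<n. (if k = i then 1 else 0) * f k) = (if i < n then f i else 0)"
    and "(\<Sum>k<n. f k * (if i = k then 1 else 0)) = (if i < n then f i else 0)"
    and "(\<Sum>k<n. f k * (if k = i then 1 else 0)) = (if i < n then f i else 0)"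
  by (induction n) (auto simp: less_Suc_eq)

lemma fdet_cong:
  assumes "\<And>i j. i < n \<Longrightarrow> j < n \<Longrightarrow> G i j = H i j"
  shows "fdet n G = fdet n H"
  unfolding fdet_def by (rule arg_cong[where f = det]) (auto simp: assms)

lemma fdet_mult: "fdet n (\<lambda>i j. \<Sum>k<n. G i k * H k j) = fdet n G * fdet n H"
proof -
  have "mat n n (\<lambda>(i, j). \<Sum>k<n. G i k * H k j) =
      mat n n (\<lambda>(i, j). G i j) * mat n n (\<lambda>(i, j). H i j)"
    by (rule eq_matI) (auto simp: scalar_prod_def lessThan_atLeast0)
  then show ?thesis
    unfolding fdet_def by (simp add: det_mult[of _ n])
qed

lemma fdet_transpose: "fdet n (\<lambda>i j. G j i) = fdet n G"
proof -
  have "mat n n (\<lambda>(i, j). G j i) = transpose_mat (mat n n (\<lambda>(i, j). G i j))"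
    by (rule eq_matI) auto
  then show ?thesis
    unfolding fdet_def by (simp add: det_transpose[of _ n])
qed

lemma fdet_upper_triangular:
  assumes "\<And>i j. j < i \<Longrightarrow> i < n \<Longrightarrow> G i j = 0"
  shows "fdet n G = (\<Prod>i<n. G i i)"
  unfolding fdet_def
  by (subst det_upper_triangular[of _ n])
    (auto intro!: upper_triangularI prod.cong simp: assms prod_list_diag_prod lessThan_atLeast0)

lemma fdet_lower_triangular:
  assumes "\<And>i j. i < j \<Longrightarrow> j < n \<Longrightarrow> G i j = 0"
  shows "fdet n G = (\<Prod>i<n. G i i)"
  using fdet_upper_triangular[of n "\<lambda>i j. G j i"] assms unfolding fdet_transpose[of n G] by simp

lemma fdet_identity: "fdet n (\<lambda>i j. if i = j then 1 else 0) = 1"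
  by (subst fdet_upper_triangular) auto

section \<open>Elimination, Schur complements and rank-one updates\<close>

lemma fdet_first_column_zero:
  assumes "\<And>i. i < n \<Longrightarrow> G (Suc i) 0 = 0"
  shows "fdet (Suc n) G = G 0 0 * fdet n (\<lambda>i j. G (Suc i) (Suc j))"
proof -
  have "mat (Suc n) (Suc n) (\<lambda>(i, j). G i j) =
      four_block_mat (mat 1 1 (\<lambda>_. G 0 0)) (mat 1 n (\<lambda>(i, j). G 0 (Suc j)))
        (0\<^sub>m n 1) (mat n n (\<lambda>(i, j). G (Suc i) (Suc j)))"
  proof (rule eq_matI)
    fix i j
    assume "i < dim_row (four_block_mat (mat 1 1 (\<lambda>_. G 0 0)) (mat 1 n (\<lambda>(i, j). G 0 (Suc j)))
        (0\<^sub>m n 1) (mat n n (\<lambda>(i, j). G (Suc i) (Suc j))))"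
      and "j < dim_col (four_block_mat (mat 1 1 (\<lambda>_. G 0 0)) (mat 1 n (\<lambda>(i, j). G 0 (Suc j)))
        (0\<^sub>m n 1) (mat n n (\<lambda>(i, j). G (Suc i) (Suc j))))"
    then show "mat (Suc n) (Suc n) (\<lambda>(i, j). G i j) $$ (i, j) =
      four_block_mat (mat 1 1 (\<lambda>_. G 0 0)) (mat 1 n (\<lambda>(i, j). G 0 (Suc j)))
        (0\<^sub>m n 1) (mat n n (\<lambda>(i, j). G (Suc i) (Suc j))) $$ (i, j)"
      by (cases i; cases j) (auto simp: assms)
  qed auto
  then have "fdet (Suc n) G = det (mat 1 1 (\<lambda>_. G 0 0)) * fdet n (\<lambda>i j. G (Suc i) (Suc j))"
    unfolding fdet_def
    using det_four_block_mat_lower_left_zero_col[of "mat 1 1 (\<lambda>_. G 0 0)" "mat 1 n (\<lambda>(i, j). G 0 (Suc j))" n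
        "0\<^sub>m n 1" "mat n n (\<lambda>(i, j). G (Suc i) (Suc j))"] by simp
  then show ?thesis
    by (simp add: det_single)
qed

lemma fdet_Schur_complement:
  assumes "G 0 0 \<noteq> 0"
  shows "fdet (Suc n) G =
    G 0 0 * fdet n (\<lambda>i j. G (Suc i) (Suc j) - G (Suc i) 0 * G 0 (Suc j) / G 0 0)"
proof -
  \<comment> \<open>Gaussian elimination of column 0 as a matrix: \<open>L\<close> is unit lower
    triangular, so multiplying by it preserves the determinant.\<close>
  define L :: "nat \<Rightarrow> nat \<Rightarrow> real"
    where "L i j = (if i = j then 1 else if j = 0 then - G i 0 / G 0 0 else 0)" for i j
  have L: "(\<Sum>k<Suc n. L i k * G k j) = (if i = 0 then G 0 j else G i j - G i 0 * G 0 j / G 0 0)"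
    if "i < Suc n" for i j
  proof (cases "i = 0")
    case True
    then show ?thesis
      by (subst sum.remove[of _ 0]) (auto simp: L_def intro!: sum.neutral)
  next
    case False
    have "(\<Sum>k<Suc n. L i k * G k j) = L i 0 * G 0 j + (L i i * G i j + (\<Sum>k\<in>{..<Suc n} - {0} - {i}. L i k * G k j))"
      using False that by (subst sum.remove[of _ 0], simp, simp, subst sum.remove[of _ i]) auto
    also have "(\<Sum>k\<in>{..<Suc n} - {0} - {i}. L i k * G k j) = 0"
      by (rule sum.neutral) (auto simp: L_def)
    finally show ?thesis
      using False by (simp add: L_def)
  qed
  have "fdet (Suc n) L = 1"
    by (subst fdet_lower_triangular) (auto simp: L_def)
  then have "fdet (Suc n) G = fdet (Suc n) (\<lambda>i j. \<Sum>k<Suc n. L i k * G k j)"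
    unfolding fdet_mult by simp
  also have "\<dots> = fdet (Suc n) (\<lambda>i j. if i = 0 then G 0 j else G i j - G i 0 * G 0 j / G 0 0)"
    by (rule fdet_cong) (rule L)
  also have "\<dots> = G 0 0 * fdet n (\<lambda>i j. G (Suc i) (Suc j) - G (Suc i) 0 * G 0 (Suc j) / G 0 0)"
    by (subst fdet_first_column_zero) (use assms in auto)
  finally show ?thesis .
qed

lemma fdet_rank_one_update:
  "fdet n (\<lambda>i j. (if i = j then 1 else 0) + u i * v j) = 1 + (\<Sum>k<n. u k * v k)"
proof -
  \<comment> \<open>Both sides are determinants of the bordered matrix \<open>M\<close>, eliminated from either side.\<close>
  define M :: "nat \<Rightarrow> nat \<Rightarrow> real" where
    "M = (\<lambda>i j. case i of 0 \<Rightarrow> (case j of 0 \<Rightarrow> 1 | Suc j \<Rightarrow> - v j)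
       | Suc i \<Rightarrow> (case j of 0 \<Rightarrow> u i | Suc j \<Rightarrow> if i = j then 1 else 0))"
  define L :: "nat \<Rightarrow> nat \<Rightarrow> real" where
    "L = (\<lambda>i j. case i of 0 \<Rightarrow> (case j of 0 \<Rightarrow> 1 | Suc j \<Rightarrow> 0)
       | Suc i \<Rightarrow> (case j of 0 \<Rightarrow> u i | Suc j \<Rightarrow> if i = j then 1 else 0))"
  define U :: "nat \<Rightarrow> nat \<Rightarrow> real" where
    "U = (\<lambda>i j. case i of 0 \<Rightarrow> (case j of 0 \<Rightarrow> 1 + (\<Sum>k<n. u k * v k) | Suc j \<Rightarrow> - v j)
       | Suc i \<Rightarrow> (case j of 0 \<Rightarrow> 0 | Suc j \<Rightarrow> if i = j then 1 else 0))"
  have "fdet (Suc n) M = fdet n (\<lambda>i j. (if i = j then 1 else 0) + u i * v j)"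
    by (subst fdet_Schur_complement) (simp_all add: M_def)
  moreover have "fdet (Suc n) M = fdet (Suc n) (\<lambda>i j. \<Sum>k<Suc n. U i k * L k j)"
  proof (rule fdet_cong)
    fix i j
    assume ij: "i < Suc n" "j < Suc n"
    show "M i j = (\<Sum>k<Suc n. U i k * L k j)"
      using ij unfolding sum.lessThan_Suc_shift
      by (cases i; cases j)
        (simp_all add: M_def U_def L_def sum_delta_mult sum_negf mult.commute del: sum.lessThan_Suc)
  qed
  moreover have "fdet (Suc n) L = 1"
  proof (subst fdet_lower_triangular)
    show "L i j = 0" if "i < j" "j < Suc n" for i j
      using that by (cases i; cases j) (simp_all add: L_def)
    show "(\<Prod>i<Suc n. L i i) = 1"
      by (simp add: L_def prod.lessThan_Suc_shift del: prod.lessThan_Suc)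
  qed
  moreover have "fdet (Suc n) U = 1 + (\<Sum>k<n. u k * v k)"
  proof (subst fdet_upper_triangular)
    show "U i j = 0" if "j < i" "i < Suc n" for i j
      using that by (cases i; cases j) (simp_all add: U_def)
    show "(\<Prod>i<Suc n. U i i) = 1 + (\<Sum>k<n. u k * v k)"
      by (simp add: U_def prod.lessThan_Suc_shift del: prod.lessThan_Suc)
  qed
  ultimately show ?thesis
    unfolding fdet_mult by simp
qed

text \<open>Induction over Schur complements. Eliminating the first index keeps the matrix positive
  definite and lowers each remaining diagonal entry by a square over the pivot, so the product of
  the pivots is at most that of the original diagonal. Positivity of the diagonal is part of the
  claim so that the two products can be compared factor by factor.\<close>

lemma Hadamard_pos_def:
  assumes "\<And>i j. i < n \<Longrightarrow> j < n \<Longrightarrow> G i j = G j i"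
    and "\<And>x k. k < n \<Longrightarrow> x k \<noteq> 0 \<Longrightarrow> 0 < (\<Sum>i<n. \<Sum>j<n. x i * G i j * x j)"
  shows "0 < fdet n G \<and> fdet n G \<le> (\<Prod>i<n. G i i) \<and> (\<forall>i<n. 0 < G i i)"
  using assms
proof (induction n arbitrary: G)
  case 0
  then show ?case by (simp add: fdet_def)
next
  case (Suc n)
  define S where "S i j = G (Suc i) (Suc j) - G (Suc i) 0 * G 0 (Suc j) / G 0 0" for i j
  have diag: "0 < G k k" if "k < Suc n" for k
  proof -
    have "0 < (\<Sum>i<Suc n. \<Sum>j<Suc n. (if i = k then 1 else 0) * G i j * (if j = k then 1 else 0))"
      by (rule Suc.prems(2)[of k]) (use that in auto)
    also have "\<dots> = G k k"
      unfolding sum_delta_mult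
      using that by (simp add: mult.assoc flip: sum_distrib_left del: sum.lessThan_Suc add: sum_delta_mult)
    finally show ?thesis .
  qed
  then have g: "0 < G 0 0" by simp
  have S: "0 < fdet n S \<and> fdet n S \<le> (\<Prod>i<n. S i i) \<and> (\<forall>i<n. 0 < S i i)"
  proof (rule Suc.IH)
    show "S i j = S j i" if "i < n" "j < n" for i j
      using Suc.prems(1)[of "Suc i" "Suc j"] Suc.prems(1)[of 0 "Suc j"] Suc.prems(1)[of 0 "Suc i"] that
      by (simp add: S_def)
  next
    fix x :: "nat \<Rightarrow> real" and k
    assume k: "k < n" "x k \<noteq> 0"
    define w where "w = (\<Sum>j<n. G 0 (Suc j) * x j)"
    \<comment> \<open>The first coordinate is the one that minimizes the form of \<open>G\<close>;
      completing the square turns the value of \<open>G\<close> at \<open>y\<close> into that of the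
      Schur complement at \<open>x\<close>.\<close>
    define y where "y i = (case i of 0 \<Rightarrow> - w / G 0 0 | Suc i \<Rightarrow> x i)" for i
    have w': "(\<Sum>i<n. x i * G (Suc i) 0) = w"
      unfolding w_def by (rule sum.cong) (use Suc.prems(1)[of 0] in auto)
    have w2: "(\<Sum>i<n. \<Sum>j<n. x i * (G (Suc i) 0 * G 0 (Suc j) / G 0 0) * x j) = w * w / G 0 0"
    proof -
      have "(\<Sum>i<n. \<Sum>j<n. x i * (G (Suc i) 0 * G 0 (Suc j) / G 0 0) * x j) =
          (\<Sum>i<n. \<Sum>j<n. (x i * G (Suc i) 0) * (G 0 (Suc j) * x j)) / G 0 0"
        by (simp add: sum_divide_distrib mult_ac)
      also have "(\<Sum>i<n. \<Sum>j<n. (x i * G (Suc i) 0) * (G 0 (Suc j) * x j)) = w * w"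
        by (simp add: sum_product[symmetric] w' w_def)
      finally show ?thesis .
    qed
    have "0 < (\<Sum>i<Suc n. \<Sum>j<Suc n. y i * G i j * y j)"
      by (rule Suc.prems(2)[of "Suc k"]) (use k in \<open>auto simp: y_def\<close>)
    also have "\<dots> = y 0 * G 0 0 * y 0 + y 0 * (\<Sum>j<n. G 0 (Suc j) * x j)
        + (\<Sum>i<n. x i * G (Suc i) 0) * y 0 + (\<Sum>i<n. \<Sum>j<n. x i * G (Suc i) (Suc j) * x j)"
      unfolding sum.lessThan_Suc_shift
      by (simp add: sum.distrib sum_distrib_left sum_distrib_right sum_subtractf sum_negf y_def mult_ac)
    also have "\<dots> = (\<Sum>i<n. \<Sum>j<n. x i * G (Suc i) (Suc j) * x j) - w * w / G 0 0"
      unfolding w' w_def[symmetric] using g by (simp add: y_def field_simps)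
    also have "\<dots> = (\<Sum>i<n. \<Sum>j<n. x i * S i j * x j)"
      unfolding w2[symmetric] by (simp add: S_def right_diff_distrib left_diff_distrib sum_subtractf)
    finally show "0 < (\<Sum>i<n. \<Sum>j<n. x i * S i j * x j)" .
  qed
  have le: "S i i \<le> G (Suc i) (Suc i)" if "i < n" for i
    using Suc.prems(1)[of "Suc i" 0] that g by (simp add: S_def)
  have "(\<Prod>i<n. S i i) \<le> (\<Prod>i<n. G (Suc i) (Suc i))"
    by (rule prod_mono) (use S le in \<open>auto intro: less_imp_le\<close>)
  then have "G 0 0 * fdet n S \<le> G 0 0 * (\<Prod>i<n. G (Suc i) (Suc i))"
    using S g by (intro mult_left_mono) auto
  moreover have "fdet (Suc n) G = G 0 0 * fdet n S"
    using g by (subst fdet_Schur_complement) (auto simp: S_def[abs_def])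
  ultimately show ?case
    using S g diag by (simp add: prod.lessThan_Suc_shift del: prod.lessThan_Suc)
qed

text \<open>AM-GM on the diagonal in Hadamard's inequality. The trace is the useful quantity because
  for a Gram matrix it is the sum of the squared lengths of the vectors, to which every vector
  contributes separately.\<close>

lemma fdet_le_trace_power:
  assumes "0 < n" "\<And>i j. i < n \<Longrightarrow> j < n \<Longrightarrow> G i j = G j i"
    and "\<And>x k. k < n \<Longrightarrow> x k \<noteq> 0 \<Longrightarrow> 0 < (\<Sum>i<n. \<Sum>j<n. x i * G i j * x j)"
  shows "fdet n G \<le> ((\<Sum>i<n. G i i) / real n) ^ n"
proof -
  have H: "0 < fdet n G \<and> fdet n G \<le> (\<Prod>i<n. G i i) \<and> (\<forall>i<n. 0 < G i i)"
    by (rule Hadamard_pos_def) (use assms in auto)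
  have "root n (\<Prod>i<n. G i i) \<le> (\<Sum>i<n. G i i) / real n"
    using arith_geom_mean[of "{..<n}" "\<lambda>i. G i i"] assms(1) H
    by (auto simp: root_powr_inverse prod_pos less_imp_le lessThan_empty_iff sum_divide_distrib)
  then have "root n (\<Prod>i<n. G i i) ^ n \<le> ((\<Sum>i<n. G i i) / real n) ^ n"
    using H by (intro power_mono real_root_ge_zero prod_nonneg) (auto intro: less_imp_le)
  moreover have "root n (\<Prod>i<n. G i i) ^ n = (\<Prod>i<n. G i i)"
    using assms(1) H by (intro real_root_pow_pos2 prod_nonneg) (auto intro: less_imp_le)
  ultimately show ?thesis
    using H by simp
qed

section \<open>Gram matrices and leverages\<close>

lemma fdet_nonzero_kernel:
  assumes "fdet n G \<noteq> 0" and "\<And>i. i < n \<Longrightarrow> (\<Sum>j<n. G i j * x j) = 0" and "k < n"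
  shows "x k = 0"
proof (rule ccontr)
  assume "x k \<noteq> 0"
  define v where "v = vec n x"
  have "v \<noteq> 0\<^sub>v n"
    using \<open>x k \<noteq> 0\<close> \<open>k < n\<close> unfolding v_def by (metis index_vec index_zero_vec(1))
  moreover have "mat n n (\<lambda>(i, j). G i j) *\<^sub>v v = 0\<^sub>v n"
    by (rule eq_vecI) (auto simp: v_def scalar_prod_def assms(2) lessThan_atLeast0[symmetric])
  moreover have "v \<in> carrier_vec n"
    by (simp add: v_def)
  ultimately have "det (mat n n (\<lambda>(i, j). G i j)) = 0"
    using det_0_iff_vec_prod_zero_field[of "mat n n (\<lambda>(i, j). G i j)" n] mat_carrier by metis
  then show False
    using assms(1) by (simp add: fdet_def)
qed

section \<open>Leverages and inverse Gram matrices\<close>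

definition ip :: "nat \<Rightarrow> (nat \<Rightarrow> real) \<Rightarrow> (nat \<Rightarrow> real) \<Rightarrow> real" where
  "ip d x y = (\<Sum>q<d. x q * y q)"

definition mv :: "nat \<Rightarrow> (nat \<Rightarrow> nat \<Rightarrow> real) \<Rightarrow> (nat \<Rightarrow> real) \<Rightarrow> nat \<Rightarrow> real" where
  "mv d H x = (\<lambda>p. ip d (H p) x)"

definition leverage :: "nat \<Rightarrow> (nat \<Rightarrow> nat \<Rightarrow> real) \<Rightarrow> (nat \<Rightarrow> real) \<Rightarrow> real" where
  "leverage d H x = ip d x (mv d H x)"

definition gram :: "('s \<Rightarrow> nat \<Rightarrow> real) \<Rightarrow> 's set \<Rightarrow> nat \<Rightarrow> nat \<Rightarrow> real" where
  "gram b S p q = (\<Sum>s\<in>S. b s p * b s q)"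

lemma ip_commute: "ip d x y = ip d y x"
  by (simp add: ip_def mult.commute)

lemma mv_gram: "mv d (gram b S) x p = (\<Sum>s\<in>S. ip d (b s) x * b s p)"
proof -
  have "mv d (gram b S) x p = (\<Sum>q<d. \<Sum>s\<in>S. b s p * b s q * x q)"
    by (simp add: mv_def ip_def gram_def sum_distrib_right)
  also have "\<dots> = (\<Sum>s\<in>S. \<Sum>q<d. b s p * b s q * x q)"
    by (rule sum.swap)
  also have "\<dots> = (\<Sum>s\<in>S. ip d (b s) x * b s p)"
    by (simp add: ip_def sum_distrib_left mult_ac)
  finally show ?thesis .
qed

lemma ip_mv_gram: "ip d x (mv d (gram b S) x) = (\<Sum>s\<in>S. (ip d (b s) x)\<^sup>2)"
proof -
  have "ip d x (mv d (gram b S) x) = (\<Sum>p<d. \<Sum>s\<in>S. ip d (b s) x * (b s p * x p))"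
    by (simp add: ip_def[of d x] mv_gram sum_distrib_left mult_ac)
  also have "\<dots> = (\<Sum>s\<in>S. \<Sum>p<d. ip d (b s) x * (b s p * x p))"
    by (rule sum.swap)
  also have "\<dots> = (\<Sum>s\<in>S. (ip d (b s) x)\<^sup>2)"
    by (simp add: sum_distrib_left[symmetric] ip_def[symmetric] power2_eq_square)
  finally show ?thesis .
qed

text \<open>The factorization \<open>H = R\<^sup>T R\<close> makes \<open>R\<close> a change of basis that turns \<open>H\<close>-norms into
  Euclidean ones, which is what Hadamard's inequality needs.\<close>

definition inverse_gram ::
  "nat \<Rightarrow> ('s \<Rightarrow> nat \<Rightarrow> real) \<Rightarrow> 's set \<Rightarrow> (nat \<Rightarrow> nat \<Rightarrow> real) \<Rightarrow> bool" where
  "inverse_gram d b S H \<longleftrightarrow>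
     (\<forall>p<d. \<forall>r<d. (\<Sum>q<d. gram b S p q * H q r) = (if p = r then 1 else 0)) \<and>
     (\<exists>R. \<forall>p<d. \<forall>q<d. H p q = (\<Sum>l<d. R l p * R l q))"

text \<open>The Sherman-Morrison formula for the inverse after adding \<open>x\<close>. It is a
  relation on indices below \<open>d\<close> because the matrices will be read off program memory,
  where nothing more is guaranteed.\<close>

definition rank_one_step ::
  "nat \<Rightarrow> (nat \<Rightarrow> nat \<Rightarrow> real) \<Rightarrow> (nat \<Rightarrow> real) \<Rightarrow> (nat \<Rightarrow> nat \<Rightarrow> real) \<Rightarrow> bool" where
  "rank_one_step d H x H' \<longleftrightarrow>
     (\<forall>p<d. \<forall>q<d. H' p q = H p q - mv d H x p * mv d H x q / (1 + leverage d H x))"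

lemma ip_factor:
  assumes "\<forall>p<d. \<forall>q<d. H p q = (\<Sum>l<d. R l p * R l q)"
  shows "p < d \<Longrightarrow> mv d H x p = (\<Sum>l<d. R l p * ip d (R l) x)"
    and "ip d x (mv d H y) = (\<Sum>l<d. ip d (R l) x * ip d (R l) y)"
proof -
  show *: "mv d H y p = (\<Sum>l<d. R l p * ip d (R l) y)" if "p < d" for p y
  proof -
    have "mv d H y p = (\<Sum>q<d. \<Sum>l<d. R l p * R l q * y q)"
      unfolding mv_def ip_def by (rule sum.cong) (use that assms in \<open>auto simp: sum_distrib_right\<close>)
    also have "\<dots> = (\<Sum>l<d. \<Sum>q<d. R l p * R l q * y q)"
      by (rule sum.swap)
    finally show ?thesis
      by (simp add: ip_def sum_distrib_left mult.assoc)
  qed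
  have "ip d x (mv d H y) = (\<Sum>p<d. \<Sum>l<d. ip d (R l) y * (R l p * x p))"
    unfolding ip_def[of d x] by (rule sum.cong) (auto simp: * sum_distrib_left mult_ac)
  also have "\<dots> = (\<Sum>l<d. \<Sum>p<d. ip d (R l) y * (R l p * x p))"
    by (rule sum.swap)
  also have "\<dots> = (\<Sum>l<d. ip d (R l) y * ip d (R l) x)"
    by (simp add: sum_distrib_left[symmetric] ip_def[of d _ x])
  also have "\<dots> = (\<Sum>l<d. ip d (R l) x * ip d (R l) y)"
    by (simp add: mult.commute)
  finally show "ip d x (mv d H y) = (\<Sum>l<d. ip d (R l) x * ip d (R l) y)" .
qed

lemma leverage_factor:
  assumes "\<forall>p<d. \<forall>q<d. H p q = (\<Sum>l<d. R l p * R l q)"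
  shows "leverage d H x = (\<Sum>l<d. (ip d (R l) x)\<^sup>2)"
  unfolding leverage_def ip_factor(2)[OF assms] by (simp add: power2_eq_square)

lemma leverage_nonneg:
  assumes "inverse_gram d b S H"
  shows "0 \<le> leverage d H x"
proof -
  obtain R where R: "\<forall>p<d. \<forall>q<d. H p q = (\<Sum>l<d. R l p * R l q)"
    using assms unfolding inverse_gram_def by blast
  show ?thesis
    unfolding leverage_factor[OF R] by (simp add: sum_nonneg)
qed

lemma inverse_gram_symmetric:
  assumes "inverse_gram d b S H" "p < d" "q < d"
  shows "H p q = H q p"
proof -
  obtain R where "\<forall>p<d. \<forall>q<d. H p q = (\<Sum>l<d. R l p * R l q)"
    using assms unfolding inverse_gram_def by blast
  then show ?thesis
    using assms(2,3) by (simp add: mult.commute)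
qed

lemma gram_inverse_gram:
  assumes "inverse_gram d b S H" "p < d"
  shows "mv d (gram b S) (mv d H x) p = x p"
proof -
  have "mv d (gram b S) (mv d H x) p = (\<Sum>q<d. \<Sum>r<d. gram b S p q * H q r * x r)"
    by (simp add: mv_def ip_def sum_distrib_left mult_ac)
  also have "\<dots> = (\<Sum>r<d. (\<Sum>q<d. gram b S p q * H q r) * x r)"
    by (subst sum.swap) (simp add: sum_distrib_right)
  also have "\<dots> = (\<Sum>r<d. (if p = r then 1 else 0) * x r)"
    by (rule sum.cong) (use assms in \<open>auto simp: inverse_gram_def\<close>)
  finally show ?thesis
    using assms(2) by (simp add: sum_delta_mult)
qed

lemma inverse_gram_expansion:
  assumes "inverse_gram d b S H" "p < d"
  shows "x p = (\<Sum>s\<in>S. ip d (b s) (mv d H x) * b s p)"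
  using gram_inverse_gram[OF assms] unfolding mv_gram by simp

lemma leverage_sum_squares:
  assumes "inverse_gram d b S H"
  shows "leverage d H x = (\<Sum>s\<in>S. (ip d (b s) (mv d H x))\<^sup>2)"
proof -
  have "leverage d H x = ip d (mv d H x) (mv d (gram b S) (mv d H x))"
    unfolding leverage_def ip_commute[of d x]
    by (simp add: ip_def[of d "mv d H x"] gram_inverse_gram[OF assms])
  then show ?thesis
    by (simp add: ip_mv_gram)
qed

text \<open>The leverage \<lambda> of \<open>b s\<close> is a sum of squares over \<open>S\<close>,
  and \<lambda> itself is the base of one of them. Hence \<lambda> squared is at most
  \<lambda>.\<close>

lemma leverage_le_1:
  assumes "inverse_gram d b S H" "finite S" "s \<in> S"
  shows "leverage d H (b s) \<le> 1"
proof -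
  have "(leverage d H (b s))\<^sup>2 \<le> (\<Sum>s'\<in>S. (ip d (b s') (mv d H (b s)))\<^sup>2)"
    unfolding leverage_def by (rule member_le_sum) (use assms in auto)
  then have "leverage d H (b s) * leverage d H (b s) \<le> 1 * leverage d H (b s)"
    using leverage_sum_squares[OF assms(1), of "b s"] by (simp add: power2_eq_square)
  then show ?thesis
    using leverage_nonneg[OF assms(1), of "b s"]
    by (metis mult_right_le_imp_le order_le_less zero_le_one)
qed

section \<open>Rank-one updates of inverse and determinant\<close>

lemma rank_one_step_mv:
  assumes "rank_one_step d H x H'" "p < d"
  shows "mv d H' y p = mv d H y p - mv d H x p * ip d y (mv d H x) / (1 + leverage d H x)"
proof -
  have "mv d H' y p = (\<Sum>q<d. H p q * y q - mv d H x p * (y q * mv d H x q) / (1 + leverage d H x))"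
    unfolding mv_def[of d H'] ip_def[of d "H' p"]
    by (rule sum.cong) (use assms in \<open>auto simp: rank_one_step_def left_diff_distrib right_diff_distrib mult_ac\<close>)
  then show ?thesis
    by (simp add: sum_subtractf mv_def[of d H y] ip_def[of d "H p"] ip_def[of d y] sum_distrib_left sum_divide_distrib)
qed

text \<open>All leverages change through the one vector \<open>mv d H x\<close>, so a single product
  of the matrix with it refreshes them; and each change is a decrease.\<close>

lemma rank_one_step_leverage:
  assumes "rank_one_step d H x H'"
  shows "leverage d H' y = leverage d H y - (ip d y (mv d H x))\<^sup>2 / (1 + leverage d H x)"
proof -
  have "leverage d H' y = (\<Sum>p<d. y p * mv d H y p -
      (y p * mv d H x p) * ip d y (mv d H x) / (1 + leverage d H x))"
    unfolding leverage_def[of d H'] ip_def[of d y "mv d H' y"]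
    by (rule sum.cong) (auto simp: rank_one_step_mv[OF assms] right_diff_distrib mult_ac)
  also have "\<dots> = leverage d H y - (\<Sum>p<d. y p * mv d H x p) * ip d y (mv d H x) / (1 + leverage d H x)"
    by (simp add: sum_subtractf leverage_def[of d H y] ip_def[of d y "mv d H y"] sum_distrib_right sum_divide_distrib)
  finally show ?thesis
    by (simp add: ip_def[symmetric] power2_eq_square)
qed

lemma gram_insert:
  assumes "finite S" "s \<notin> S"
  shows "gram b (insert s S) p q = b s p * b s q + gram b S p q"
  using assms by (simp add: gram_def)

lemma inverse_gram_insert:
  assumes inv: "inverse_gram d b S H" and S: "finite S" "s \<notin> S" and step: "rank_one_step d H (b s) H'"
  shows "inverse_gram d b (insert s S) H'"
proof -
  define x where "x = b s"
  define w where "w = mv d H x"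
  define l where "l = leverage d H x"
  have l0: "0 \<le> l"
    unfolding l_def by (rule leverage_nonneg[OF inv])
  have H': "H' p q = H p q - w p * w q / (1 + l)" if "p < d" "q < d" for p q
    using step that by (simp add: rank_one_step_def w_def l_def x_def)
  have Kw: "(\<Sum>q<d. gram b S p q * w q) = x p" if "p < d" for p
    using gram_inverse_gram[OF inv that, of x] by (simp add: mv_def[of d "gram b S"] ip_def w_def)
  have xH: "(\<Sum>q<d. x q * H q r) = w r" if "r < d" for r
    unfolding w_def mv_def ip_def
    by (rule sum.cong) (use inverse_gram_symmetric[OF inv] that in \<open>auto simp: mult.commute\<close>)
  have xw: "(\<Sum>q<d. x q * w q) = l"
    by (simp add: l_def leverage_def ip_def w_def)
  have "(\<Sum>q<d. gram b (insert s S) p q * H' q r) = (if p = r then 1 else 0)" if "p < d" "r < d" for p r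
  proof -
    have "(\<Sum>q<d. gram b (insert s S) p q * H' q r) =
        (\<Sum>q<d. gram b S p q * H q r - gram b S p q * w q * (w r / (1 + l))
          + x p * (x q * H q r) - x p * (x q * w q * (w r / (1 + l))))"
      by (rule sum.cong) (use that in \<open>auto simp: gram_insert S H' x_def[symmetric] algebra_simps\<close>)
    also have "\<dots> = (if p = r then 1 else 0) - x p * (w r / (1 + l)) + x p * w r - x p * (l * (w r / (1 + l)))"
      using inv that unfolding inverse_gram_def
      by (simp add: sum_subtractf sum.distrib sum_distrib_left[symmetric] sum_distrib_right[symmetric] Kw xH xw
          del: times_divide_eq_right times_divide_eq_left)
    also have "\<dots> = (if p = r then 1 else 0)"
      using l0 by (simp add: divide_simps) (simp add: algebra_simps)
    finally show ?thesis .
  qed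
  moreover have "\<exists>R. \<forall>p<d. \<forall>q<d. H' p q = (\<Sum>l<d. R l p * R l q)"
  proof -
    from inv obtain R where R: "\<forall>p<d. \<forall>q<d. H p q = (\<Sum>l<d. R l p * R l q)"
      unfolding inverse_gram_def by blast
    define y where "y k = ip d (R k) x" for k
    define t where "t = sqrt (1 + l)"
    \<comment> \<open>The new factor is \<open>(I - \<beta> y y\<^sup>T) R\<close> with
      \<open>y = R x\<close>, so \<beta> must solve
      \<open>2 * \<beta> - \<beta>\<^sup>2 * l = 1 / (1 + l)\<close>. The root is
      \<open>(1 - 1 / t) / l\<close>; written as \<open>1 / (t * (t + 1))\<close> it also covers
      \<open>l = 0\<close>.\<close>
    define \<beta> where "\<beta> = 1 / (t * (t + 1))"
    have t: "1 \<le> t" "t\<^sup>2 = 1 + l"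
      using l0 by (auto simp: t_def)
    have yl: "(\<Sum>k<d. y k * y k) = l"
      by (simp add: l_def leverage_factor[OF R] y_def power2_eq_square)
    have Ry: "(\<Sum>k<d. R k p * y k) = w p" if "p < d" for p
      using ip_factor(1)[OF R that, of x] by (simp add: y_def w_def)
    have "2 * \<beta> - \<beta>\<^sup>2 * (t\<^sup>2 - 1) = 1 / t\<^sup>2"
      unfolding \<beta>_def using t(1) by (simp add: divide_simps power2_eq_square) (simp add: algebra_simps)
    then have \<beta>: "2 * \<beta> - \<beta>\<^sup>2 * l = 1 / (1 + l)"
      by (simp add: t(2))
    have "H' p q = (\<Sum>k<d. (R k p - \<beta> * y k * w p) * (R k q - \<beta> * y k * w q))" if "p < d" "q < d" for p q
    proof -
      have "(\<Sum>k<d. (R k p - \<beta> * y k * w p) * (R k q - \<beta> * y k * w q)) =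
          (\<Sum>k<d. R k p * R k q - R k p * y k * (\<beta> * w q) - R k q * y k * (\<beta> * w p)
            + y k * y k * (\<beta>\<^sup>2 * w p * w q))"
        by (rule sum.cong) (auto simp: algebra_simps power2_eq_square)
      also have "\<dots> = H p q - w p * (\<beta> * w q) - w q * (\<beta> * w p) + l * (\<beta>\<^sup>2 * w p * w q)"
        using R that by (simp add: sum_subtractf sum.distrib sum_distrib_right[symmetric] Ry yl)
      also have "\<dots> = H p q - w p * w q * (2 * \<beta> - \<beta>\<^sup>2 * l)"
        by (simp add: algebra_simps)
      finally show ?thesis
        unfolding \<beta> using that by (simp add: H')
    qed
    then show ?thesis
      by (intro exI[of _ "\<lambda>k q. R k q - \<beta> * y k * w q"]) auto
  qed
  ultimately show ?thesis
    unfolding inverse_gram_def by blast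
qed

text \<open>With \<open>K\<close> the old Gram matrix, \<open>x = b s\<close> and \<open>w\<close>
  its image under \<open>H\<close>, the identity \<open>K w = x\<close> factors the new Gram matrix
  as \<open>K (I + w x\<^sup>T)\<close>, and the second factor is a rank-one update of the
  identity.\<close>

lemma fdet_gram_insert:
  assumes inv: "inverse_gram d b S H" and S: "finite S" "s \<notin> S"
  shows "fdet d (gram b (insert s S)) = fdet d (gram b S) * (1 + leverage d H (b s))"
proof -
  define w where "w = mv d H (b s)"
  have "fdet d (gram b (insert s S)) =
      fdet d (\<lambda>p q. \<Sum>k<d. gram b S p k * ((if k = q then 1 else 0) + w k * b s q))"
  proof (rule fdet_cong)
    fix p q
    assume pq: "p < d" "q < d"
    have "(\<Sum>k<d. gram b S p k * ((if k = q then 1 else 0) + w k * b s q)) =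
        (\<Sum>k<d. gram b S p k * (if k = q then 1 else 0)) + (\<Sum>k<d. gram b S p k * w k) * b s q"
      by (simp add: distrib_left sum.distrib sum_distrib_right mult.assoc)
    also have "(\<Sum>k<d. gram b S p k * w k) = b s p"
      using gram_inverse_gram[OF inv pq(1), of "b s"] by (simp add: mv_def[of d "gram b S"] ip_def w_def)
    finally show "gram b (insert s S) p q =
        (\<Sum>k<d. gram b S p k * ((if k = q then 1 else 0) + w k * b s q))"
      using pq by (simp add: gram_insert S sum_delta_mult)
  qed
  also have "\<dots> = fdet d (gram b S) * (1 + (\<Sum>k<d. w k * b s k))"
    unfolding fdet_mult fdet_rank_one_update ..
  finally show ?thesis
    by (simp add: leverage_def ip_def w_def mult.commute)
qed

text \<open>The left side is the determinant of the Gram matrix after the change of coordinates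
  \<open>F\<close>, and the sum on the right is its trace. The freedom in \<open>F\<close> serves
  two bounds: a factor of \<open>H\<close> makes squared lengths into leverages, while the recorded
  pivot functionals make all entries at most 1.\<close>

lemma fdet_gram_le:
  assumes d: "0 < d" and nz: "fdet d (gram b S) \<noteq> 0" "fdet d F \<noteq> 0"
  shows "(fdet d F)\<^sup>2 * fdet d (gram b S) \<le> ((\<Sum>s\<in>S. \<Sum>p<d. (ip d (F p) (b s))\<^sup>2) / real d) ^ d"
proof -
  define G where "G i j = (\<Sum>s\<in>S. ip d (F i) (b s) * ip d (F j) (b s))" for i j
  have GF: "G i j = (\<Sum>k<d. (\<Sum>l<d. F i l * gram b S l k) * F j k)" for i j
  proof -
    have "(\<Sum>k<d. (\<Sum>l<d. F i l * gram b S l k) * F j k) =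
        (\<Sum>k<d. \<Sum>l<d. F i l * (gram b S l k * F j k))"
      by (simp add: sum_distrib_right mult.assoc)
    also have "\<dots> = (\<Sum>l<d. \<Sum>k<d. F i l * (gram b S l k * F j k))"
      by (rule sum.swap)
    also have "\<dots> = (\<Sum>l<d. F i l * mv d (gram b S) (F j) l)"
      by (simp add: sum_distrib_left[symmetric] mv_def ip_def)
    also have "\<dots> = (\<Sum>l<d. \<Sum>s\<in>S. F i l * b s l * ip d (F j) (b s))"
      by (simp add: mv_gram sum_distrib_left ip_commute[of d "F j"] mult_ac)
    also have "\<dots> = G i j"
      unfolding G_def by (subst sum.swap) (simp add: sum_distrib_right[symmetric] ip_def)
    finally show ?thesis ..
  qed
  have "fdet d G = fdet d (\<lambda>i j. \<Sum>k<d. (\<Sum>l<d. F i l * gram b S l k) * F j k)"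
    by (rule fdet_cong) (rule GF)
  also have "\<dots> = (fdet d F)\<^sup>2 * fdet d (gram b S)"
    by (subst fdet_mult, subst fdet_mult, subst fdet_transpose) (simp add: power2_eq_square)
  finally have "(fdet d F)\<^sup>2 * fdet d (gram b S) = fdet d G" ..
  also have "fdet d G \<le> ((\<Sum>i<d. G i i) / real d) ^ d"
  proof (rule fdet_le_trace_power[OF d])
    show "G i j = G j i" for i j
      by (simp add: G_def mult.commute)
    fix x :: "nat \<Rightarrow> real" and k
    assume k: "k < d" "x k \<noteq> 0"
    \<comment> \<open>The form of \<open>G\<close> at \<open>x\<close> is that of the Gram matrix of
      the \<open>b s\<close> at \<open>y\<close>. If it vanished, \<open>y\<close> and then
      \<open>x\<close> would be annihilated by nonsingular matrices.\<close>
    define y where "y q = (\<Sum>i<d. x i * F i q)" for q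
    have y: "(\<Sum>i<d. x i * ip d (F i) z) = ip d z y" for z
      unfolding ip_def y_def sum_distrib_left
      by (subst sum.swap) (simp add: mult_ac)
    have "(\<Sum>i<d. \<Sum>j<d. x i * G i j * x j) =
        (\<Sum>i<d. \<Sum>j<d. \<Sum>s\<in>S. (x i * ip d (F i) (b s)) * (x j * ip d (F j) (b s)))"
      by (simp add: G_def sum_distrib_left sum_distrib_right mult_ac)
    also have "\<dots> = (\<Sum>i<d. \<Sum>s\<in>S. \<Sum>j<d. (x i * ip d (F i) (b s)) * (x j * ip d (F j) (b s)))"
      by (rule sum.cong[OF refl]) (rule sum.swap)
    also have "\<dots> = (\<Sum>s\<in>S. \<Sum>i<d. \<Sum>j<d. (x i * ip d (F i) (b s)) * (x j * ip d (F j) (b s)))"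
      by (rule sum.swap)
    also have "\<dots> = (\<Sum>s\<in>S. (ip d (b s) y)\<^sup>2)"
      by (simp add: sum_product[symmetric] y power2_eq_square)
    finally have eq: "(\<Sum>i<d. \<Sum>j<d. x i * G i j * x j) = (\<Sum>s\<in>S. (ip d (b s) y)\<^sup>2)" .
    have "(\<Sum>s\<in>S. (ip d (b s) y)\<^sup>2) \<noteq> 0"
    proof
      assume 0: "(\<Sum>s\<in>S. (ip d (b s) y)\<^sup>2) = 0"
      have "mv d (gram b S) y p = 0" for p
      proof (cases "finite S")
        case True
        then show ?thesis
          using 0 by (simp add: mv_gram sum_nonneg_eq_0_iff)
      qed (simp add: mv_gram)
      then have "y q = 0" if "q < d" for q
        using fdet_nonzero_kernel[OF nz(1), of y q] that by (simp add: mv_def ip_def)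
      then have "x k = 0"
        using fdet_nonzero_kernel[of d "\<lambda>i j. F j i" x k] nz(2) k(1)
        unfolding fdet_transpose[of d F] by (simp add: y_def mult.commute)
      then show False using k by simp
    qed
    moreover have "0 \<le> (\<Sum>s\<in>S. (ip d (b s) y)\<^sup>2)"
      by (rule sum_nonneg) simp
    ultimately show "0 < (\<Sum>i<d. \<Sum>j<d. x i * G i j * x j)"
      unfolding eq by simp
  qed
  also have "(\<Sum>i<d. G i i) = (\<Sum>s\<in>S. \<Sum>p<d. (ip d (F p) (b s))\<^sup>2)"
    unfolding G_def by (subst sum.swap) (simp add: power2_eq_square)
  finally show ?thesis .
qed

section \<open>Growth of the Gram determinant\<close>

lemma fdet_inverse_gram:
  assumes inv: "inverse_gram d b S H" and R: "\<forall>p<d. \<forall>q<d. H p q = (\<Sum>l<d. R l p * R l q)"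
  shows "(fdet d R)\<^sup>2 * fdet d (gram b S) = 1"
proof -
  have "fdet d (\<lambda>p r. \<Sum>q<d. gram b S p q * H q r) = fdet d (\<lambda>p r. if p = r then 1 else 0)"
    by (rule fdet_cong) (use inv in \<open>auto simp: inverse_gram_def\<close>)
  moreover have "fdet d H = fdet d (\<lambda>p q. \<Sum>l<d. R l p * R l q)"
    by (rule fdet_cong) (use R in auto)
  moreover have "fdet d (\<lambda>p q. \<Sum>l<d. R l p * R l q) = (fdet d R)\<^sup>2"
    unfolding fdet_mult fdet_transpose[of d R] by (simp add: power2_eq_square)
  ultimately show ?thesis
    unfolding fdet_mult fdet_identity by (simp only: mult.commute)
qed

lemma fdet_gram_pos:
  assumes "inverse_gram d b S H"
  shows "0 < fdet d (gram b S)"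
proof -
  obtain R where "\<forall>p<d. \<forall>q<d. H p q = (\<Sum>l<d. R l p * R l q)"
    using assms unfolding inverse_gram_def by blast
  then have "(fdet d R)\<^sup>2 * fdet d (gram b S) = 1"
    by (rule fdet_inverse_gram[OF assms])
  then show ?thesis
    using mult_nonneg_nonpos[of "(fdet d R)\<^sup>2" "fdet d (gram b S)"]
    by (cases "fdet d (gram b S) \<le> 0") auto
qed

text \<open>The sum is the trace of the Gram matrix times its inverse.\<close>

lemma sum_leverage:
  assumes "inverse_gram d b S H"
  shows "(\<Sum>s\<in>S. leverage d H (b s)) = real d"
proof -
  have "(\<Sum>s\<in>S. leverage d H (b s)) = (\<Sum>s\<in>S. \<Sum>p<d. \<Sum>q<d. b s p * b s q * H p q)"
    by (simp add: leverage_def mv_def ip_def sum_distrib_left mult_ac)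
  also have "\<dots> = (\<Sum>p<d. \<Sum>s\<in>S. \<Sum>q<d. b s p * b s q * H p q)"
    by (rule sum.swap)
  also have "\<dots> = (\<Sum>p<d. \<Sum>q<d. \<Sum>s\<in>S. b s p * b s q * H p q)"
    by (rule sum.cong[OF refl]) (rule sum.swap)
  also have "\<dots> = (\<Sum>p<d. \<Sum>q<d. gram b S p q * H q p)"
    by (intro sum.cong) (auto simp: gram_def sum_distrib_right inverse_gram_symmetric[OF assms])
  also have "\<dots> = (\<Sum>p<d. 1)"
    by (rule sum.cong) (use assms in \<open>auto simp: inverse_gram_def\<close>)
  finally show ?thesis by simp
qed

text \<open>Coordinates \<open>R\<close> with \<open>H = R\<^sup>T R\<close> normalize the old Gram
  determinant to 1 and make the leverage the squared length. The old vectors then contribute exactly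
  \<open>d\<close> to the trace and each new one at most \<open>L\<close>.\<close>

lemma fdet_gram_growth:
  assumes d: "0 < d" and inv: "inverse_gram d b S H" "inverse_gram d b S' H'"
    and S: "finite S'" "S \<subseteq> S'" and L: "\<And>s. s \<in> S' - S \<Longrightarrow> leverage d H (b s) \<le> L"
  shows "fdet d (gram b S') \<le> fdet d (gram b S) * (1 + real (card (S' - S)) * L / real d) ^ d"
proof -
  obtain R where R: "\<forall>p<d. \<forall>q<d. H p q = (\<Sum>l<d. R l p * R l q)"
    using inv unfolding inverse_gram_def by blast
  have 1: "(fdet d R)\<^sup>2 * fdet d (gram b S) = 1"
    by (rule fdet_inverse_gram[OF inv(1) R])
  have "(fdet d R)\<^sup>2 * fdet d (gram b S') \<le> ((\<Sum>s\<in>S'. \<Sum>p<d. (ip d (R p) (b s))\<^sup>2) / real d) ^ d"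
    by (rule fdet_gram_le) (use d 1 fdet_gram_pos[OF inv(2)] in auto)
  also have "(\<Sum>s\<in>S'. \<Sum>p<d. (ip d (R p) (b s))\<^sup>2) = (\<Sum>s\<in>S'. leverage d H (b s))"
    by (simp add: leverage_factor[OF R])
  also have "\<dots> = (\<Sum>s\<in>S' - S. leverage d H (b s)) + real d"
    using sum.subset_diff[OF S(2,1), of "\<lambda>s. leverage d H (b s)"] sum_leverage[OF inv(1)] by simp
  also have "(((\<Sum>s\<in>S' - S. leverage d H (b s)) + real d) / real d) ^ d
      \<le> ((real (card (S' - S)) * L + real d) / real d) ^ d"
    using sum_bounded_above[OF L, of "S' - S" "\<lambda>s. s"] leverage_nonneg[OF inv(1)]
    by (intro power_mono divide_right_mono add_right_mono divide_nonneg_nonneg add_nonneg_nonneg sum_nonneg) auto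
  also have "\<dots> = (1 + real (card (S' - S)) * L / real d) ^ d"
    using d by (simp add: add_divide_distrib add.commute)
  finally have "(fdet d R)\<^sup>2 * fdet d (gram b S') * fdet d (gram b S)
      \<le> (1 + real (card (S' - S)) * L / real d) ^ d * fdet d (gram b S)"
    using fdet_gram_pos[OF inv(1)] by (intro mult_right_mono) auto
  moreover have "(fdet d R)\<^sup>2 * fdet d (gram b S') * fdet d (gram b S) = fdet d (gram b S')"
    using 1 by (metis mult.commute mult.left_commute mult.right_neutral)
  ultimately have "fdet d (gram b S') \<le> (1 + real (card (S' - S)) * L / real d) ^ d * fdet d (gram b S)"
    by (simp only:)
  then show ?thesis
    by (simp only: mult.commute)
qed

section \<open>Length of greedy runs\<close>

text \<open>The whole history is recorded, not just the current state, because the bound on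
  \<open>N\<close> compares determinants at times \<open>2 * d\<close> apart. The sets may contain
  indices of unit vectors from the start, while \<open>j\<close> chooses among rows of the
  matrix.\<close>

definition greedy_run ::
  "nat \<Rightarrow> nat \<Rightarrow> (nat \<Rightarrow> nat \<Rightarrow> real) \<Rightarrow> nat \<Rightarrow> (nat \<Rightarrow> nat set) \<Rightarrow> (nat \<Rightarrow> nat \<Rightarrow> nat \<Rightarrow> real) \<Rightarrow>
    (nat \<Rightarrow> nat) \<Rightarrow> bool" where
  "greedy_run d n b N S H j \<longleftrightarrow>
     (\<forall>t\<le>N. inverse_gram d b (S t) (H t) \<and> finite (S t)) \<and>
     (\<forall>t<N. j t < n \<and> S (Suc t) = insert (j t) (S t) \<and> rank_one_step d (H t) (b (j t)) (H (Suc t)) \<and>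
        (\<forall>i<n. leverage d (H t) (b i) \<le> leverage d (H t) (b (j t))) \<and> 1 < leverage d (H t) (b (j t)))"

lemma greedy_run_extend:
  assumes run: "greedy_run d n b N S H j" and i: "i < n"
    and max: "\<And>i'. i' < n \<Longrightarrow> leverage d (H N) (b i') \<le> leverage d (H N) (b i)"
    and gt: "1 < leverage d (H N) (b i)" and step: "rank_one_step d (H N) (b i) H'"
  shows "greedy_run d n b (Suc N) (S(Suc N := insert i (S N))) (H(Suc N := H')) (j(N := i))"
proof -
  have N: "inverse_gram d b (S N) (H N)" "finite (S N)"
    using run unfolding greedy_run_def by auto
  then have "i \<notin> S N"
    using leverage_le_1 gt by fastforce
  then have "inverse_gram d b (insert i (S N)) H'"
    by (rule inverse_gram_insert[OF N _ step])
  then show ?thesis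
    using run N i max gt step unfolding greedy_run_def by (auto simp: less_Suc_eq le_Suc_eq)
qed

section \<open>Rounds of \<open>2 * d\<close> greedy steps\<close>

context
  fixes d n N :: nat and b :: "nat \<Rightarrow> nat \<Rightarrow> real" and S :: "nat \<Rightarrow> nat set"
    and H :: "nat \<Rightarrow> nat \<Rightarrow> nat \<Rightarrow> real" and j :: "nat \<Rightarrow> nat"
  assumes d: "0 < d" and run: "greedy_run d n b N S H j"
begin

text \<open>Since \<open>j t\<close> is a maximizer, this is the largest leverage of any row before
  step \<open>t\<close>.\<close>

definition lev_at :: "nat \<Rightarrow> real" where
  "lev_at t = leverage d (H t) (b (j t))"

lemma run_inv: "t \<le> N \<Longrightarrow> inverse_gram d b (S t) (H t)" "t \<le> N \<Longrightarrow> finite (S t)"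
  using run unfolding greedy_run_def by auto

lemma run_step:
  assumes "t < N"
  shows "j t < n" "S (Suc t) = insert (j t) (S t)" "rank_one_step d (H t) (b (j t)) (H (Suc t))"
    "i < n \<Longrightarrow> leverage d (H t) (b i) \<le> lev_at t" "1 < lev_at t"
  using run assms unfolding greedy_run_def lev_at_def by auto

lemma run_fresh: "t < N \<Longrightarrow> j t \<notin> S t"
  using leverage_le_1[OF run_inv, of t "j t"] run_step(5)[of t] by (auto simp: lev_at_def)

text \<open>Adding a vector lowers every leverage, hence also the maximum. So within a round the
  last chosen leverage bounds all others from below.\<close>

lemma lev_at_Suc:
  assumes "Suc t < N"
  shows "lev_at (Suc t) \<le> lev_at t"
proof -
  have "0 \<le> leverage d (H t) (b (j t))"
    using leverage_nonneg run_inv assms by (meson Suc_lessD less_imp_le)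
  then have "lev_at (Suc t) \<le> leverage d (H t) (b (j (Suc t)))"
    unfolding lev_at_def using assms
    by (subst rank_one_step_leverage[OF run_step(3)]) auto
  also have "\<dots> \<le> lev_at t"
    using assms run_step(1)[of "Suc t"] by (intro run_step(4)) auto
  finally show ?thesis .
qed

lemma lev_at_antimono:
  assumes "s \<le> t" "t < N"
  shows "lev_at t \<le> lev_at s"
  using assms
proof (induction t rule: dec_induct)
  case (step t)
  then show ?case
    using lev_at_Suc[of t] by auto
qed auto

lemma run_sets:
  assumes "s \<le> t" "t \<le> N"
  shows "S s \<subseteq> S t \<and> S t - S s \<subseteq> {..<n} \<and> card (S t - S s) = t - s"
  using assms
proof (induction t rule: dec_induct)
  case (step t)
  then have IH: "S s \<subseteq> S t" "S t - S s \<subseteq> {..<n}" "card (S t - S s) = t - s"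
    by auto
  have t: "t < N"
    using step by auto
  have "S (Suc t) - S s = insert (j t) (S t - S s)" "j t \<notin> S t - S s"
    using run_step(2)[OF t] run_fresh[OF t] IH(1) by auto
  moreover have "finite (S t - S s)"
    using run_inv(2)[of t] t by simp
  ultimately show ?case
    using IH run_step(1,2)[OF t] step(1) by (auto simp: card_insert_if)
qed auto

lemma run_fdet_lower:
  assumes "s \<le> t" "t \<le> N" "0 \<le> \<mu>" "\<And>u. s \<le> u \<Longrightarrow> u < t \<Longrightarrow> \<mu> \<le> lev_at u"
  shows "fdet d (gram b (S s)) * (1 + \<mu>) ^ (t - s) \<le> fdet d (gram b (S t))"
  using assms
proof (induction t rule: dec_induct)
  case (step t)
  have t: "t < N"
    using step by auto
  have pos: "0 < fdet d (gram b (S t))"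
    using fdet_gram_pos[OF run_inv(1)] t by simp
  have "fdet d (gram b (S s)) * (1 + \<mu>) ^ (Suc t - s)
      = fdet d (gram b (S s)) * (1 + \<mu>) ^ (t - s) * (1 + \<mu>)"
    using step(1) by (simp add: Suc_diff_le)
  also have "\<dots> \<le> fdet d (gram b (S t)) * (1 + \<mu>)"
    using step t by (intro mult_right_mono) auto
  also have "\<dots> \<le> fdet d (gram b (S t)) * (1 + lev_at t)"
    using step(1,6) pos by (intro mult_left_mono) auto
  also have "\<dots> = fdet d (gram b (S (Suc t)))"
    using fdet_gram_insert[OF run_inv run_fresh[OF t]] t
    by (simp add: run_step(2) lev_at_def)
  finally show ?case .
qed auto

text \<open>Let \<mu> be the leverage at the end and \<lambda> the one at the start. The determinant
  grows by at least \<open>(1 + \<mu>) ^ (2 * d)\<close> and at most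
  \<open>(1 + 2 * \<lambda>) ^ d\<close>, and a \<open>d\<close>-th root leaves a square on the left
  only. With \<open>d\<close> steps both exponents would be \<open>d\<close>, and the comparison
  would only say that leverages do not increase.\<close>

lemma run_round:
  assumes "s + 2 * d < N"
  shows "(1 + lev_at (s + 2 * d))\<^sup>2 \<le> 1 + 2 * lev_at s"
proof -
  let ?t = "s + 2 * d"
  have sets: "S s \<subseteq> S ?t" "S ?t - S s \<subseteq> {..<n}" "card (S ?t - S s) = 2 * d"
    using run_sets[of s ?t] assms by auto
  have lev1: "1 < lev_at ?t" "1 < lev_at s"
    using run_step(5) assms by auto
  have pos: "0 < fdet d (gram b (S s))"
    using fdet_gram_pos[OF run_inv(1)] assms by simp
  have "fdet d (gram b (S s)) * (1 + lev_at ?t) ^ (2 * d) \<le> fdet d (gram b (S ?t))"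
    using run_fdet_lower[of s ?t "lev_at ?t"] lev_at_antimono[of _ ?t] assms lev1 by auto
  also have "\<dots> \<le> fdet d (gram b (S s)) * (1 + real (card (S ?t - S s)) * lev_at s / real d) ^ d"
  proof (rule fdet_gram_growth[OF d])
    show "leverage d (H s) (b i) \<le> lev_at s" if "i \<in> S ?t - S s" for i
      using sets that assms by (intro run_step(4)) auto
  qed (use assms run_inv[of s] run_inv[of ?t] sets in auto)
  also have "1 + real (card (S ?t - S s)) * lev_at s / real d = 1 + 2 * lev_at s"
    using d sets by simp
  finally have "((1 + lev_at ?t)\<^sup>2) ^ d \<le> (1 + 2 * lev_at s) ^ d"
    using pos by (simp add: power_mult)
  then show ?thesis
    using d lev1 power_mono_iff by fastforce
qed

text \<open>The upper bound is absolute: in the coordinates \<open>F\<close> the \<open>d\<close>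
  initial and \<open>2 * d\<close> new vectors have \<open>d\<close> entries of size at most 1 each,
  so the trace is at most \<open>3 * d * d\<close>. The initial leverages, which may be huge, do not
  enter.\<close>

lemma run_first_round:
  assumes F: "(fdet d F)\<^sup>2 * fdet d (gram b (S 0)) = 1"
    and le: "\<And>i p. i < n \<or> i \<in> S 0 \<Longrightarrow> p < d \<Longrightarrow> \<bar>ip d (F p) (b i)\<bar> \<le> 1"
    and card: "card (S 0) = d" and N: "2 * d < N"
  shows "(1 + lev_at (2 * d))\<^sup>2 \<le> 3 * real d"
proof -
  let ?t = "2 * d"
  have sets: "S 0 \<subseteq> S ?t" "S ?t - S 0 \<subseteq> {..<n}" "card (S ?t - S 0) = 2 * d"
    using run_sets[of 0 ?t] N by auto
  have lev1: "1 < lev_at ?t"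
    using run_step(5) N by auto
  have fin: "finite (S ?t)"
    using run_inv N by simp
  have cardt: "card (S ?t) = 3 * d"
    using sets card card_Diff_subset[of "S 0" "S ?t"] card_mono[OF fin sets(1)] finite_subset[OF sets(1) fin]
    by simp
  have "(1 + lev_at ?t) ^ (2 * d) = (fdet d F)\<^sup>2 * (fdet d (gram b (S 0)) * (1 + lev_at ?t) ^ (?t - 0))"
    using F by (simp add: mult.assoc[symmetric])
  also have "\<dots> \<le> (fdet d F)\<^sup>2 * fdet d (gram b (S ?t))"
    using run_fdet_lower[of 0 ?t "lev_at ?t"] lev_at_antimono[of _ ?t] N lev1
    by (intro mult_left_mono) auto
  also have "\<dots> \<le> ((\<Sum>s\<in>S ?t. \<Sum>p<d. (ip d (F p) (b s))\<^sup>2) / real d) ^ d"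
  proof (rule fdet_gram_le[OF d])
    show "fdet d (gram b (S ?t)) \<noteq> 0"
      using fdet_gram_pos[OF run_inv(1), of ?t] N by simp
    show "fdet d F \<noteq> 0"
      using F by auto
  qed
  also have "\<dots> \<le> (3 * real d) ^ d"
  proof (rule power_mono)
    have "(\<Sum>s\<in>S ?t. \<Sum>p<d. (ip d (F p) (b s))\<^sup>2) \<le> (\<Sum>s\<in>S ?t. \<Sum>p<d. 1)"
    proof (intro sum_mono)
      fix s p
      assume "s \<in> S ?t" "p \<in> {..<d}"
      then have "\<bar>ip d (F p) (b s)\<bar> \<le> 1"
        using sets by (intro le) auto
      then show "(ip d (F p) (b s))\<^sup>2 \<le> 1"
        by (simp add: abs_square_le_1)
    qed
    also have "\<dots> = 3 * real d * real d"
      by (simp add: cardt)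
    finally show "(\<Sum>s\<in>S ?t. \<Sum>p<d. (ip d (F p) (b s))\<^sup>2) / real d \<le> 3 * real d"
      using d by (simp add: divide_le_eq)
  qed (simp add: sum_nonneg)
  finally have "((1 + lev_at ?t)\<^sup>2) ^ d \<le> (3 * real d) ^ d"
    by (simp add: power_mult)
  then show ?thesis
    using d lev1 power_mono_iff[of "(1 + lev_at ?t)\<^sup>2" "3 * real d" d] by auto
qed

text \<open>The witness is the binary logarithm of \<open>ln m\<close>, rounded up; passing to
  natural logarithms costs the factor 2, by \<open>ln 2 \<ge> 1 / 2\<close>.\<close>

lemma exists_halving_number:
  "\<exists>i::nat. ln (real m) \<le> 2 ^ i \<and> real i \<le> 2 * max 1 (ln (ln (real m))) + 1"
proof (cases "ln (real m) \<le> 1")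
  case True
  then show ?thesis by (intro exI[of _ 0]) auto
next
  case False
  define i where "i = nat \<lceil>ln (ln (real m)) / ln 2\<rceil>"
  have "0 < ln (ln (real m))"
    using False by simp
  then have i: "ln (ln (real m)) / ln 2 \<le> real i" "real i \<le> ln (ln (real m)) / ln 2 + 1"
    by (simp_all add: i_def)
  have "ln (real m) = exp (ln (ln (real m)))"
    using False by simp
  also have "\<dots> \<le> exp (real i * ln 2)"
    using i(1) by (simp add: divide_le_eq)
  also have "\<dots> = 2 ^ i"
    by (simp add: exp_of_nat_mult)
  finally have "ln (real m) \<le> 2 ^ i" .
  moreover have "1 / 2 \<le> ln (2 :: real)"
    using ln_le_minus_one[of "1 / 2"] by (simp add: ln_div)
  moreover from this have "ln (ln (real m)) / ln 2 \<le> 2 * ln (ln (real m))"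
    using \<open>0 < ln (ln (real m))\<close> by (simp add: divide_le_eq)
  ultimately show ?thesis
    using i(2) by (intro exI[of _ i]) auto
qed

text \<open>With \<open>z = 1 + \<lambda>\<close>, a round of \<open>2 d\<close> steps turns the maximal leverage \<open>\<lambda>\<close> into one with
  \<open>z'\<^sup>2 \<le> 2 z - 1\<close>. So \<open>ln (z / 2)\<close> is halved, which brings it from \<open>ln d\<close> below 1 in
  \<open>O(log log d)\<close> rounds; three further rounds make \<open>\<lambda> \<le> 1\<close>.\<close>

lemma run_length:
  assumes F: "(fdet d F)\<^sup>2 * fdet d (gram b (S 0)) = 1"
    and le: "\<And>i p. i < n \<or> i \<in> S 0 \<Longrightarrow> p < d \<Longrightarrow> \<bar>ip d (F p) (b i)\<bar> \<le> 1"
    and card: "card (S 0) = d"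
  shows "real N \<le> 14 * real d * max 1 (ln (ln (real d)))"
proof -
  obtain i :: nat where i: "ln (real d) \<le> 2 ^ i" "real i \<le> 2 * max 1 (ln (ln (real d))) + 1"
    using exists_halving_number by blast
  have "N \<le> 2 * d * (i + 4)"
  proof (rule ccontr)
    assume "\<not> N \<le> 2 * d * (i + 4)"
    then have N: "2 * d * (i + 4) < N"
      by simp
    \<comment> \<open>Index 0 is the end of the first round, so \<open>i + 4\<close> rounds reach
      index \<open>i + 3\<close>: the first round, \<open>i\<close> halvings of the logarithm, and
      three final rounds.\<close>
    define z where "z k = 1 + lev_at (2 * d * (k + 1))" for k
    have less: "2 * d * (k + 1) < N" if "k \<le> i + 3" for k
    proof -
      have "2 * d * (k + 1) \<le> 2 * d * (i + 4)"
        using that by (intro mult_le_mono2) simp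
      then show ?thesis using N by linarith
    qed
    have z2: "2 < z k" if "k \<le> i + 3" for k
      using run_step(5)[OF less[OF that]] by (simp add: z_def)
    have z0: "(z 0)\<^sup>2 \<le> 3 * real d"
      using run_first_round[OF F le card] less[of 0] by (simp add: z_def)
    have zS: "(z (Suc k))\<^sup>2 \<le> 2 * z k - 1" if "Suc k \<le> i + 3" for k
      using run_round[of "2 * d * (k + 1)"] less[of "Suc k"] that
      by (simp add: z_def algebra_simps)
    have "ln (z k / 2) \<le> ln (real d) / 2 ^ k" if "k \<le> i + 3" for k
      using that
    proof (induction k)
      case 0
      have "1 \<le> real d" using d by simp
      then have "real d \<le> real d * real d"
        by (metis mult_le_cancel_left1 not_less of_nat_less_0_iff)
      then have "(z 0)\<^sup>2 \<le> 4 * (real d * real d)"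
        using z0 \<open>1 \<le> real d\<close> by linarith
      then have "(z 0 / 2)\<^sup>2 \<le> (real d)\<^sup>2"
        by (simp add: power2_eq_square)
      then have "z 0 / 2 \<le> real d"
        by (rule power2_le_imp_le) simp
      then show ?case
        using z2[of 0] d by simp
    next
      case (Suc k)
      have "(z (Suc k) / 2)\<^sup>2 \<le> z k / 2"
        using zS[of k] Suc.prems by (simp add: power_divide)
      then have "ln ((z (Suc k) / 2)\<^sup>2) \<le> ln (z k / 2)"
        using z2[of k] z2[of "Suc k"] Suc.prems by (subst ln_le_cancel_iff) auto
      then have "2 * ln (z (Suc k) / 2) \<le> ln (z k / 2)"
        using z2[of "Suc k"] Suc.prems by (simp add: ln_realpow)
      also have "\<dots> \<le> ln (real d) / 2 ^ k"
        using Suc by simp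
      finally show ?case by simp
    qed
    then have "ln (z i / 2) \<le> ln (real d) / 2 ^ i"
      by simp
    also have "\<dots> \<le> 1"
      using i(1) by simp
    finally have "exp (ln (z i / 2)) \<le> exp 1"
      by (simp only: exp_le_cancel_iff)
    moreover have "exp (ln (z i / 2)) = z i / 2"
      using z2[of i] by (subst exp_ln) auto
    ultimately have "z i / 2 \<le> exp 1"
      by (simp only:)
    then have "z i \<le> 6"
      using exp_le by simp
    \<comment> \<open>The constants follow the recursion, rounded up to convenient squares:
      \<open>2 * 6 - 1 = 11 < 3.4\<^sup>2\<close>, \<open>2 * 3.4 - 1 = 5.8 < 2.42\<^sup>2\<close>
      and \<open>2 * 2.42 - 1 = 3.84 < 2\<^sup>2\<close>.\<close>
    then have "(z (Suc i))\<^sup>2 \<le> 3.4\<^sup>2"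
      using zS[of i] by (simp add: power2_eq_square)
    then have "z (Suc i) \<le> 3.4"
      by (rule power2_le_imp_le) simp
    then have "(z (Suc (Suc i)))\<^sup>2 \<le> 2.42\<^sup>2"
      using zS[of "Suc i"] by (simp add: power2_eq_square)
    then have "z (Suc (Suc i)) \<le> 2.42"
      by (rule power2_le_imp_le) simp
    then have "(z (Suc (Suc (Suc i))))\<^sup>2 \<le> 2\<^sup>2"
      using zS[of "Suc (Suc i)"] by (simp add: power2_eq_square)
    then have "z (Suc (Suc (Suc i))) \<le> 2"
      by (rule power2_le_imp_le) simp
    then show False
      using z2[of "Suc (Suc (Suc i))"] by simp
  qed
  then have "real N \<le> real (2 * d * (i + 4))"
    by (simp only: of_nat_le_iff)
  also have "\<dots> = 2 * real d * (real i + 4)"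
    by simp
  \<comment> \<open>With \<open>M\<close> the maximum on the right,
    \<open>i + 4 \<le> 2 * M + 5 \<le> 7 * M\<close> because \<open>M\<close> is at least 1.\<close>
  also have "\<dots> \<le> 2 * real d * (7 * max 1 (ln (ln (real d))))"
    using i(2) by (intro mult_left_mono) auto
  finally show ?thesis by simp
qed

end

section \<open>The initial basis\<close>

text \<open>The basis consists of the vectors \<open>b (\<sigma> l)\<close> with dual basis \<open>T\<close>; row indices below \<open>n\<close> stand for rows
  of the matrix and \<open>n + l\<close> for the \<open>l\<close>-th unit vector, which remains in the basis if step \<open>l\<close> finds no
  pivot. The exchanges destroy the bound on the pivot functionals \<open>T l\<close>, so \<open>F\<close> keeps them as they were right
  after their step: in the coordinates \<open>F\<close> the basis is unit triangular and all rows have entries at most 1.\<close>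

definition pivot_inv ::
  "nat \<Rightarrow> nat \<Rightarrow> (nat \<Rightarrow> nat \<Rightarrow> real) \<Rightarrow> nat \<Rightarrow> (nat \<Rightarrow> nat \<Rightarrow> real) \<Rightarrow> (nat \<Rightarrow> nat) \<Rightarrow>
    (nat \<Rightarrow> nat \<Rightarrow> real) \<Rightarrow> bool" where
  "pivot_inv d n b k T \<sigma> F \<longleftrightarrow>
     (\<forall>l<d. \<sigma> l = n + l \<or> l < k \<and> \<sigma> l < n) \<and>
     (\<forall>l<d. \<forall>m<d. ip d (T l) (b (\<sigma> m)) = (if l = m then 1 else 0)) \<and>
     (\<forall>p<d. \<forall>q<d. (\<Sum>l<d. b (\<sigma> l) p * T l q) = (if p = q then 1 else 0)) \<and>
     (\<forall>l<k. n \<le> \<sigma> l \<longrightarrow> (\<forall>i<n. ip d (T l) (b i) = 0)) \<and>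
     (\<forall>l<k. \<forall>i<n. \<bar>ip d (F l) (b i)\<bar> \<le> 1) \<and>
     (\<forall>l<d. k \<le> l \<longrightarrow> (\<forall>q<d. F l q = T l q)) \<and>
     (\<forall>l<d. ip d (F l) (b (\<sigma> l)) = 1 \<and> (\<forall>m<l. ip d (F l) (b (\<sigma> m)) = 0)) \<and>
     (\<forall>m<k. n \<le> \<sigma> m \<longrightarrow> (\<forall>l<d. ip d (F l) (b (\<sigma> m)) = (if l = m then 1 else 0)))"

lemma pivot_invD:
  assumes "pivot_inv d n b k T \<sigma> F"
  shows "l < d \<Longrightarrow> \<sigma> l = n + l \<or> l < k \<and> \<sigma> l < n"
    and "l < d \<Longrightarrow> l' < d \<Longrightarrow> ip d (T l) (b (\<sigma> l')) = (if l = l' then 1 else 0)"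
    and "p < d \<Longrightarrow> q < d \<Longrightarrow> (\<Sum>l<d. b (\<sigma> l) p * T l q) = (if p = q then 1 else 0)"
    and "l < k \<Longrightarrow> n \<le> \<sigma> l \<Longrightarrow> i < n \<Longrightarrow> ip d (T l) (b i) = 0"
    and "l < k \<Longrightarrow> i < n \<Longrightarrow> \<bar>ip d (F l) (b i)\<bar> \<le> 1"
    and "l < d \<Longrightarrow> k \<le> l \<Longrightarrow> q < d \<Longrightarrow> F l q = T l q"
    and "l < d \<Longrightarrow> ip d (F l) (b (\<sigma> l)) = 1"
    and "l < d \<Longrightarrow> l' < l \<Longrightarrow> ip d (F l) (b (\<sigma> l')) = 0"
    and "l' < k \<Longrightarrow> n \<le> \<sigma> l' \<Longrightarrow> l < d \<Longrightarrow> ip d (F l) (b (\<sigma> l')) = (if l = l' then 1 else 0)"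
  using assms unfolding pivot_inv_def by simp_all

section \<open>Pivot steps on the dual basis\<close>

lemma ip_cong: "(\<And>q. q < d \<Longrightarrow> x q = x' q) \<Longrightarrow> (\<And>q. q < d \<Longrightarrow> y q = y' q) \<Longrightarrow> ip d x y = ip d x' y'"
  by (simp add: ip_def)

lemma ip_diff_scale: "ip d (\<lambda>q. x q - c * y q) z = ip d x z - c * ip d y z"
  by (simp add: ip_def left_diff_distrib sum_subtractf sum_distrib_left mult.assoc)

lemma pivot_inv_init:
  assumes "\<And>z q. z < d \<Longrightarrow> q < d \<Longrightarrow> b (n + z) q = (if q = z then 1 else 0)"
    and "\<And>p q. p < d \<Longrightarrow> q < d \<Longrightarrow> T p q = (if p = q then 1 else 0)"
  shows "pivot_inv d n b 0 T (\<lambda>l. n + l) T"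
proof -
  have 1: "ip d (T l) (b (n + m)) = (if l = m then 1 else 0)" if "l < d" "m < d" for l m
  proof -
    have "ip d (T l) (b (n + m)) = (\<Sum>q<d. (if l = q then 1 else 0) * (if q = m then 1 else 0))"
      unfolding ip_def by (rule sum.cong) (use assms that in auto)
    then show ?thesis
      using that by (simp only: sum_delta_mult) auto
  qed
  have 2: "(\<Sum>l<d. b (n + l) p * T l q) = (if p = q then 1 else 0)" if "p < d" "q < d" for p q
  proof -
    have "(\<Sum>l<d. b (n + l) p * T l q) = (\<Sum>l<d. (if p = l then 1 else 0) * (if l = q then 1 else 0))"
      by (rule sum.cong) (use assms that in auto)
    then show ?thesis
      using that by (simp only: sum_delta_mult) auto
  qed
  show ?thesis
    unfolding pivot_inv_def using 1 2 by auto
qed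

text \<open>The unit vector in slot \<open>k\<close> now stays for good, so the earlier functionals
  \<open>F l\<close> must be made to vanish on it. Subtracting a multiple of \<open>T k\<close> does
  this without harm: \<open>T k\<close> is zero on all rows, and by duality zero on all other basis
  vectors.\<close>

lemma pivot_inv_skip:
  assumes inv: "pivot_inv d n b k T \<sigma> F" and k: "k < d"
    and zero: "\<And>i. i < n \<Longrightarrow> ip d (T k) (b i) = 0"
  shows "\<exists>F'. pivot_inv d n b (Suc k) T \<sigma> F'"
proof -
  define F' where "F' l = (if l < k then \<lambda>q. F l q - ip d (F l) (b (\<sigma> k)) * T k q else F l)" for l
  have \<sigma>k: "\<sigma> k = n + k"
    using pivot_invD(1)[OF inv k] by simp
  have dual: "ip d (T l) (b (\<sigma> m)) = (if l = m then 1 else 0)" if "l < d" "m < d" for l m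
    by (rule pivot_invD(2)[OF inv that])
  have FT: "ip d (F l) x = ip d (T l) x" if "l < d" "k \<le> l" for l x
    by (rule ip_cong) (use pivot_invD(6)[OF inv that] in auto)
  have F': "ip d (F' l) x = (if l < k then ip d (F l) x - ip d (F l) (b (\<sigma> k)) * ip d (T k) x else ip d (F l) x)" for l x
    by (simp add: F'_def ip_diff_scale)
  have "pivot_inv d n b (Suc k) T \<sigma> F'"
    unfolding pivot_inv_def
  proof (intro conjI allI impI)
    fix l assume "l < d"
    then show "\<sigma> l = n + l \<or> l < Suc k \<and> \<sigma> l < n"
      using pivot_invD(1)[OF inv] by fastforce
  next
    fix l m assume "l < d" "m < d"
    then show "ip d (T l) (b (\<sigma> m)) = (if l = m then 1 else 0)"
      by (rule dual)
  next
    fix p q assume "p < d" "q < d"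
    then show "(\<Sum>l<d. b (\<sigma> l) p * T l q) = (if p = q then 1 else 0)"
      by (rule pivot_invD(3)[OF inv])
  next
    fix l i assume "l < Suc k" "n \<le> \<sigma> l" "i < n"
    then show "ip d (T l) (b i) = 0"
      using pivot_invD(4)[OF inv] zero by (auto simp: less_Suc_eq)
  next
    fix l i assume "l < Suc k" "i < n"
    then show "\<bar>ip d (F' l) (b i)\<bar> \<le> 1"
      using pivot_invD(5)[OF inv] zero k FT[of k] unfolding F' by (auto simp: less_Suc_eq)
  next
    fix l q assume "l < d" "Suc k \<le> l" "q < d"
    then show "F' l q = T l q"
      using pivot_invD(6)[OF inv] by (simp add: F'_def)
  next
    fix l assume l: "l < d"
    then show "ip d (F' l) (b (\<sigma> l)) = 1"
      using pivot_invD(7)[OF inv l] dual[of k l] k unfolding F' by auto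
    fix m assume "m < l"
    then show "ip d (F' l) (b (\<sigma> m)) = 0"
      using pivot_invD(8)[OF inv l] dual[of k m] k l unfolding F' by auto
  next
    fix m l assume "m < Suc k" "n \<le> \<sigma> m" "l < d"
    then show "ip d (F' l) (b (\<sigma> m)) = (if l = m then 1 else 0)"
      using pivot_invD(7,9)[OF inv] dual[of k m] dual[of l m] FT[of l] k unfolding F' by (auto simp: less_Suc_eq)
  qed
  then show ?thesis by blast
qed

text \<open>A Gauss-Jordan exchange on the dual basis. The new \<open>T' k\<close> is
  \<open>T k\<close> divided by the pivot, so the choice of a maximal pivot bounds it by 1 on all
  rows. Earlier functionals \<open>F l\<close> can be kept, since triangularity constrains them only
  on slots up to \<open>l\<close> and on retained unit vectors. A functional whose slot kept its
  unit vector vanishes on \<open>b j\<close>, so the exchange does not change it.\<close>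

lemma pivot_inv_pivot:
  assumes inv: "pivot_inv d n b k T \<sigma> F" and k: "k < d" and j: "j < n"
    and nz: "ip d (T k) (b j) \<noteq> 0"
    and max: "\<And>i. i < n \<Longrightarrow> \<bar>ip d (T k) (b i)\<bar> \<le> \<bar>ip d (T k) (b j)\<bar>"
    and T': "\<And>l q. l < d \<Longrightarrow> q < d \<Longrightarrow>
      T' l q = T l q - (ip d (T l) (b j) - (if l = k then 1 else 0)) / ip d (T k) (b j) * T k q"
  shows "\<exists>F'. pivot_inv d n b (Suc k) T' (\<sigma>(k := j)) F'"
proof -
  define piv where "piv = ip d (T k) (b j)"
  define F' where "F' l = (if l < k then F l else T' l)" for l
  have \<sigma>: "\<sigma> l = n + l \<or> l < k \<and> \<sigma> l < n" if "l < d" for l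
    by (rule pivot_invD(1)[OF inv that])
  have dual: "ip d (T l) (b (\<sigma> m)) = (if l = m then 1 else 0)" if "l < d" "m < d" for l m
    by (rule pivot_invD(2)[OF inv that])
  have sumT: "(\<Sum>l<d. b (\<sigma> l) p * T l q) = (if p = q then 1 else 0)" if "p < d" "q < d" for p q
    by (rule pivot_invD(3)[OF inv that])
  have ipT': "ip d (T' l) x = ip d (T l) x - (ip d (T l) (b j) - (if l = k then 1 else 0)) / piv * ip d (T k) x"
    if "l < d" for l x
    unfolding ip_diff_scale[symmetric] using that T' by (intro ip_cong) (auto simp: piv_def)
  have dual': "ip d (T' l) (b ((\<sigma>(k := j)) m)) = (if l = m then 1 else 0)" if "l < d" "m < d" for l m
    using that k nz dual[of k m] dual[of l m] by (auto simp: ipT' piv_def)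
  have expand: "(\<Sum>l<d. b (\<sigma> l) p * ip d (T l) (b j)) = b j p" if "p < d" for p
  proof -
    have "(\<Sum>l<d. b (\<sigma> l) p * ip d (T l) (b j)) = (\<Sum>l<d. \<Sum>q<d. b (\<sigma> l) p * T l q * b j q)"
      by (simp add: ip_def sum_distrib_left mult.assoc)
    also have "\<dots> = (\<Sum>q<d. \<Sum>l<d. b (\<sigma> l) p * T l q * b j q)"
      by (rule sum.swap)
    also have "\<dots> = (\<Sum>q<d. (if p = q then 1 else 0) * b j q)"
      by (rule sum.cong) (use that in \<open>auto simp: sum_distrib_right[symmetric] sumT\<close>)
    finally show ?thesis
      using that by (simp only: sum_delta_mult if_True)
  qed
  have sumT': "(\<Sum>l<d. b ((\<sigma>(k := j)) l) p * T' l q) = (if p = q then 1 else 0)" if "p < d" "q < d" for p q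
  proof -
    \<comment> \<open>The last summand corrects slot \<open>k\<close>, where \<open>b j\<close>
      replaces \<open>b (\<sigma> k)\<close> and \<open>T' k\<close> equals \<open>T k\<close>
      divided by \<open>piv\<close>.\<close>
    have "(\<Sum>l<d. b ((\<sigma>(k := j)) l) p * T' l q) =
        (\<Sum>l<d. b (\<sigma> l) p * T l q - (b (\<sigma> l) p * ip d (T l) (b j)) * (T k q / piv)
          + (b (\<sigma> l) p * (if l = k then 1 else 0)) * (T k q / piv)
          + (b j p - b (\<sigma> k) p) * (T k q / piv) * (if l = k then 1 else 0))"
    proof (rule sum.cong[OF refl])
      fix l assume "l \<in> {..<d}"
      then show "b ((\<sigma>(k := j)) l) p * T' l q =
        b (\<sigma> l) p * T l q - (b (\<sigma> l) p * ip d (T l) (b j)) * (T k q / piv)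
          + (b (\<sigma> l) p * (if l = k then 1 else 0)) * (T k q / piv)
          + (b j p - b (\<sigma> k) p) * (T k q / piv) * (if l = k then 1 else 0)"
        using that nz by (auto simp: T' piv_def field_simps)
    qed
    also have "\<dots> = (if p = q then 1 else 0) - b j p * (T k q / piv) + b (\<sigma> k) p * (T k q / piv)
        + (b j p - b (\<sigma> k) p) * (T k q / piv)"
      unfolding sum.distrib sum_subtractf sum_distrib_right[symmetric] sum_delta_mult sumT[OF that] expand[OF that(1)]
      using k by simp
    also have "\<dots> = (if p = q then 1 else 0)"
      by (simp add: algebra_simps)
    finally show ?thesis .
  qed
  have "pivot_inv d n b (Suc k) T' (\<sigma>(k := j)) F'"
    unfolding pivot_inv_def
  proof (intro conjI allI impI)
    fix l assume "l < d"
    then show "(\<sigma>(k := j)) l = n + l \<or> l < Suc k \<and> (\<sigma>(k := j)) l < n"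
      using \<sigma> j by (auto simp: less_Suc_eq)
  next
    fix l m assume "l < d" "m < d"
    then show "ip d (T' l) (b ((\<sigma>(k := j)) m)) = (if l = m then 1 else 0)"
      by (rule dual')
  next
    fix p q assume "p < d" "q < d"
    then show "(\<Sum>l<d. b ((\<sigma>(k := j)) l) p * T' l q) = (if p = q then 1 else 0)"
      by (rule sumT')
  next
    fix l i assume l: "l < Suc k" "n \<le> (\<sigma>(k := j)) l" "i < n"
    then have "l < k" "l < d" "n \<le> \<sigma> l"
      using j k by (auto simp: less_Suc_eq)
    then show "ip d (T' l) (b i) = 0"
      using pivot_invD(4)[OF inv] l(3) j \<open>l < Suc k\<close> by (simp add: ipT')
  next
    fix l i assume l: "l < Suc k" "i < n"
    show "\<bar>ip d (F' l) (b i)\<bar> \<le> 1"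
    proof (cases "l = k")
      case True
      have "ip d (F' k) (b i) = ip d (T k) (b i) / piv"
        using k nz by (simp add: F'_def ipT' piv_def diff_divide_distrib left_diff_distrib)
      then show ?thesis
        using True max[OF l(2)] nz by (simp add: piv_def)
    next
      case False
      then show ?thesis
        using l pivot_invD(5)[OF inv] unfolding F'_def by auto
    qed
  next
    fix l q assume "l < d" "Suc k \<le> l" "q < d"
    then show "F' l q = T' l q"
      by (simp add: F'_def)
  next
    fix l assume l: "l < d"
    then show "ip d (F' l) (b ((\<sigma>(k := j)) l)) = 1"
      using pivot_invD(7)[OF inv l] dual'[of l l] unfolding F'_def by auto
    fix m assume "m < l"
    then show "ip d (F' l) (b ((\<sigma>(k := j)) m)) = 0"
      using pivot_invD(8)[OF inv l] dual'[of l m] l unfolding F'_def by auto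
  next
    fix m l assume m: "m < Suc k" "n \<le> (\<sigma>(k := j)) m" "l < d"
    then have "m < k" "m < d" "n \<le> \<sigma> m"
      using j k by (auto simp: less_Suc_eq)
    then show "ip d (F' l) (b ((\<sigma>(k := j)) m)) = (if l = m then 1 else 0)"
      using pivot_invD(9)[OF inv] dual'[of l m] m(3) \<open>m < Suc k\<close> k unfolding F'_def by auto
  qed
  then show ?thesis by blast
qed

section \<open>The basis after the last pivot step\<close>

context
  fixes d n :: nat and b T F H :: "nat \<Rightarrow> nat \<Rightarrow> real" and \<sigma> :: "nat \<Rightarrow> nat" and S :: "nat set"
  assumes inv: "pivot_inv d n b d T \<sigma> F"
    and S: "S = \<sigma> ` {..<d}" and H: "\<forall>p<d. \<forall>q<d. H p q = (\<Sum>l<d. T l p * T l q)"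
begin

lemma pivot_dual: "l < d \<Longrightarrow> m < d \<Longrightarrow> ip d (T l) (b (\<sigma> m)) = (if l = m then 1 else 0)"
  by (rule pivot_invD(2)[OF inv])

lemma pivot_inj: "inj_on \<sigma> {..<d}"
proof (rule inj_onI)
  fix l m assume "l \<in> {..<d}" "m \<in> {..<d}" "\<sigma> l = \<sigma> m"
  then show "l = m"
    using pivot_dual[of l l] pivot_dual[of l m] by (auto split: if_splits)
qed

lemma pivot_card: "card S = d"
  by (simp add: S card_image pivot_inj)

lemma pivot_gram: "gram b S p q = (\<Sum>l<d. b (\<sigma> l) p * b (\<sigma> l) q)"
  by (simp add: gram_def S sum.reindex[OF pivot_inj])

text \<open>With the basis vectors as columns of \<open>B\<close>, the Gram matrix is
  \<open>B B\<^sup>T\<close> and \<open>T\<close> is the inverse of \<open>B\<close>. So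
  \<open>H = T\<^sup>T T\<close> inverts it, and \<open>T\<close> is itself the required
  factor.\<close>

lemma pivot_inverse_gram: "inverse_gram d b S H"
proof -
  have "(\<Sum>q<d. gram b S p q * H q r) = (if p = r then 1 else 0)" if "p < d" "r < d" for p r
  proof -
    have HT: "(\<Sum>q<d. b (\<sigma> l) q * H q r) = T l r" if "l < d" for l
    proof -
      have "(\<Sum>q<d. b (\<sigma> l) q * H q r) = (\<Sum>q<d. \<Sum>m<d. T m q * b (\<sigma> l) q * T m r)"
        by (rule sum.cong) (use H \<open>r < d\<close> in \<open>auto simp: sum_distrib_left mult_ac\<close>)
      also have "\<dots> = (\<Sum>m<d. \<Sum>q<d. T m q * b (\<sigma> l) q * T m r)"
        by (rule sum.swap)
      also have "\<dots> = (\<Sum>m<d. (if m = l then 1 else 0) * T m r)"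
        by (rule sum.cong) (use pivot_dual that in \<open>auto simp: sum_distrib_right[symmetric] ip_def\<close>)
      finally show ?thesis
        using that by (simp only: sum_delta_mult if_True)
    qed
    have "(\<Sum>q<d. gram b S p q * H q r) = (\<Sum>q<d. \<Sum>l<d. b (\<sigma> l) p * (b (\<sigma> l) q * H q r))"
      by (simp add: pivot_gram sum_distrib_right mult.assoc)
    also have "\<dots> = (\<Sum>l<d. \<Sum>q<d. b (\<sigma> l) p * (b (\<sigma> l) q * H q r))"
      by (rule sum.swap)
    also have "\<dots> = (\<Sum>l<d. b (\<sigma> l) p * T l r)"
      by (rule sum.cong) (auto simp: sum_distrib_left[symmetric] HT)
    also have "\<dots> = (if p = r then 1 else 0)"
      by (rule pivot_invD(3)[OF inv that])
    finally show ?thesis .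
  qed
  then show ?thesis
    unfolding inverse_gram_def using H by blast
qed

text \<open>In the coordinates \<open>F\<close> the basis is unit triangular, so the determinants of
  \<open>F\<close> and of the basis are inverse to each other; the Gram determinant is the square of
  the latter.\<close>

lemma pivot_fdet: "(fdet d F)\<^sup>2 * fdet d (gram b S) = 1"
proof -
  define B where "B q l = b (\<sigma> l) q" for q l
  have "fdet d (\<lambda>l m. \<Sum>q<d. F l q * B q m) = (\<Prod>l<d. \<Sum>q<d. F l q * B q l)"
    by (rule fdet_upper_triangular) (use pivot_invD(8)[OF inv] in \<open>auto simp: ip_def B_def\<close>)
  also have "\<dots> = 1"
    using pivot_invD(7)[OF inv] by (intro prod.neutral) (auto simp: ip_def B_def)
  finally have 1: "fdet d F * fdet d B = 1"
    unfolding fdet_mult .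
  have "fdet d (gram b S) = fdet d (\<lambda>p q. \<Sum>l<d. B p l * B q l)"
    by (rule fdet_cong) (simp add: pivot_gram B_def)
  also have "\<dots> = (fdet d B)\<^sup>2"
    unfolding fdet_mult fdet_transpose[of d B] by (simp add: power2_eq_square)
  finally show ?thesis
    using 1 by (simp add: power_mult_distrib[symmetric])
qed

lemma pivot_bounded:
  assumes "i < n \<or> i \<in> S" "p < d"
  shows "\<bar>ip d (F p) (b i)\<bar> \<le> 1"
proof (cases "i < n")
  case True
  then show ?thesis
    by (rule pivot_invD(5)[OF inv assms(2)])
next
  case False
  then obtain m where "m < d" "i = \<sigma> m"
    using assms S by auto
  then have "ip d (F p) (b i) = (if p = m then 1 else 0)"
    using pivot_invD(9)[OF inv, of m p] assms(2) False by auto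
  then show ?thesis by simp
qed

text \<open>By duality the product equals \<open>T m\<close> applied to row \<open>i\<close>, where
  \<open>m\<close> is the slot of the unit vector \<open>b s\<close>; a slot that found no pivot has
  a functional vanishing on all rows.\<close>

lemma pivot_orthogonal:
  assumes "s \<in> S" "n \<le> s" "i < n"
  shows "ip d (b s) (mv d H (b i)) = 0"
proof -
  obtain m where m: "m < d" "s = \<sigma> m"
    using assms S by auto
  have "ip d (b s) (mv d H (b i)) = (\<Sum>l<d. (if l = m then 1 else 0) * ip d (T l) (b i))"
    unfolding ip_factor(2)[OF H] by (rule sum.cong) (use m pivot_dual in auto)
  also have "\<dots> = ip d (T m) (b i)"
    using m by (simp only: sum_delta_mult if_True)
  also have "\<dots> = 0"
    by (rule pivot_invD(4)[OF inv]) (use m assms in auto)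
  finally show ?thesis .
qed

end

text \<open>The update changes the image of \<open>y\<close> only by a multiple of the image of
  \<open>x\<close>. So unit vectors that get coefficient 0 for all rows keep it while rows are
  added.\<close>

lemma rank_one_step_orthogonal:
  assumes "rank_one_step d H x H'" "ip d z (mv d H x) = 0" "ip d z (mv d H y) = 0"
  shows "ip d z (mv d H' y) = 0"
proof -
  define c where "c = ip d y (mv d H x) / (1 + leverage d H x)"
  have "ip d z (mv d H' y) = (\<Sum>p<d. z p * mv d H y p - c * (z p * mv d H x p))"
    unfolding ip_def[of d z]
    by (rule sum.cong) (auto simp: rank_one_step_mv[OF assms(1)] c_def right_diff_distrib)
  also have "\<dots> = ip d z (mv d H y) - c * ip d z (mv d H x)"
    by (simp add: sum_subtractf ip_def[of d z] sum_distrib_left)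
  finally show ?thesis
    using assms(2,3) by simp
qed

text \<open>Translates coefficients indexed by elements of \<open>S\<close> into a vector indexed by
  positions in \<open>S\<close>.\<close>

lemma well_conditioned_spanning_setI:
  assumes A: "A \<in> carrier_mat n d" and S: "S \<subseteq> {..<n}" and \<kappa>: "1 \<le> \<kappa>"
    and c: "\<And>i. i < n \<Longrightarrow> \<exists>c. (\<forall>q<d. A $$ (i, q) = (\<Sum>s\<in>S. c s * A $$ (s, q))) \<and> (\<Sum>s\<in>S. (c s)\<^sup>2) \<le> 1"
  shows "well_conditioned_spanning_set A S \<kappa>"
  unfolding well_conditioned_spanning_set_def
proof (intro conjI allI impI)
  show "S \<subseteq> {..<dim_row A}"
    using A S by auto
  fix i assume "i < dim_row A"
  then have i: "i < n"
    using A by simp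
  obtain c where c: "\<forall>q<d. A $$ (i, q) = (\<Sum>s\<in>S. c s * A $$ (s, q))" "(\<Sum>s\<in>S. (c s)\<^sup>2) \<le> 1"
    using assms(4)[OF i] by blast
  have fin: "finite S"
    using S finite_subset by auto
  \<comment> \<open>\<open>pick S\<close> enumerates \<open>S\<close> increasingly, which is the
    order of the rows in \<open>submatrix\<close>.\<close>
  have bij: "bij_betw (pick S) {..<card S} S"
    unfolding bij_betw_def
  proof
    show inj: "inj_on (pick S) {..<card S}"
      by (rule inj_onI) (metis card_pick_le lessThan_iff)
    show "pick S ` {..<card S} = S"
      by (rule card_subset_eq[OF fin]) (use pick_in_set_le inj in \<open>auto simp: card_image\<close>)
  qed
  have card: "card {i. i < dim_row A \<and> i \<in> S} = card S"
    using A S by (intro arg_cong[where f = card]) auto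
  define x where "x = vec (card S) (\<lambda>k. c (pick S k))"
  have "row A i = (submatrix A S UNIV)\<^sup>T *\<^sub>v x"
  proof (rule eq_vecI)
    fix q assume "q < dim_vec ((submatrix A S UNIV)\<^sup>T *\<^sub>v x)"
    then have q: "q < d"
      using A by (simp add: dim_submatrix)
    have "((submatrix A S UNIV)\<^sup>T *\<^sub>v x) $ q = (\<Sum>k<card S. A $$ (pick S k, q) * c (pick S k))"
      using q A card
      by (simp add: x_def scalar_prod_def dim_submatrix submatrix_index pick_UNIV lessThan_atLeast0)
    also have "\<dots> = (\<Sum>s\<in>S. A $$ (s, q) * c s)"
      by (rule sum.reindex_bij_betw[OF bij])
    also have "\<dots> = row A i $ q"
      using c(1) q A i by (simp add: mult.commute)
    finally show "row A i $ q = ((submatrix A S UNIV)\<^sup>T *\<^sub>v x) $ q" ..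
  qed (use A in \<open>simp add: dim_submatrix\<close>)
  moreover have "L2_set (\<lambda>k. x $ k) {..<card S} \<le> \<kappa>"
  proof -
    have "(\<Sum>k<card S. (x $ k)\<^sup>2) = (\<Sum>k<card S. (c (pick S k))\<^sup>2)"
      by (rule sum.cong) (auto simp: x_def)
    also have "\<dots> = (\<Sum>s\<in>S. (c s)\<^sup>2)"
      by (rule sum.reindex_bij_betw[OF bij])
    finally have "L2_set (\<lambda>k. x $ k) {..<card S} \<le> 1"
      using c(2) by (simp add: L2_set_def)
    then show ?thesis
      using \<kappa> by simp
  qed
  ultimately show "\<exists>x\<in>carrier_vec (card S). row A i = (submatrix A S UNIV)\<^sup>T *\<^sub>v x \<and>
      L2_set (\<lambda>k. x $ k) {..<card S} \<le> \<kappa>"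
    by (intro bexI[of _ x]) (auto simp: x_def)
qed

section \<open>Programs with time bounds\<close>

text \<open>A total-correctness triple with a time budget. The start store is an argument and not a
  precondition, so that postconditions can refer to it.\<close>

definition runs :: "com \<Rightarrow> store \<Rightarrow> nat \<Rightarrow> (store \<Rightarrow> bool) \<Rightarrow> bool" where
  "runs c s B Q \<longleftrightarrow> (\<exists>T t. exec c s T t \<and> T \<le> B \<and> Q t)"

lemma runs_weaken: "runs c s B Q \<Longrightarrow> B \<le> B' \<Longrightarrow> (\<And>t. Q t \<Longrightarrow> Q' t) \<Longrightarrow> runs c s B' Q'"
  unfolding runs_def by (meson le_trans)

lemma runs_Skip: "Q s \<Longrightarrow> 1 \<le> B \<Longrightarrow> runs Skip s B Q"
  unfolding runs_def using exec_Skip by blast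

lemma runs_NAssign: "Q (nupdate a (nval e1 s) (nval e2 s) s) \<Longrightarrow> 1 \<le> B \<Longrightarrow> runs (NAssign a e1 e2) s B Q"
  unfolding runs_def using exec_NAssign by blast

lemma runs_RAssign: "Q (rupdate a (nval e1 s) (rval e2 s) s) \<Longrightarrow> 1 \<le> B \<Longrightarrow> runs (RAssign a e1 e2) s B Q"
  unfolding runs_def using exec_RAssign by blast

lemma runs_Seq:
  assumes "runs c1 s B1 Q1" and "\<And>t. Q1 t \<Longrightarrow> runs c2 t B2 Q" and "B1 + B2 \<le> B"
  shows "runs (Seq c1 c2) s B Q"
proof -
  obtain T1 t where 1: "exec c1 s T1 t" "T1 \<le> B1" "Q1 t"
    using assms(1) unfolding runs_def by blast
  then obtain T2 t' where 2: "exec c2 t T2 t'" "T2 \<le> B2" "Q t'"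
    using assms(2) unfolding runs_def by blast
  show ?thesis
    unfolding runs_def using exec_Seq[OF 1(1) 2(1)] 1 2 assms(3)
    by (intro exI[of _ "T1 + T2"] exI[of _ t']) auto
qed

lemma runs_Cond:
  assumes "bval b s \<Longrightarrow> runs c1 s B Q" and "\<not> bval b s \<Longrightarrow> runs c2 s B Q" and "B + 1 \<le> B'"
  shows "runs (Cond b c1 c2) s B' Q"
proof (cases "bval b s")
  case True
  then obtain T t where "exec c1 s T t" "T \<le> B" "Q t"
    using assms(1) unfolding runs_def by blast
  then show ?thesis
    unfolding runs_def using exec_CondTrue[OF True] assms(3) by (meson add_le_mono1 le_trans)
next
  case False
  then obtain T t where "exec c2 s T t" "T \<le> B" "Q t"
    using assms(2) unfolding runs_def by blast
  then show ?thesis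
    unfolding runs_def using exec_CondFalse[OF False] assms(3) by (meson add_le_mono1 le_trans)
qed

text \<open>Termination is drawn from the invariant, which is indexed by the iteration and can hold
  only up to \<open>K\<close>. The greedy loop has no decreasing counter; its bound is a theorem
  about the run that the invariant records.\<close>

lemma runs_While:
  assumes init: "I 0 s"
    and step: "\<And>k t. I k t \<Longrightarrow> bval b t \<Longrightarrow> runs c t B (I (Suc k))"
    and bound: "\<And>k t. I k t \<Longrightarrow> k \<le> K"
    and post: "\<And>k t. I k t \<Longrightarrow> \<not> bval b t \<Longrightarrow> Q t"
    and B': "K * (B + 1) + 1 \<le> B'"
  shows "runs (While b c) s B' Q"
proof -
  have "runs (While b c) t ((K - k) * (B + 1) + 1) Q" if "I k t" "k \<le> K" for k t
    using that
  proof (induction "K - k" arbitrary: k t)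
    case 0
    show ?case
    proof (cases "bval b t")
      \<comment> \<open>Here \<open>k = K\<close>, and one more iteration would establish the
        invariant at \<open>K + 1\<close>, contrary to \<open>bound\<close>.\<close>
      case True
      then obtain T t' where "I (Suc k) t'"
        using step[OF 0(2)] unfolding runs_def by blast
      then show ?thesis
        using bound[of "Suc k"] 0 by auto
    next
      case False
      then show ?thesis
        unfolding runs_def using exec_WhileFalse[OF False] post[OF 0(2)] by fastforce
    qed
  next
    case (Suc x)
    show ?case
    proof (cases "bval b t")
      case True
      then obtain T t' where 1: "exec c t T t'" "T \<le> B" "I (Suc k) t'"
        using step[OF Suc(3)] unfolding runs_def by blast
      then have "runs (While b c) t' ((K - Suc k) * (B + 1) + 1) Q"
        using Suc bound[of "Suc k"] by auto
      then obtain T' t'' where 2: "exec (While b c) t' T' t''" "T' \<le> (K - Suc k) * (B + 1) + 1" "Q t''"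
        unfolding runs_def by blast
      have "K - k = Suc (K - Suc k)"
        using Suc by linarith
      then have "T + T' + 1 \<le> (K - k) * (B + 1) + 1"
        using 1 2 by simp
      then show ?thesis
        unfolding runs_def using exec_WhileTrue[OF True 1(1) 2(1)] 2(3) by blast
    next
      case False
      then show ?thesis
        unfolding runs_def using exec_WhileFalse[OF False] post[OF Suc(3)] by fastforce
    qed
  qed
  from this[OF init] show ?thesis
    using B' by (auto intro: runs_weaken)
qed

section \<open>Counting loops and frame conditions\<close>

abbreviation "nvar a \<equiv> NCell a (NConst 0)"
abbreviation "rvar a \<equiv> RCell a (NConst 0)"
abbreviation "nset a e \<equiv> NAssign a (NConst 0) e"
abbreviation "rset a e \<equiv> RAssign a (NConst 0) e"

definition for_loop :: "string \<Rightarrow> nexp \<Rightarrow> com \<Rightarrow> com" where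
  "for_loop i e c = Seq (nset i (NConst 0))
     (While (NLess (nvar i) e) (Seq c (nset i (NAdd (nvar i) (NConst 1)))))"

lemma store_update_simps [simp]:
  "nmem (nupdate a i v s) b = (if b = a then (nmem s a)(i := v) else nmem s b)"
  "rmem (nupdate a i v s) = rmem s"
  "rmem (rupdate a i r s) b = (if b = a then (rmem s a)(i := r) else rmem s b)"
  "nmem (rupdate a i r s) = nmem s"
  by (simp_all add: nupdate_def rupdate_def)

text \<open>Each iteration pays for the body, the test and the increment; the final 2 is for the
  initialization and the last test.\<close>

lemma runs_for:
  assumes init: "I 0 (nupdate i 0 0 s)"
    and step: "\<And>k t. k < N \<Longrightarrow> I k t \<Longrightarrow> nmem t i 0 = k \<Longrightarrow>
      runs c t B (\<lambda>t'. nmem t' i 0 = k \<and> I (Suc k) (nupdate i 0 (Suc k) t'))"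
    and len: "\<And>k t. I k t \<Longrightarrow> nval e t = N"
    and post: "\<And>t. I N t \<Longrightarrow> Q t"
    and B': "N * (B + 2) + 2 \<le> B'"
  shows "runs (for_loop i e c) s B' Q"
  unfolding for_loop_def
proof (rule runs_Seq)
  show "runs (nset i (NConst 0)) s 1 (\<lambda>t. t = nupdate i 0 0 s)"
    by (rule runs_NAssign) auto
  fix t assume t: "t = nupdate i 0 0 s"
  show "runs (While (NLess (nvar i) e) (Seq c (nset i (NAdd (nvar i) (NConst 1))))) t (N * (B + 2) + 1) Q"
  proof (rule runs_While[where I = "\<lambda>k t. nmem t i 0 = k \<and> k \<le> N \<and> I k t"])
    show "nmem t i 0 = 0 \<and> 0 \<le> N \<and> I 0 t"
      using init t by simp
    fix k t
    assume I: "nmem t i 0 = k \<and> k \<le> N \<and> I k t"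
    then show "k \<le> N" by simp
    have e: "nval e t = N"
      using I len by blast
    show "Q t" if "\<not> bval (NLess (nvar i) e) t"
      using that I e post by auto
    show "runs (Seq c (nset i (NAdd (nvar i) (NConst 1)))) t (B + 1)
        (\<lambda>t. nmem t i 0 = Suc k \<and> Suc k \<le> N \<and> I (Suc k) t)" if "bval (NLess (nvar i) e) t"
    proof (rule runs_Seq)
      show "runs c t B (\<lambda>t'. nmem t' i 0 = k \<and> I (Suc k) (nupdate i 0 (Suc k) t'))"
        by (rule step) (use that I e in auto)
      show "runs (nset i (NAdd (nvar i) (NConst 1))) t' 1 (\<lambda>t. nmem t i 0 = Suc k \<and> Suc k \<le> N \<and> I (Suc k) t)"
        if "nmem t' i 0 = k \<and> I (Suc k) (nupdate i 0 (Suc k) t')" for t'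
        by (rule runs_NAssign) (use that I e \<open>bval (NLess (nvar i) e) t\<close> in auto)
    qed simp
  qed simp
qed (use B' in simp)

text \<open>The frame condition: \<open>X\<close> lists the names, of either kind of array, that a
  program may have changed.\<close>

definition agree :: "string set \<Rightarrow> store \<Rightarrow> store \<Rightarrow> bool" where
  "agree X s t \<longleftrightarrow> (\<forall>a. a \<notin> X \<longrightarrow> nmem t a = nmem s a \<and> rmem t a = rmem s a)"

lemma agree_refl [simp]: "agree X s s"
  by (simp add: agree_def)

lemma agree_update [simp]:
  "a \<in> X \<Longrightarrow> agree X s (nupdate a i v t) \<longleftrightarrow> agree X s t"
  "a \<in> X \<Longrightarrow> agree X s (rupdate a i r t) \<longleftrightarrow> agree X s t"
  by (auto simp: agree_def)

lemma agree_trans: "agree X s t \<Longrightarrow> agree Y t u \<Longrightarrow> X \<subseteq> Z \<Longrightarrow> Y \<subseteq> Z \<Longrightarrow> agree Z s u"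
  unfolding agree_def by (metis subsetD)

lemma agreeD: "agree X s t \<Longrightarrow> a \<notin> X \<Longrightarrow> nmem t a = nmem s a" "agree X s t \<Longrightarrow> a \<notin> X \<Longrightarrow> rmem t a = rmem s a"
  by (simp_all add: agree_def)

abbreviation "row_e \<equiv> NCell ''row'' (nvar ''e'')"
abbreviation "col_e \<equiv> NCell ''col'' (nvar ''e'')"
abbreviation "rconst c \<equiv> ROfNat (NConst c)"

text \<open>A sparse matrix-vector product with \<open>w\<close>, accumulated entry by entry, so
  that the order of the listing does not matter.\<close>

definition scan :: com where
  "scan = for_loop ''e'' (nvar ''nnz'')
     (RAssign ''acc'' row_e
       (RAdd (RCell ''acc'' row_e) (RMul (RCell ''val'' (nvar ''e'')) (RCell ''w'' col_e))))"

text \<open>\<open>R\<close>, \<open>C\<close> and \<open>V\<close> are the three input arrays.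
  Continuing the rows by unit vectors from index \<open>n\<close> on lets one index address basis
  vectors of both kinds.\<close>

locale sparse_input =
  fixes n d m :: nat and R C :: "nat \<Rightarrow> nat" and V :: "nat \<Rightarrow> real" and b :: "nat \<Rightarrow> nat \<Rightarrow> real"
  assumes d: "1 \<le> d"
    and entry: "e < m \<Longrightarrow> R e < n \<and> C e < d \<and> V e = b (R e) (C e)"
    and complete: "i < n \<Longrightarrow> q < d \<Longrightarrow> b i q \<noteq> 0 \<Longrightarrow> \<exists>e<m. R e = i \<and> C e = q"
    and unit: "z < d \<Longrightarrow> q < d \<Longrightarrow> b (n + z) q = (if q = z then 1 else 0)"
    and inj: "e < m \<Longrightarrow> e' < m \<Longrightarrow> R e = R e' \<Longrightarrow> C e = C e' \<Longrightarrow> e = e'"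
begin

text \<open>The cost unit: every pass is bounded by a multiple of \<open>W\<close>, which is at
  least 1 and so absorbs single assignments too.\<close>

definition W :: nat where "W = m + d * d"

lemma W: "m \<le> W" "d \<le> W" "d * d \<le> W" "1 \<le> W"
proof -
  have "d * 1 \<le> d * d"
    using d by (intro mult_le_mono) auto
  then show "m \<le> W" "d \<le> W" "d * d \<le> W" "1 \<le> W"
    using d unfolding W_def by linarith+
qed

definition inp :: "store \<Rightarrow> bool" where
  "inp s \<longleftrightarrow> nmem s ''d'' 0 = d \<and> nmem s ''nnz'' 0 = m \<and> (\<forall>e<m. nmem s ''row'' e = R e) \<and>
     (\<forall>e<m. nmem s ''col'' e = C e) \<and> (\<forall>e<m. rmem s ''val'' e = V e)"

lemma inp_agree:
  assumes "inp s" "agree X s t" "X \<inter> {''d'', ''nnz'', ''row'', ''col'', ''val''} = {}"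
  shows "inp t"
proof -
  have "\<forall>a\<in>{''d'', ''nnz'', ''row'', ''col'', ''val''}. nmem t a = nmem s a \<and> rmem t a = rmem s a"
    using assms(2,3) unfolding agree_def by blast
  then show ?thesis
    using assms(1) by (simp add: inp_def)
qed

lemma inp_update [simp]:
  "a \<notin> {''d'', ''nnz'', ''row'', ''col'', ''val''} \<Longrightarrow> inp (nupdate a i v s) = inp s"
  "a \<notin> {''d'', ''nnz'', ''row'', ''col'', ''val''} \<Longrightarrow> inp (rupdate a i r s) = inp s"
proof -
  assume "a \<notin> {''d'', ''nnz'', ''row'', ''col'', ''val''}"
  then have a: "{a} \<inter> {''d'', ''nnz'', ''row'', ''col'', ''val''} = {}"
    by blast
  have inp_cong: "inp t = inp s" if "agree {a} s t" for t
    using inp_agree[OF _ that a] inp_agree[of t "{a}" s, OF _ _ a] that unfolding agree_def by metis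
  show "inp (nupdate a i v s) = inp s" "inp (rupdate a i r s) = inp s"
    by (rule inp_cong; simp)+
qed

text \<open>What the first \<open>k\<close> entries contribute to cell \<open>i\<close> in a product
  with \<open>w\<close>; for \<open>k = m\<close> it is the inner product of row \<open>i\<close>
  with \<open>w\<close>.\<close>

definition rowdot :: "(nat \<Rightarrow> real) \<Rightarrow> nat \<Rightarrow> nat \<Rightarrow> real" where
  "rowdot w k i = (\<Sum>e<k. if R e = i then V e * w (C e) else 0)"

lemma runs_scan:
  assumes "inp s"
  shows "runs scan s (5 * W) (\<lambda>t. inp t \<and> agree {''e'', ''acc''} s t \<and>
    rmem t ''acc'' = (\<lambda>i. rmem s ''acc'' i + rowdot (rmem s ''w'') m i))"
  unfolding scan_def
proof (rule runs_for[where N = m and B = 1 and I = "\<lambda>k t. inp t \<and> agree {''e'', ''acc''} s t \<and>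
    rmem t ''acc'' = (\<lambda>i. rmem s ''acc'' i + rowdot (rmem s ''w'') k i)"])
  fix k t
  assume k: "k < m" "nmem t ''e'' 0 = k"
    and I: "inp t \<and> agree {''e'', ''acc''} s t \<and> rmem t ''acc'' = (\<lambda>i. rmem s ''acc'' i + rowdot (rmem s ''w'') k i)"
  then have [simp]: "rmem t ''w'' = rmem s ''w''" "nmem t ''row'' k = R k" "nmem t ''col'' k = C k" "rmem t ''val'' k = V k"
    by (auto simp: inp_def agree_def)
  show "runs (RAssign ''acc'' row_e
       (RAdd (RCell ''acc'' row_e) (RMul (RCell ''val'' (nvar ''e'')) (RCell ''w'' col_e)))) t 1
      (\<lambda>t'. nmem t' ''e'' 0 = k \<and> inp (nupdate ''e'' 0 (Suc k) t') \<and>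
        agree {''e'', ''acc''} s (nupdate ''e'' 0 (Suc k) t') \<and>
        rmem (nupdate ''e'' 0 (Suc k) t') ''acc'' = (\<lambda>i. rmem s ''acc'' i + rowdot (rmem s ''w'') (Suc k) i))"
    by (rule runs_RAssign) (use k I in \<open>auto simp: rowdot_def\<close>)
qed (use assms W in \<open>auto simp: rowdot_def inp_def\<close>)

end

section \<open>Sparse and dense linear algebra\<close>

text \<open>Resetting \<open>acc\<close> makes further entries of the same row leave \<open>lev\<close> unchanged, so a pass over the
  entries updates every row exactly once.\<close>

definition levup :: com where
  "levup = for_loop ''e'' (nvar ''nnz'')
     (Seq (RAssign ''lev'' row_e
            (RAdd (RCell ''lev'' row_e) (RMul (rvar ''sig'') (RMul (RCell ''acc'' row_e) (RCell ''acc'' row_e)))))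
          (RAssign ''acc'' row_e (rconst 0)))"

text \<open>The loop is over entries and not over rows, so its cost does not depend on
  \<open>n\<close>. Rows without entries are never visited; their value is 0, which cannot exceed
  the initial \<open>best\<close>, 0 or 1 in its two uses.\<close>

definition argmax :: com where
  "argmax = for_loop ''e'' (nvar ''nnz'')
     (Cond (RLess (rvar ''best'') (RCell ''lev'' row_e))
       (Seq (rset ''best'' (RCell ''lev'' row_e)) (nset ''j'' row_e)) Skip)"

definition clear :: com where
  "clear = for_loop ''e'' (nvar ''nnz'') (RAssign ''lev'' row_e (rconst 0))"

text \<open>Unpacks the sparse row \<open>j\<close> into a dense vector. Two negated comparisons
  express equality of integers.\<close>

definition load :: com where
  "load = Seq (for_loop ''q'' (nvar ''d'') (RAssign ''v'' (nvar ''q'') (rconst 0)))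
     (for_loop ''e'' (nvar ''nnz'')
       (Cond (BAnd (BNot (NLess row_e (nvar ''j''))) (BNot (NLess (nvar ''j'') row_e)))
         (RAssign ''v'' col_e (RCell ''val'' (nvar ''e''))) Skip))"

text \<open>Matrices are stored by rows. The language has no integer multiplication, so the counters \<open>b\<close> and
  \<open>kb\<close> run through the offsets of the rows.\<close>

definition dotrow :: "string \<Rightarrow> com" where
  "dotrow X = for_loop ''q'' (nvar ''d'') (RAssign ''y'' (nvar ''p'')
     (RAdd (RCell ''y'' (nvar ''p'')) (RMul (RCell X (NAdd (nvar ''b'') (nvar ''q''))) (RCell ''v'' (nvar ''q'')))))"

definition matvec :: "string \<Rightarrow> com" where
  "matvec X = Seq (nset ''b'' (NConst 0)) (for_loop ''p'' (nvar ''d'')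
     (Seq (RAssign ''y'' (nvar ''p'') (rconst 0))
       (Seq (dotrow X) (nset ''b'' (NAdd (nvar ''b'') (nvar ''d''))))))"

definition axpyrow :: "string \<Rightarrow> com" where
  "axpyrow X = for_loop ''q'' (nvar ''d'') (RAssign X (NAdd (nvar ''b'') (nvar ''q''))
     (RAdd (RCell X (NAdd (nvar ''b'') (nvar ''q''))) (RMul (RCell ''y'' (nvar ''p'')) (RCell ''w'' (nvar ''q'')))))"

definition rank1 :: "string \<Rightarrow> com" where
  "rank1 X = Seq (nset ''b'' (NConst 0)) (for_loop ''p'' (nvar ''d'')
     (Seq (axpyrow X) (nset ''b'' (NAdd (nvar ''b'') (nvar ''d'')))))"

definition copyrow :: com where
  "copyrow = for_loop ''q'' (nvar ''d'')
     (RAssign ''w'' (nvar ''q'') (RCell ''T'' (NAdd (nvar ''kb'') (nvar ''q''))))"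

text \<open>Non-aliasing facts for the routines that take the name of a matrix as a parameter, where
  simplification cannot compare string literals.\<close>

lemma matrix_name_neq:
  assumes "X \<in> {''T'', ''H''}"
  shows "X \<noteq> ''q''" "''q'' \<noteq> X" "X \<noteq> ''p''" "''p'' \<noteq> X" "X \<noteq> ''b''" "''b'' \<noteq> X"
    "X \<noteq> ''y''" "''y'' \<noteq> X" "X \<noteq> ''w''" "''w'' \<noteq> X" "X \<noteq> ''v''" "''v'' \<noteq> X"
    "X \<noteq> ''d''" "X \<noteq> ''nnz''" "X \<noteq> ''row''" "X \<noteq> ''col''" "X \<noteq> ''val''"
  using assms by auto

context sparse_input
begin

text \<open>Entries in one row have distinct columns, so the sum over entries is a sum over their
  columns; all other columns hold zeros.\<close>

lemma rowdot_ip: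
  assumes "i < n"
  shows "rowdot w m i = ip d (b i) w"
proof -
  define E where "E = {e. e < m \<and> R e = i}"
  have inj: "inj_on C E"
    unfolding E_def by (rule inj_onI) (use inj in auto)
  have "rowdot w m i = (\<Sum>e\<in>E. V e * w (C e))"
    unfolding rowdot_def E_def by (rule sum.mono_neutral_cong_right) auto
  also have "\<dots> = (\<Sum>e\<in>E. b i (C e) * w (C e))"
    by (rule sum.cong) (use entry in \<open>auto simp: E_def\<close>)
  also have "\<dots> = (\<Sum>q\<in>C ` E. b i q * w q)"
    by (simp add: sum.reindex[OF inj])
  also have "\<dots> = ip d (b i) w"
    unfolding ip_def by (rule sum.mono_neutral_left)
      (use entry complete[OF assms] in \<open>auto simp: E_def\<close>)
  finally show ?thesis .
qed

lemma rowdot_outside: "i \<notin> R ` {..<m} \<Longrightarrow> rowdot w m i = 0"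
  unfolding rowdot_def by (rule sum.neutral) auto

text \<open>The assumption on rows without entries makes the formula for \<open>lev\<close> hold at
  every index: there the added square is 0.\<close>

lemma runs_levup:
  assumes "inp s" and "\<And>i. i \<notin> R ` {..<m} \<Longrightarrow> rmem s ''acc'' i = 0"
  shows "runs levup s (6 * W) (\<lambda>t. inp t \<and> agree {''e'', ''acc'', ''lev''} s t \<and> rmem t ''acc'' = (\<lambda>_. 0) \<and>
    rmem t ''lev'' = (\<lambda>i. rmem s ''lev'' i + rmem s ''sig'' 0 * (rmem s ''acc'' i)\<^sup>2))"
proof -
  define I where "I k t \<longleftrightarrow> inp t \<and> agree {''e'', ''acc'', ''lev''} s t \<and>
    rmem t ''acc'' = (\<lambda>i. if i \<in> R ` {..<k} then 0 else rmem s ''acc'' i) \<and>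
    rmem t ''lev'' = (\<lambda>i. rmem s ''lev'' i + (if i \<in> R ` {..<k} then rmem s ''sig'' 0 * (rmem s ''acc'' i)\<^sup>2 else 0))"
    for k t
  show ?thesis
    unfolding levup_def
  proof (rule runs_for[where N = m and B = 2 and I = I])
    fix k t
    assume k: "k < m" "nmem t ''e'' 0 = k" and I: "I k t"
    then have [simp]: "rmem t ''sig'' = rmem s ''sig''" "nmem t ''row'' k = R k"
      by (auto simp: inp_def agree_def I_def)
    show "runs (Seq (RAssign ''lev'' row_e
            (RAdd (RCell ''lev'' row_e) (RMul (rvar ''sig'') (RMul (RCell ''acc'' row_e) (RCell ''acc'' row_e)))))
          (RAssign ''acc'' row_e (rconst 0))) t 2
        (\<lambda>t'. nmem t' ''e'' 0 = k \<and> I (Suc k) (nupdate ''e'' 0 (Suc k) t'))"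
    proof (rule runs_Seq)
      show "runs (RAssign ''lev'' row_e
            (RAdd (RCell ''lev'' row_e) (RMul (rvar ''sig'') (RMul (RCell ''acc'' row_e) (RCell ''acc'' row_e))))) t 1
          (\<lambda>t1. t1 = rupdate ''lev'' (R k) (rmem t ''lev'' (R k) + rmem s ''sig'' 0 * (rmem t ''acc'' (R k))\<^sup>2) t)"
        by (rule runs_RAssign) (use k in \<open>auto simp: power2_eq_square\<close>)
      show "runs (RAssign ''acc'' row_e (rconst 0)) t1 1
          (\<lambda>t'. nmem t' ''e'' 0 = k \<and> I (Suc k) (nupdate ''e'' 0 (Suc k) t'))"
        if "t1 = rupdate ''lev'' (R k) (rmem t ''lev'' (R k) + rmem s ''sig'' 0 * (rmem t ''acc'' (R k))\<^sup>2) t" for t1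
        by (rule runs_RAssign) (use k I in \<open>auto simp: that I_def lessThan_Suc fun_eq_iff\<close>)
    qed simp
  next
    fix t assume "I m t"
    then show "inp t \<and> agree {''e'', ''acc'', ''lev''} s t \<and> rmem t ''acc'' = (\<lambda>_. 0) \<and>
        rmem t ''lev'' = (\<lambda>i. rmem s ''lev'' i + rmem s ''sig'' 0 * (rmem s ''acc'' i)\<^sup>2)"
      using assms(2) by (auto simp: I_def fun_eq_iff)
  qed (use assms W in \<open>auto simp: I_def inp_def\<close>)
qed

text \<open>\<open>acc\<close> is zero before and after, so passes can follow each other without a
  separate clearing loop.\<close>

lemma runs_pass:
  assumes "inp s" and "rmem s ''acc'' = (\<lambda>_. 0)"
  shows "runs (Seq scan levup) s (11 * W) (\<lambda>t. inp t \<and> agree {''e'', ''acc'', ''lev''} s t \<and>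
    rmem t ''acc'' = (\<lambda>_. 0) \<and>
    rmem t ''lev'' = (\<lambda>i. rmem s ''lev'' i + rmem s ''sig'' 0 * (rowdot (rmem s ''w'') m i)\<^sup>2))"
proof (rule runs_Seq[OF runs_scan[OF assms(1)]])
  fix t
  assume t: "inp t \<and> agree {''e'', ''acc''} s t \<and> rmem t ''acc'' = (\<lambda>i. rmem s ''acc'' i + rowdot (rmem s ''w'') m i)"
  then have acc: "rmem t ''acc'' = rowdot (rmem s ''w'') m" and [simp]: "rmem t ''lev'' = rmem s ''lev''" "rmem t ''sig'' = rmem s ''sig''"
    using assms(2) by (auto simp: agree_def)
  show "runs levup t (6 * W) (\<lambda>t. inp t \<and> agree {''e'', ''acc'', ''lev''} s t \<and> rmem t ''acc'' = (\<lambda>_. 0) \<and>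
      rmem t ''lev'' = (\<lambda>i. rmem s ''lev'' i + rmem s ''sig'' 0 * (rowdot (rmem s ''w'') m i)\<^sup>2))"
  proof (rule runs_weaken[OF runs_levup])
    fix u
    assume u: "inp u \<and> agree {''e'', ''acc'', ''lev''} t u \<and> rmem u ''acc'' = (\<lambda>_. 0) \<and>
      rmem u ''lev'' = (\<lambda>i. rmem t ''lev'' i + rmem t ''sig'' 0 * (rmem t ''acc'' i)\<^sup>2)"
    then have "agree {''e'', ''acc'', ''lev''} s u"
      using t by (blast intro: agree_trans)
    then show "inp u \<and> agree {''e'', ''acc'', ''lev''} s u \<and> rmem u ''acc'' = (\<lambda>_. 0) \<and>
      rmem u ''lev'' = (\<lambda>i. rmem s ''lev'' i + rmem s ''sig'' 0 * (rowdot (rmem s ''w'') m i)\<^sup>2)"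
      using u by (simp add: acc)
  qed (use t rowdot_outside in \<open>auto simp: acc\<close>)
qed simp

lemma runs_argmax:
  assumes "inp s"
  shows "runs argmax s (7 * W) (\<lambda>t. inp t \<and> agree {''e'', ''best'', ''j''} s t \<and>
    (\<forall>e<m. rmem s ''lev'' (R e) \<le> rmem t ''best'' 0) \<and> rmem s ''best'' 0 \<le> rmem t ''best'' 0 \<and>
    (rmem t ''best'' 0 = rmem s ''best'' 0 \<or> (nmem t ''j'' 0 < n \<and> rmem t ''best'' 0 = rmem s ''lev'' (nmem t ''j'' 0))))"
proof -
  define I where "I k t \<longleftrightarrow> inp t \<and> agree {''e'', ''best'', ''j''} s t \<and>
    (\<forall>e<k. rmem s ''lev'' (R e) \<le> rmem t ''best'' 0) \<and> rmem s ''best'' 0 \<le> rmem t ''best'' 0 \<and>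
    (rmem t ''best'' 0 = rmem s ''best'' 0 \<or> (nmem t ''j'' 0 < n \<and> rmem t ''best'' 0 = rmem s ''lev'' (nmem t ''j'' 0)))"
    for k t
  show ?thesis
    unfolding argmax_def
  proof (rule runs_for[where N = m and B = 3 and I = I])
    fix k t
    assume k: "k < m" "nmem t ''e'' 0 = k" and I: "I k t"
    then have [simp]: "rmem t ''lev'' = rmem s ''lev''" "nmem t ''row'' k = R k"
      by (auto simp: inp_def agree_def I_def)
    have R: "R k < n"
      using entry k by simp
    let ?Q = "\<lambda>t'. nmem t' ''e'' 0 = k \<and> I (Suc k) (nupdate ''e'' 0 (Suc k) t')"
    show "runs (Cond (RLess (rvar ''best'') (RCell ''lev'' row_e))
       (Seq (rset ''best'' (RCell ''lev'' row_e)) (nset ''j'' row_e)) Skip) t 3 ?Q"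
    proof (rule runs_Cond)
      assume less: "bval (RLess (rvar ''best'') (RCell ''lev'' row_e)) t"
      show "runs (Seq (rset ''best'' (RCell ''lev'' row_e)) (nset ''j'' row_e)) t 2 ?Q"
      proof (rule runs_Seq)
        show "runs (rset ''best'' (RCell ''lev'' row_e)) t 1 (\<lambda>t1. t1 = rupdate ''best'' 0 (rmem s ''lev'' (R k)) t)"
          by (rule runs_RAssign) (use k in auto)
        show "runs (nset ''j'' row_e) t1 1 ?Q" if "t1 = rupdate ''best'' 0 (rmem s ''lev'' (R k)) t" for t1
          by (rule runs_NAssign)
            (use that k I less R in \<open>auto simp: I_def less_Suc_eq intro: order_trans less_imp_le\<close>)
      qed simp
    next
      assume "\<not> bval (RLess (rvar ''best'') (RCell ''lev'' row_e)) t"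
      then show "runs Skip t 2 ?Q"
        by (intro runs_Skip) (use k I in \<open>auto simp: I_def less_Suc_eq\<close>)
    qed simp
  next
    fix t assume "I m t"
    then show "inp t \<and> agree {''e'', ''best'', ''j''} s t \<and>
        (\<forall>e<m. rmem s ''lev'' (R e) \<le> rmem t ''best'' 0) \<and> rmem s ''best'' 0 \<le> rmem t ''best'' 0 \<and>
        (rmem t ''best'' 0 = rmem s ''best'' 0 \<or> (nmem t ''j'' 0 < n \<and> rmem t ''best'' 0 = rmem s ''lev'' (nmem t ''j'' 0)))"
      by (simp add: I_def)
  qed (use assms W in \<open>auto simp: I_def inp_def\<close>)
qed

lemma runs_clear:
  assumes "inp s" and "\<And>i. i \<notin> R ` {..<m} \<Longrightarrow> rmem s ''lev'' i = 0"
  shows "runs clear s (5 * W) (\<lambda>t. inp t \<and> agree {''e'', ''lev''} s t \<and> rmem t ''lev'' = (\<lambda>_. 0))"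
proof -
  define I where "I k t \<longleftrightarrow> inp t \<and> agree {''e'', ''lev''} s t \<and>
    rmem t ''lev'' = (\<lambda>i. if i \<in> R ` {..<k} then 0 else rmem s ''lev'' i)" for k t
  show ?thesis
    unfolding clear_def
  proof (rule runs_for[where N = m and B = 1 and I = I])
    fix k t
    assume k: "k < m" "nmem t ''e'' 0 = k" and I: "I k t"
    then have [simp]: "nmem t ''row'' k = R k"
      by (auto simp: inp_def I_def)
    show "runs (RAssign ''lev'' row_e (rconst 0)) t 1
        (\<lambda>t'. nmem t' ''e'' 0 = k \<and> I (Suc k) (nupdate ''e'' 0 (Suc k) t'))"
      by (rule runs_RAssign) (use k I in \<open>auto simp: I_def lessThan_Suc fun_eq_iff\<close>)
  next
    fix t assume "I m t"
    then show "inp t \<and> agree {''e'', ''lev''} s t \<and> rmem t ''lev'' = (\<lambda>_. 0)"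
      using assms(2) by (auto simp: I_def fun_eq_iff)
  qed (use assms W in \<open>auto simp: I_def inp_def\<close>)
qed

lemma runs_load:
  assumes "inp s" and j: "nmem s ''j'' 0 < n"
  shows "runs load s (11 * W) (\<lambda>t. inp t \<and> agree {''q'', ''e'', ''v''} s t \<and>
    (\<forall>q<d. rmem t ''v'' q = b (nmem s ''j'' 0) q))"
proof -
  define j where "j = nmem s ''j'' 0"
  define J where "J k t \<longleftrightarrow> inp t \<and> agree {''q'', ''v''} s t \<and> (\<forall>q<k. rmem t ''v'' q = 0)" for k t
  define I where "I k t \<longleftrightarrow> inp t \<and> agree {''q'', ''e'', ''v''} s t \<and>
    (\<forall>q<d. rmem t ''v'' q = (if \<exists>e<k. R e = j \<and> C e = q then b j q else 0))" for k t
  show ?thesis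
    unfolding load_def
  proof (rule runs_Seq)
    show "runs (for_loop ''q'' (nvar ''d'') (RAssign ''v'' (nvar ''q'') (rconst 0))) s (5 * W) (J d)"
    proof (rule runs_for[where N = d and B = 1 and I = J])
      fix k t
      assume k: "k < d" "nmem t ''q'' 0 = k" and J: "J k t"
      show "runs (RAssign ''v'' (nvar ''q'') (rconst 0)) t 1
          (\<lambda>t'. nmem t' ''q'' 0 = k \<and> J (Suc k) (nupdate ''q'' 0 (Suc k) t'))"
        by (rule runs_RAssign) (use k J in \<open>auto simp: J_def\<close>)
    qed (use assms W in \<open>auto simp: J_def inp_def\<close>)
    fix s' assume s': "J d s'"
    show "runs (for_loop ''e'' (nvar ''nnz'')
       (Cond (BAnd (BNot (NLess row_e (nvar ''j''))) (BNot (NLess (nvar ''j'') row_e)))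
         (RAssign ''v'' col_e (RCell ''val'' (nvar ''e''))) Skip)) s' (6 * W)
        (\<lambda>t. inp t \<and> agree {''q'', ''e'', ''v''} s t \<and> (\<forall>q<d. rmem t ''v'' q = b (nmem s ''j'' 0) q))"
    proof (rule runs_for[where N = m and B = 2 and I = I])
      have "agree {''q'', ''e'', ''v''} s s'"
        using s' unfolding J_def agree_def by blast
      then show "I 0 (nupdate ''e'' 0 0 s')"
        using s' by (auto simp: I_def J_def)
      fix k t
      assume k: "k < m" "nmem t ''e'' 0 = k" and I: "I k t"
      then have [simp]: "nmem t ''row'' k = R k" "nmem t ''col'' k = C k" "rmem t ''val'' k = V k" "nmem t ''j'' 0 = j"
        by (auto simp: inp_def I_def agree_def j_def)
      let ?Q = "\<lambda>t'. nmem t' ''e'' 0 = k \<and> I (Suc k) (nupdate ''e'' 0 (Suc k) t')"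
      show "runs (Cond (BAnd (BNot (NLess row_e (nvar ''j''))) (BNot (NLess (nvar ''j'') row_e)))
         (RAssign ''v'' col_e (RCell ''val'' (nvar ''e''))) Skip) t 2 ?Q"
      proof (rule runs_Cond)
        assume "bval (BAnd (BNot (NLess row_e (nvar ''j''))) (BNot (NLess (nvar ''j'') row_e))) t"
        then have "R k = j"
          using k by simp
        then show "runs (RAssign ''v'' col_e (RCell ''val'' (nvar ''e''))) t 1 ?Q"
          by (intro runs_RAssign) (use k I entry[of k] in \<open>auto simp: I_def less_Suc_eq\<close>)
      next
        assume "\<not> bval (BAnd (BNot (NLess row_e (nvar ''j''))) (BNot (NLess (nvar ''j'') row_e))) t"
        then have "R k \<noteq> j"
          using k by auto
        then show "runs Skip t 1 ?Q"
          by (intro runs_Skip) (use k I in \<open>auto simp: I_def less_Suc_eq\<close>)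
      qed simp
    next
      fix t assume "I m t"
      then show "inp t \<and> agree {''q'', ''e'', ''v''} s t \<and> (\<forall>q<d. rmem t ''v'' q = b (nmem s ''j'' 0) q)"
        using complete[of j] j by (fastforce simp: I_def j_def)
    qed (use W in \<open>auto simp: I_def inp_def\<close>)
  qed simp
qed

lemma runs_copyrow:
  assumes "inp s"
  shows "runs copyrow s (5 * W) (\<lambda>t. inp t \<and> agree {''q'', ''w''} s t \<and>
    (\<forall>q<d. rmem t ''w'' q = rmem s ''T'' (nmem s ''kb'' 0 + q)))"
proof -
  define I where "I k t \<longleftrightarrow> inp t \<and> agree {''q'', ''w''} s t \<and>
    (\<forall>q<k. rmem t ''w'' q = rmem s ''T'' (nmem s ''kb'' 0 + q))" for k t
  show ?thesis
    unfolding copyrow_def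
  proof (rule runs_for[where N = d and B = 1 and I = I])
    fix k t
    assume k: "k < d" "nmem t ''q'' 0 = k" and I: "I k t"
    then have [simp]: "rmem t ''T'' = rmem s ''T''" "nmem t ''kb'' = nmem s ''kb''"
      by (auto simp: I_def agree_def)
    show "runs (RAssign ''w'' (nvar ''q'') (RCell ''T'' (NAdd (nvar ''kb'') (nvar ''q'')))) t 1
        (\<lambda>t'. nmem t' ''q'' 0 = k \<and> I (Suc k) (nupdate ''q'' 0 (Suc k) t'))"
      by (rule runs_RAssign) (use k I in \<open>auto simp: I_def less_Suc_eq\<close>)
  qed (use assms W in \<open>auto simp: I_def inp_def\<close>)
qed

lemma runs_dotrow:
  assumes "inp s" and X: "X \<in> {''T'', ''H''}"
  shows "runs (dotrow X) s (3 * d + 2) (\<lambda>t. inp t \<and> agree {''q'', ''y''} s t \<and>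
    rmem t ''y'' = (rmem s ''y'')(nmem s ''p'' 0 := rmem s ''y'' (nmem s ''p'' 0) +
      (\<Sum>q<d. rmem s X (nmem s ''b'' 0 + q) * rmem s ''v'' q)))"
proof -
  define I where "I k t \<longleftrightarrow> inp t \<and> agree {''q'', ''y''} s t \<and>
    rmem t ''y'' = (rmem s ''y'')(nmem s ''p'' 0 := rmem s ''y'' (nmem s ''p'' 0) +
      (\<Sum>q<k. rmem s X (nmem s ''b'' 0 + q) * rmem s ''v'' q))" for k t
  show ?thesis
    unfolding dotrow_def
  proof (rule runs_for[where N = d and B = 1 and I = I])
    fix k t
    assume k: "k < d" "nmem t ''q'' 0 = k" and I: "I k t"
    have ag: "agree {''q'', ''y''} s t"
      using I by (simp add: I_def)
    have [simp]: "rmem t X = rmem s X" "rmem t ''v'' = rmem s ''v''" "nmem t ''p'' = nmem s ''p''" "nmem t ''b'' = nmem s ''b''"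
      by (simp_all add: agreeD[OF ag] matrix_name_neq[OF X])
    show "runs (RAssign ''y'' (nvar ''p'')
     (RAdd (RCell ''y'' (nvar ''p'')) (RMul (RCell X (NAdd (nvar ''b'') (nvar ''q''))) (RCell ''v'' (nvar ''q''))))) t 1
        (\<lambda>t'. nmem t' ''q'' 0 = k \<and> I (Suc k) (nupdate ''q'' 0 (Suc k) t'))"
      by (rule runs_RAssign) (use k I in \<open>auto simp: I_def\<close>)
  qed (use assms W in \<open>auto simp: I_def inp_def\<close>)
qed

lemma runs_matvec:
  assumes "inp s" and X: "X \<in> {''T'', ''H''}"
  shows "runs (matvec X) s (12 * W) (\<lambda>t. inp t \<and> agree {''p'', ''q'', ''b'', ''y''} s t \<and>
    (\<forall>p<d. rmem t ''y'' p = (\<Sum>q<d. rmem s X (p * d + q) * rmem s ''v'' q)))"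
proof -
  define I where "I k t \<longleftrightarrow> inp t \<and> agree {''p'', ''q'', ''b'', ''y''} s t \<and> nmem t ''b'' 0 = k * d \<and>
    (\<forall>p<k. rmem t ''y'' p = (\<Sum>q<d. rmem s X (p * d + q) * rmem s ''v'' q))" for k t
  show ?thesis
    unfolding matvec_def
  proof (rule runs_Seq)
    show "runs (nset ''b'' (NConst 0)) s 1 (\<lambda>t. t = nupdate ''b'' 0 0 s)"
      by (rule runs_NAssign) auto
    fix s' assume s': "s' = nupdate ''b'' 0 0 s"
    show "runs (for_loop ''p'' (nvar ''d'') (Seq (RAssign ''y'' (nvar ''p'') (rconst 0))
       (Seq (dotrow X) (nset ''b'' (NAdd (nvar ''b'') (nvar ''d'')))))) s' (11 * W)
       (\<lambda>t. inp t \<and> agree {''p'', ''q'', ''b'', ''y''} s t \<and>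
          (\<forall>p<d. rmem t ''y'' p = (\<Sum>q<d. rmem s X (p * d + q) * rmem s ''v'' q)))"
    proof (rule runs_for[where N = d and B = "3 * d + 4" and I = I])
      fix k t
      assume k: "k < d" "nmem t ''p'' 0 = k" and I: "I k t"
      then have [simp]: "rmem t X = rmem s X" "rmem t ''v'' = rmem s ''v''" "nmem t ''d'' 0 = d"
        using X by (auto simp: I_def agree_def inp_def)
      show "runs (Seq (RAssign ''y'' (nvar ''p'') (rconst 0))
       (Seq (dotrow X) (nset ''b'' (NAdd (nvar ''b'') (nvar ''d''))))) t (3 * d + 4)
        (\<lambda>t'. nmem t' ''p'' 0 = k \<and> I (Suc k) (nupdate ''p'' 0 (Suc k) t'))"
      proof (rule runs_Seq)
        show "runs (RAssign ''y'' (nvar ''p'') (rconst 0)) t 1 (\<lambda>t1. t1 = rupdate ''y'' k 0 t)"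
          by (rule runs_RAssign) (use k in auto)
        fix t1 assume t1: "t1 = rupdate ''y'' k 0 t"
        show "runs (Seq (dotrow X) (nset ''b'' (NAdd (nvar ''b'') (nvar ''d'')))) t1 (3 * d + 3)
            (\<lambda>t'. nmem t' ''p'' 0 = k \<and> I (Suc k) (nupdate ''p'' 0 (Suc k) t'))"
        proof (rule runs_Seq[OF runs_dotrow[OF _ X]])
          show "inp t1"
            using I t1 by (simp add: I_def)
          have b1: "nmem t1 ''b'' 0 = k * d" "nmem t1 ''p'' 0 = k" and X1: "rmem t1 X = rmem s X" "rmem t1 ''v'' = rmem s ''v''"
            using I t1 k X by (auto simp: I_def)
          fix t2
          assume t2: "inp t2 \<and> agree {''q'', ''y''} t1 t2 \<and>
            rmem t2 ''y'' = (rmem t1 ''y'')(nmem t1 ''p'' 0 := rmem t1 ''y'' (nmem t1 ''p'' 0) +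
              (\<Sum>q<d. rmem t1 X (nmem t1 ''b'' 0 + q) * rmem t1 ''v'' q))"
          then have [simp]: "nmem t2 ''b'' 0 = k * d" "nmem t2 ''p'' 0 = k" "nmem t2 ''d'' 0 = d"
            using b1 by (auto simp: agree_def inp_def)
          have y2: "rmem t2 ''y'' = (rmem t ''y'')(k := \<Sum>q<d. rmem s X (k * d + q) * rmem s ''v'' q)"
            using t2 unfolding b1 X1 by (simp add: t1)
          have "agree {''p'', ''q'', ''b'', ''y''} s t1"
            using I t1 by (simp add: I_def)
          then have "agree {''p'', ''q'', ''b'', ''y''} s t2"
            using t2 by (blast intro: agree_trans)
          then show "runs (nset ''b'' (NAdd (nvar ''b'') (nvar ''d''))) t2 1
            (\<lambda>t'. nmem t' ''p'' 0 = k \<and> I (Suc k) (nupdate ''p'' 0 (Suc k) t'))"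
            by (intro runs_NAssign) (use t2[THEN conjunct1] I y2 in \<open>auto simp: I_def less_Suc_eq\<close>)
        qed simp
      qed simp
    next
      have "d * (3 * d + 4 + 2) + 2 = 3 * (d * d) + 6 * d + 2"
        by (simp add: algebra_simps)
      then show "d * (3 * d + 4 + 2) + 2 \<le> 11 * W"
        using W by linarith
    qed (use assms s' in \<open>auto simp: I_def inp_def\<close>)
  qed (use W in simp)
qed

lemma runs_axpyrow:
  assumes "inp s" and X: "X \<in> {''T'', ''H''}"
  shows "runs (axpyrow X) s (3 * d + 2) (\<lambda>t. inp t \<and> agree {''q'', X} s t \<and>
    rmem t X = (\<lambda>i. rmem s X i + (if nmem s ''b'' 0 \<le> i \<and> i < nmem s ''b'' 0 + d
      then rmem s ''y'' (nmem s ''p'' 0) * rmem s ''w'' (i - nmem s ''b'' 0) else 0)))"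
proof -
  define I where "I k t \<longleftrightarrow> inp t \<and> agree {''q'', X} s t \<and>
    rmem t X = (\<lambda>i. rmem s X i + (if nmem s ''b'' 0 \<le> i \<and> i < nmem s ''b'' 0 + k
      then rmem s ''y'' (nmem s ''p'' 0) * rmem s ''w'' (i - nmem s ''b'' 0) else 0))" for k t
  show ?thesis
    unfolding axpyrow_def
  proof (rule runs_for[where N = d and B = 1 and I = I])
    fix k t
    assume k: "k < d" "nmem t ''q'' 0 = k" and I: "I k t"
    have ag: "agree {''q'', X} s t"
      using I by (simp add: I_def)
    have [simp]: "rmem t ''w'' = rmem s ''w''" "rmem t ''y'' = rmem s ''y''" "nmem t ''p'' = nmem s ''p''" "nmem t ''b'' = nmem s ''b''"
      by (simp_all add: agreeD[OF ag] matrix_name_neq[OF X])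
    show "runs (RAssign X (NAdd (nvar ''b'') (nvar ''q''))
     (RAdd (RCell X (NAdd (nvar ''b'') (nvar ''q''))) (RMul (RCell ''y'' (nvar ''p'')) (RCell ''w'' (nvar ''q''))))) t 1
        (\<lambda>t'. nmem t' ''q'' 0 = k \<and> I (Suc k) (nupdate ''q'' 0 (Suc k) t'))"
      by (rule runs_RAssign) (use k I in \<open>auto simp: I_def fun_eq_iff matrix_name_neq[OF X]\<close>)
  qed (use assms W in \<open>auto simp: I_def inp_def\<close>)
qed

lemma runs_rank1:
  assumes "inp s" and X: "X \<in> {''T'', ''H''}"
  shows "runs (rank1 X) s (12 * W) (\<lambda>t. inp t \<and> agree {''p'', ''q'', ''b'', X} s t \<and>
    (\<forall>p<d. \<forall>q<d. rmem t X (p * d + q) = rmem s X (p * d + q) + rmem s ''y'' p * rmem s ''w'' q))"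
proof -
  \<comment> \<open>Flat index \<open>i\<close> is row \<open>i div d\<close> and column
    \<open>i mod d\<close>. The invariant describes every cell, so that rows from \<open>k\<close>
    on are known to be untouched.\<close>
  define I where "I k t \<longleftrightarrow> inp t \<and> agree {''p'', ''q'', ''b'', X} s t \<and> nmem t ''b'' 0 = k * d \<and>
    rmem t X = (\<lambda>i. rmem s X i + (if i < k * d then rmem s ''y'' (i div d) * rmem s ''w'' (i mod d) else 0))" for k t
  show ?thesis
    unfolding rank1_def
  proof (rule runs_Seq)
    show "runs (nset ''b'' (NConst 0)) s 1 (\<lambda>t. t = nupdate ''b'' 0 0 s)"
      by (rule runs_NAssign) auto
    fix s' assume s': "s' = nupdate ''b'' 0 0 s"
    show "runs (for_loop ''p'' (nvar ''d'') (Seq (axpyrow X) (nset ''b'' (NAdd (nvar ''b'') (nvar ''d''))))) s' (11 * W)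
       (\<lambda>t. inp t \<and> agree {''p'', ''q'', ''b'', X} s t \<and>
          (\<forall>p<d. \<forall>q<d. rmem t X (p * d + q) = rmem s X (p * d + q) + rmem s ''y'' p * rmem s ''w'' q))"
    proof (rule runs_for[where N = d and B = "3 * d + 3" and I = I])
      fix k t
      assume k: "k < d" "nmem t ''p'' 0 = k" and I: "I k t"
      have ag: "agree {''p'', ''q'', ''b'', X} s t"
        using I by (simp add: I_def)
      have t: "inp t" "rmem t ''w'' = rmem s ''w''" "rmem t ''y'' = rmem s ''y''" "nmem t ''b'' 0 = k * d"
        using I by (simp_all add: I_def agreeD[OF ag] matrix_name_neq[OF X])
      show "runs (Seq (axpyrow X) (nset ''b'' (NAdd (nvar ''b'') (nvar ''d'')))) t (3 * d + 3)
        (\<lambda>t'. nmem t' ''p'' 0 = k \<and> I (Suc k) (nupdate ''p'' 0 (Suc k) t'))"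
      proof (rule runs_Seq[OF runs_axpyrow[OF t(1) X]])
        fix t2
        assume t2: "inp t2 \<and> agree {''q'', X} t t2 \<and>
          rmem t2 X = (\<lambda>i. rmem t X i + (if nmem t ''b'' 0 \<le> i \<and> i < nmem t ''b'' 0 + d
            then rmem t ''y'' (nmem t ''p'' 0) * rmem t ''w'' (i - nmem t ''b'' 0) else 0))"
        then have [simp]: "nmem t2 ''b'' 0 = k * d" "nmem t2 ''p'' 0 = k" "nmem t2 ''d'' 0 = d"
          using t k by (auto simp: agreeD(1)[of "{''q'', X}" t t2] matrix_name_neq[OF X] inp_def)
        have "rmem t2 X i = rmem s X i + (if i < Suc k * d then rmem s ''y'' (i div d) * rmem s ''w'' (i mod d) else 0)" for i
        proof (cases "k * d \<le> i \<and> i < k * d + d")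
          case True
          then obtain r where "i = k * d + r" "r < d"
            by (metis add_less_cancel_left le_Suc_ex)
          then show ?thesis
            using t2 I k unfolding t by (simp add: I_def)
        next
          case False
          then show ?thesis
            using t2 I k unfolding t by (auto simp: I_def)
        qed
        moreover have "agree {''p'', ''q'', ''b'', X} s t2"
          using t2 I unfolding I_def by (blast intro: agree_trans)
        ultimately show "runs (nset ''b'' (NAdd (nvar ''b'') (nvar ''d''))) t2 1
            (\<lambda>t'. nmem t' ''p'' 0 = k \<and> I (Suc k) (nupdate ''p'' 0 (Suc k) t'))"
          by (intro runs_NAssign) (use t2[THEN conjunct1] in \<open>auto simp: I_def\<close>)
      qed simp
    next
      have "d * (3 * d + 3 + 2) + 2 = 3 * (d * d) + 5 * d + 2"
        by (simp add: algebra_simps)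
      then show "d * (3 * d + 3 + 2) + 2 \<le> 11 * W"
        using W by linarith
    next
      fix t assume I: "I d t"
      have "p * d + q < d * d" if "p < d" "q < d" for p q
      proof -
        have "p * d + q < Suc p * d" using that by simp
        also have "\<dots> \<le> d * d" using that by (intro mult_le_mono1) simp
        finally show ?thesis .
      qed
      then show "inp t \<and> agree {''p'', ''q'', ''b'', X} s t \<and>
          (\<forall>p<d. \<forall>q<d. rmem t X (p * d + q) = rmem s X (p * d + q) + rmem s ''y'' p * rmem s ''w'' q)"
        using I by (simp add: I_def)
    qed (use assms s' in \<open>auto simp: I_def inp_def\<close>)
  qed (use W in simp)
qed

end

section \<open>Pivot search, basis exchange and rank-one update\<close>

lemma runsE:
  assumes "runs c s B Q"
  obtains T t where "exec c s T t" "T \<le> B" "Q t"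
  using assms unfolding runs_def by blast

lemma runsI: "exec c s T t \<Longrightarrow> T \<le> B \<Longrightarrow> Q t \<Longrightarrow> runs c s B Q"
  unfolding runs_def by blast

text \<open>\<open>lev\<close> serves as scratch space for the squares of the products of row
  \<open>k\<close> of \<open>T\<close> with the rows; comparing squares finds the entry of largest
  absolute value. It is cleared afterwards because the leverages are later accumulated from
  zero.\<close>

definition pivot_search :: com where
  "pivot_search = Seq copyrow (Seq (rset ''sig'' (rconst 1)) (Seq (Seq scan levup)
     (Seq (rset ''best'' (rconst 0)) (Seq argmax clear))))"

text \<open>\<open>w\<close> still holds the old row \<open>k\<close> of \<open>T\<close> from the
  search, so the rank-one update may overwrite that row. The pivot is saved before its cell of
  \<open>y\<close> is decremented.\<close>

definition exchange :: com where
  "exchange = Seq load (Seq (matvec ''T'') (Seq (rset ''piv'' (RCell ''y'' (nvar ''k'')))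
     (Seq (RAssign ''y'' (nvar ''k'') (RSub (RCell ''y'' (nvar ''k'')) (rconst 1)))
     (Seq (for_loop ''q'' (nvar ''d'')
        (RAssign ''y'' (nvar ''q'') (RDiv (RSub (rconst 0) (RCell ''y'' (nvar ''q''))) (rvar ''piv''))))
     (rank1 ''T'')))))"

text \<open>Adds \<open>sig\<close> times the square of \<open>w\<close> to \<open>H\<close> and the
  matching change to all leverages. With \<open>sig = 1\<close> it builds the initial
  \<open>H\<close>; with a negative \<open>sig\<close> it is the Sherman-Morrison step.\<close>

definition update :: com where
  "update = Seq (for_loop ''q'' (nvar ''d'')
       (RAssign ''y'' (nvar ''q'') (RMul (rvar ''sig'') (RCell ''w'' (nvar ''q'')))))
     (Seq (rank1 ''H'') (Seq scan levup))"

text \<open>Rows can be output as soon as they are chosen: a slot is exchanged only in its own pivot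
  step, and the greedy phase never removes a row.\<close>

definition push :: com where
  "push = Seq (NAssign ''out'' (nvar ''len'') (nvar ''j'')) (nset ''len'' (NAdd (nvar ''len'') (NConst 1)))"

lemma runs_push:
  "runs push s 2 (\<lambda>t. agree {''out'', ''len''} s t \<and> output_set t = insert (nmem s ''j'' 0) (output_set s))"
  unfolding push_def
proof (rule runs_Seq)
  show "runs (NAssign ''out'' (nvar ''len'') (nvar ''j'')) s 1
      (\<lambda>t. t = nupdate ''out'' (nmem s ''len'' 0) (nmem s ''j'' 0) s)"
    by (rule runs_NAssign) auto
  show "runs (nset ''len'' (NAdd (nvar ''len'') (NConst 1))) t 1
      (\<lambda>t. agree {''out'', ''len''} s t \<and> output_set t = insert (nmem s ''j'' 0) (output_set s))"
    if "t = nupdate ''out'' (nmem s ''len'' 0) (nmem s ''j'' 0) s" for t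
    by (rule runs_NAssign) (auto simp: that output_set_def lessThan_Suc)
qed simp

context sparse_input
begin

lemma runs_pivot_search:
  assumes s: "inp s" "rmem s ''acc'' = (\<lambda>_. 0)" "rmem s ''lev'' = (\<lambda>_. 0)"
    and Tk: "\<And>q. Tk q = rmem s ''T'' (nmem s ''kb'' 0 + q)"
  shows "runs pivot_search s (30 * W) (\<lambda>t. inp t \<and>
    agree {''q'', ''w'', ''e'', ''acc'', ''lev'', ''sig'', ''best'', ''j''} s t \<and>
    rmem t ''acc'' = (\<lambda>_. 0) \<and> rmem t ''lev'' = (\<lambda>_. 0) \<and> (\<forall>q<d. rmem t ''w'' q = Tk q) \<and>
    (rmem t ''best'' 0 \<le> 0 \<longrightarrow> (\<forall>i<n. ip d Tk (b i) = 0)) \<and>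
    (0 < rmem t ''best'' 0 \<longrightarrow> nmem t ''j'' 0 < n \<and> ip d Tk (b (nmem t ''j'' 0)) \<noteq> 0 \<and>
      (\<forall>i<n. \<bar>ip d Tk (b i)\<bar> \<le> \<bar>ip d Tk (b (nmem t ''j'' 0))\<bar>)))"
proof -
  obtain T1 t1 where 1: "exec copyrow s T1 t1" "T1 \<le> 5 * W"
    and t1: "inp t1 \<and> agree {''q'', ''w''} s t1 \<and>
      (\<forall>q<d. rmem t1 ''w'' q = rmem s ''T'' (nmem s ''kb'' 0 + q))"
    by (rule runsE[OF runs_copyrow[OF s(1)]])
  define t2 where "t2 = rupdate ''sig'' 0 1 t1"
  have 2: "exec (rset ''sig'' (rconst 1)) t1 1 t2"
    using exec_RAssign[of "''sig''" "NConst 0" "rconst 1" t1] by (simp add: t2_def)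
  have t2: "inp t2" "rmem t2 ''acc'' = (\<lambda>_. 0)" "rmem t2 ''lev'' = (\<lambda>_. 0)" "rmem t2 ''sig'' 0 = 1"
      "rmem t2 ''w'' = rmem t1 ''w''"
    using t1 s agreeD[of "{''q'', ''w''}" s t1] by (simp_all add: t2_def)
  obtain T3 t3 where 3: "exec (Seq scan levup) t2 T3 t3" "T3 \<le> 11 * W"
    and t3: "inp t3 \<and> agree {''e'', ''acc'', ''lev''} t2 t3 \<and> rmem t3 ''acc'' = (\<lambda>_. 0) \<and>
      rmem t3 ''lev'' = (\<lambda>i. rmem t2 ''lev'' i + rmem t2 ''sig'' 0 * (rowdot (rmem t2 ''w'') m i)\<^sup>2)"
    by (rule runsE[OF runs_pass[OF t2(1,2)]])
  define t4 where "t4 = rupdate ''best'' 0 0 t3"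
  have 4: "exec (rset ''best'' (rconst 0)) t3 1 t4"
    using exec_RAssign[of "''best''" "NConst 0" "rconst 0" t3] by (simp add: t4_def)
  define L where "L = rmem t4 ''lev''"
  have L: "L i = (rowdot (rmem t1 ''w'') m i)\<^sup>2" for i
    using t3 t2 by (simp add: L_def t4_def)
  have t4: "inp t4" "rmem t4 ''best'' 0 = 0"
    using t3 by (simp_all add: t4_def)
  obtain T5 t5 where 5: "exec argmax t4 T5 t5" "T5 \<le> 7 * W"
    and t5: "inp t5 \<and> agree {''e'', ''best'', ''j''} t4 t5 \<and>
      (\<forall>e<m. rmem t4 ''lev'' (R e) \<le> rmem t5 ''best'' 0) \<and> rmem t4 ''best'' 0 \<le> rmem t5 ''best'' 0 \<and>
      (rmem t5 ''best'' 0 = rmem t4 ''best'' 0 \<or>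
        (nmem t5 ''j'' 0 < n \<and> rmem t5 ''best'' 0 = rmem t4 ''lev'' (nmem t5 ''j'' 0)))"
    by (rule runsE[OF runs_argmax[OF t4(1)]])
  have lev5: "rmem t5 ''lev'' = L"
    using t5 agreeD(2)[of "{''e'', ''best'', ''j''}" t4 t5] by (simp add: L_def)
  have L0: "L i = 0" if "i \<notin> R ` {..<m}" for i
    using that by (simp add: L rowdot_outside)
  have "inp t5" "\<And>i. i \<notin> R ` {..<m} \<Longrightarrow> rmem t5 ''lev'' i = 0"
    using t5 L0 by (simp_all add: lev5)
  from runs_clear[OF this] obtain T6 t6 where 6: "exec clear t5 T6 t6" "T6 \<le> 5 * W"
    and t6: "inp t6 \<and> agree {''e'', ''lev''} t5 t6 \<and> rmem t6 ''lev'' = (\<lambda>_. 0)"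
    by (rule runsE)
  have ag: "agree {''q'', ''w'', ''e'', ''acc'', ''lev'', ''sig'', ''best'', ''j''} s t6" (is "agree ?X s t6")
  proof -
    have "agree ?X s t1"
      by (rule agree_trans[OF t1[THEN conjunct2, THEN conjunct1] agree_refl]) auto
    then have "agree ?X s t2"
      by (simp add: t2_def)
    then have "agree ?X s t3"
      by (rule agree_trans[OF _ t3[THEN conjunct2, THEN conjunct1]]) auto
    then have "agree ?X s t4"
      by (simp add: t4_def)
    then have "agree ?X s t5"
      by (rule agree_trans[OF _ t5[THEN conjunct2, THEN conjunct1]]) auto
    then show ?thesis
      by (rule agree_trans[OF _ t6[THEN conjunct2, THEN conjunct1]]) auto
  qed
  have "rmem t6 ''acc'' = rmem t5 ''acc''" "rmem t6 ''w'' = rmem t5 ''w''"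
    and b6: "rmem t6 ''best'' = rmem t5 ''best''" "nmem t6 ''j'' = nmem t5 ''j''"
    by (simp_all add: agreeD[OF t6[THEN conjunct2, THEN conjunct1]])
  moreover have "rmem t5 ''acc'' = rmem t4 ''acc''" "rmem t5 ''w'' = rmem t4 ''w''"
    by (simp_all add: agreeD[OF t5[THEN conjunct2, THEN conjunct1]])
  moreover have "rmem t3 ''w'' = rmem t2 ''w''"
    by (simp add: agreeD[OF t3[THEN conjunct2, THEN conjunct1]])
  ultimately have acc6: "rmem t6 ''acc'' = (\<lambda>_. 0)" and w6: "rmem t6 ''w'' = rmem t1 ''w''"
    using t3 t2 by (simp_all add: t4_def)
  have Li: "L i = (ip d Tk (b i))\<^sup>2" if "i < n" for i
  proof -
    have "ip d (b i) (rmem t1 ''w'') = ip d (b i) Tk"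
      using t1 by (intro ip_cong) (auto simp: Tk)
    then show ?thesis
      by (simp add: L rowdot_ip[OF that] ip_commute)
  qed
  \<comment> \<open>\<open>best\<close> starts at 0, which covers the rows that have no
    entries.\<close>
  have Lbest: "L i \<le> rmem t6 ''best'' 0" for i
    using t5 t4 L0[of i] unfolding b6 L_def[symmetric] by (cases "i \<in> R ` {..<m}") auto
  show ?thesis
    unfolding pivot_search_def
  proof (rule runsI)
    show "exec (Seq copyrow (Seq (rset ''sig'' (rconst 1)) (Seq (Seq scan levup)
       (Seq (rset ''best'' (rconst 0)) (Seq argmax clear))))) s (T1 + (1 + (T3 + (1 + (T5 + T6))))) t6"
      by (intro exec_Seq[OF 1(1)] exec_Seq[OF 2] exec_Seq[OF 3(1)] exec_Seq[OF 4] exec_Seq[OF 5(1) 6(1)])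
    show "T1 + (1 + (T3 + (1 + (T5 + T6)))) \<le> 30 * W"
      using 1 3 5 6 W by linarith
    have "\<forall>i<n. ip d Tk (b i) = 0" if "rmem t6 ''best'' 0 \<le> 0"
    proof (intro allI impI)
      fix i assume i: "i < n"
      then have "(ip d Tk (b i))\<^sup>2 \<le> 0"
        using Lbest[of i] that unfolding Li[OF i] by linarith
      then show "ip d Tk (b i) = 0" by simp
    qed
    moreover have "nmem t6 ''j'' 0 < n \<and> ip d Tk (b (nmem t6 ''j'' 0)) \<noteq> 0 \<and>
        (\<forall>i<n. \<bar>ip d Tk (b i)\<bar> \<le> \<bar>ip d Tk (b (nmem t6 ''j'' 0))\<bar>)" if pos: "0 < rmem t6 ''best'' 0"
    proof -
      have j: "nmem t6 ''j'' 0 < n" "rmem t6 ''best'' 0 = L (nmem t6 ''j'' 0)"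
        using pos t5 t4 unfolding b6 L_def by auto
      have "\<bar>ip d Tk (b i)\<bar> \<le> \<bar>ip d Tk (b (nmem t6 ''j'' 0))\<bar>" if "i < n" for i
        using Lbest[of i] unfolding j(2) Li[OF j(1)] Li[OF that] by (simp add: abs_le_square_iff)
      moreover have "ip d Tk (b (nmem t6 ''j'' 0)) \<noteq> 0"
        using pos unfolding j(2) Li[OF j(1)] by auto
      ultimately show ?thesis
        using j by simp
    qed
    ultimately show "inp t6 \<and>
      agree {''q'', ''w'', ''e'', ''acc'', ''lev'', ''sig'', ''best'', ''j''} s t6 \<and>
      rmem t6 ''acc'' = (\<lambda>_. 0) \<and> rmem t6 ''lev'' = (\<lambda>_. 0) \<and> (\<forall>q<d. rmem t6 ''w'' q = Tk q) \<and>
      (rmem t6 ''best'' 0 \<le> 0 \<longrightarrow> (\<forall>i<n. ip d Tk (b i) = 0)) \<and>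
      (0 < rmem t6 ''best'' 0 \<longrightarrow> nmem t6 ''j'' 0 < n \<and> ip d Tk (b (nmem t6 ''j'' 0)) \<noteq> 0 \<and>
        (\<forall>i<n. \<bar>ip d Tk (b i)\<bar> \<le> \<bar>ip d Tk (b (nmem t6 ''j'' 0))\<bar>))"
      using t6 ag acc6 w6 t1 by (simp add: Tk)
  qed
qed

lemma runs_map_y:
  assumes "inp s"
    and val: "\<And>k t. k < d \<Longrightarrow> agree {''q'', ''y''} s t \<Longrightarrow> nmem t ''q'' 0 = k \<Longrightarrow>
      rmem t ''y'' k = rmem s ''y'' k \<Longrightarrow> rval r t = f k"
  shows "runs (for_loop ''q'' (nvar ''d'') (RAssign ''y'' (nvar ''q'') r)) s (5 * W)
    (\<lambda>t. inp t \<and> agree {''q'', ''y''} s t \<and> (\<forall>q<d. rmem t ''y'' q = f q))"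
proof -
  define I where "I k t \<longleftrightarrow> inp t \<and> agree {''q'', ''y''} s t \<and>
    (\<forall>q. rmem t ''y'' q = (if q < k then f q else rmem s ''y'' q))" for k t
  show ?thesis
  proof (rule runs_for[where N = d and B = 1 and I = I])
    fix k t
    assume k: "k < d" "nmem t ''q'' 0 = k" and I: "I k t"
    then have r: "rval r t = f k"
      using val[of k t] by (simp add: I_def)
    show "runs (RAssign ''y'' (nvar ''q'') r) t 1
        (\<lambda>t'. nmem t' ''q'' 0 = k \<and> I (Suc k) (nupdate ''q'' 0 (Suc k) t'))"
      by (rule runs_RAssign) (use k I r in \<open>auto simp: I_def less_Suc_eq\<close>)
  qed (use assms W in \<open>auto simp: I_def inp_def\<close>)
qed

lemma runs_exchange:
  assumes s: "inp s" "nmem s ''j'' 0 = j" "j < n" "nmem s ''k'' 0 = k" "k < d"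
    and T: "\<And>p q. T p q = rmem s ''T'' (p * d + q)"
  shows "runs exchange s (42 * W) (\<lambda>t. inp t \<and>
    agree {''q'', ''e'', ''v'', ''p'', ''b'', ''y'', ''piv'', ''T''} s t \<and>
    (\<forall>l<d. \<forall>q<d. rmem t ''T'' (l * d + q) =
      T l q - (ip d (T l) (b j) - (if l = k then 1 else 0)) / ip d (T k) (b j) * rmem s ''w'' q))"
proof -
  have "nmem s ''j'' 0 < n"
    using s by simp
  from runs_load[OF s(1) this] obtain T1 t1 where 1: "exec load s T1 t1" "T1 \<le> 11 * W"
    and t1: "inp t1 \<and> agree {''q'', ''e'', ''v''} s t1 \<and> (\<forall>q<d. rmem t1 ''v'' q = b (nmem s ''j'' 0) q)"
    by (rule runsE)
  have ag1: "agree {''q'', ''e'', ''v''} s t1" and inp1: "inp t1"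
    using t1 by auto
  obtain T2 t2 where 2: "exec (matvec ''T'') t1 T2 t2" "T2 \<le> 12 * W"
    and t2: "inp t2 \<and> agree {''p'', ''q'', ''b'', ''y''} t1 t2 \<and>
      (\<forall>p<d. rmem t2 ''y'' p = (\<Sum>q<d. rmem t1 ''T'' (p * d + q) * rmem t1 ''v'' q))"
    by (rule runsE[OF runs_matvec[OF inp1, of "''T''"]]) simp_all
  have ag2: "agree {''p'', ''q'', ''b'', ''y''} t1 t2" and inp2: "inp t2"
    using t2 by auto
  have y2: "rmem t2 ''y'' p = ip d (T p) (b j)" if "p < d" for p
    using t2 t1 that s(2) by (simp add: ip_def T agreeD[OF ag1])
  define t3 where "t3 = rupdate ''piv'' 0 (rmem t2 ''y'' k) t2"
  have k2: "nmem t2 ''k'' 0 = k"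
    using s by (simp add: agreeD[OF ag1] agreeD[OF ag2])
  have 3: "exec (rset ''piv'' (RCell ''y'' (nvar ''k''))) t2 1 t3"
    using exec_RAssign[of "''piv''" "NConst 0" "RCell ''y'' (nvar ''k'')" t2] by (simp add: t3_def k2)
  define t4 where "t4 = rupdate ''y'' k (rmem t3 ''y'' k - 1) t3"
  have 4: "exec (RAssign ''y'' (nvar ''k'') (RSub (RCell ''y'' (nvar ''k'')) (rconst 1))) t3 1 t4"
    using exec_RAssign[of "''y''" "nvar ''k''" "RSub (RCell ''y'' (nvar ''k'')) (rconst 1)" t3]
    by (simp add: t4_def t3_def k2)
  have inp4: "inp t4"
    using inp2 by (simp add: t4_def t3_def)
  have y4: "rmem t4 ''y'' p = ip d (T p) (b j) - (if p = k then 1 else 0)" if "p < d" for p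
    using y2[OF that] y2[OF s(5)] by (auto simp: t4_def t3_def)
  have piv4: "rmem t4 ''piv'' 0 = ip d (T k) (b j)"
    using y2[OF s(5)] by (simp add: t4_def t3_def)
  define c where "c q = (ip d (T q) (b j) - (if q = k then 1 else 0)) / ip d (T k) (b j)" for q
  define f where "f q = - c q" for q
  have "runs (for_loop ''q'' (nvar ''d'')
        (RAssign ''y'' (nvar ''q'') (RDiv (RSub (rconst 0) (RCell ''y'' (nvar ''q''))) (rvar ''piv'')))) t4 (5 * W)
      (\<lambda>t. inp t \<and> agree {''q'', ''y''} t4 t \<and> (\<forall>q<d. rmem t ''y'' q = f q))"
  proof (rule runs_map_y[OF inp4])
    fix k t
    assume k: "k < d" "nmem t ''q'' 0 = k" "rmem t ''y'' k = rmem t4 ''y'' k" and ag: "agree {''q'', ''y''} t4 t"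
    have "rval (RDiv (RSub (rconst 0) (RCell ''y'' (nvar ''q''))) (rvar ''piv'')) t =
        (0 - rmem t4 ''y'' k) / rmem t4 ''piv'' 0"
      using k by (simp add: agreeD[OF ag])
    also have "\<dots> = f k"
      unfolding y4[OF k(1)] piv4 f_def c_def by (simp only: diff_0 minus_divide_left)
    finally show "rval (RDiv (RSub (rconst 0) (RCell ''y'' (nvar ''q''))) (rvar ''piv'')) t = f k" .
  qed
  then obtain T5 t5 where 5: "exec (for_loop ''q'' (nvar ''d'')
        (RAssign ''y'' (nvar ''q'') (RDiv (RSub (rconst 0) (RCell ''y'' (nvar ''q''))) (rvar ''piv'')))) t4 T5 t5"
      "T5 \<le> 5 * W" and t5: "inp t5 \<and> agree {''q'', ''y''} t4 t5 \<and> (\<forall>q<d. rmem t5 ''y'' q = f q)"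
    by (rule runsE)
  have ag5: "agree {''q'', ''y''} t4 t5" and inp5: "inp t5"
    using t5 by auto
  obtain T6 t6 where 6: "exec (rank1 ''T'') t5 T6 t6" "T6 \<le> 12 * W"
    and t6: "inp t6 \<and> agree {''p'', ''q'', ''b'', ''T''} t5 t6 \<and>
      (\<forall>p<d. \<forall>q<d. rmem t6 ''T'' (p * d + q) = rmem t5 ''T'' (p * d + q) + rmem t5 ''y'' p * rmem t5 ''w'' q)"
    by (rule runsE[OF runs_rank1[OF inp5, of "''T''"]]) simp_all
  have ag6: "agree {''p'', ''q'', ''b'', ''T''} t5 t6"
    using t6 by auto
  show ?thesis
    unfolding exchange_def
  proof (rule runsI)
    show "exec (Seq load (Seq (matvec ''T'') (Seq (rset ''piv'' (RCell ''y'' (nvar ''k'')))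
     (Seq (RAssign ''y'' (nvar ''k'') (RSub (RCell ''y'' (nvar ''k'')) (rconst 1)))
     (Seq (for_loop ''q'' (nvar ''d'')
        (RAssign ''y'' (nvar ''q'') (RDiv (RSub (rconst 0) (RCell ''y'' (nvar ''q''))) (rvar ''piv''))))
     (rank1 ''T'')))))) s (T1 + (T2 + (1 + (1 + (T5 + T6))))) t6"
      by (intro exec_Seq[OF 1(1)] exec_Seq[OF 2(1)] exec_Seq[OF 3] exec_Seq[OF 4] exec_Seq[OF 5(1) 6(1)])
    show "T1 + (T2 + (1 + (1 + (T5 + T6)))) \<le> 42 * W"
      using 1 2 5 6 W by linarith
    let ?X = "{''q'', ''e'', ''v'', ''p'', ''b'', ''y'', ''piv'', ''T''}"
    have "agree ?X s t2"
      by (rule agree_trans[OF ag1 ag2]) auto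
    then have "agree ?X s t4"
      by (simp add: t4_def t3_def)
    then have "agree ?X s t5"
      by (rule agree_trans[OF _ ag5]) auto
    then have "agree ?X s t6"
      by (rule agree_trans[OF _ ag6]) auto
    moreover have "rmem t5 ''T'' = rmem s ''T''" "rmem t5 ''w'' = rmem s ''w''"
      by (simp_all add: agreeD[OF ag5] t4_def t3_def agreeD[OF ag2] agreeD[OF ag1])
    moreover have "rmem t5 ''y'' l = f l" if "l < d" for l
      using t5 that by blast
    ultimately have "inp t6 \<and> agree ?X s t6 \<and> (\<forall>l<d. \<forall>q<d. rmem t6 ''T'' (l * d + q) =
        T l q - c l * rmem s ''w'' q)"
      using t6 by (simp add: T f_def)
    then show "inp t6 \<and> agree ?X s t6 \<and> (\<forall>l<d. \<forall>q<d. rmem t6 ''T'' (l * d + q) =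
      T l q - (ip d (T l) (b j) - (if l = k then 1 else 0)) / ip d (T k) (b j) * rmem s ''w'' q)"
      unfolding c_def .
  qed
qed

lemma runs_update:
  assumes s: "inp s" "rmem s ''acc'' = (\<lambda>_. 0)"
  shows "runs update s (28 * W) (\<lambda>t. inp t \<and>
    agree {''q'', ''y'', ''p'', ''b'', ''H'', ''e'', ''acc'', ''lev''} s t \<and> rmem t ''acc'' = (\<lambda>_. 0) \<and>
    (\<forall>p<d. \<forall>q<d. rmem t ''H'' (p * d + q) =
      rmem s ''H'' (p * d + q) + rmem s ''sig'' 0 * rmem s ''w'' p * rmem s ''w'' q) \<and>
    rmem t ''lev'' = (\<lambda>i. rmem s ''lev'' i + rmem s ''sig'' 0 * (rowdot (rmem s ''w'') m i)\<^sup>2))"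
proof -
  have "runs (for_loop ''q'' (nvar ''d'')
       (RAssign ''y'' (nvar ''q'') (RMul (rvar ''sig'') (RCell ''w'' (nvar ''q''))))) s (5 * W)
      (\<lambda>t. inp t \<and> agree {''q'', ''y''} s t \<and> (\<forall>q<d. rmem t ''y'' q = rmem s ''sig'' 0 * rmem s ''w'' q))"
  proof (rule runs_map_y[OF s(1)])
    fix k t
    assume "nmem t ''q'' 0 = k" and ag: "agree {''q'', ''y''} s t"
    then show "rval (RMul (rvar ''sig'') (RCell ''w'' (nvar ''q''))) t = rmem s ''sig'' 0 * rmem s ''w'' k"
      by (simp add: agreeD[OF ag])
  qed
  then obtain T1 t1 where 1: "exec (for_loop ''q'' (nvar ''d'')
       (RAssign ''y'' (nvar ''q'') (RMul (rvar ''sig'') (RCell ''w'' (nvar ''q''))))) s T1 t1" "T1 \<le> 5 * W"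
    and t1: "inp t1 \<and> agree {''q'', ''y''} s t1 \<and> (\<forall>q<d. rmem t1 ''y'' q = rmem s ''sig'' 0 * rmem s ''w'' q)"
    by (rule runsE)
  have ag1: "agree {''q'', ''y''} s t1" and inp1: "inp t1"
    using t1 by auto
  obtain T2 t2 where 2: "exec (rank1 ''H'') t1 T2 t2" "T2 \<le> 12 * W"
    and t2: "inp t2 \<and> agree {''p'', ''q'', ''b'', ''H''} t1 t2 \<and>
      (\<forall>p<d. \<forall>q<d. rmem t2 ''H'' (p * d + q) = rmem t1 ''H'' (p * d + q) + rmem t1 ''y'' p * rmem t1 ''w'' q)"
    by (rule runsE[OF runs_rank1[OF inp1, of "''H''"]]) simp_all
  have ag2: "agree {''p'', ''q'', ''b'', ''H''} t1 t2" and inp2: "inp t2"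
    using t2 by auto
  have acc2: "rmem t2 ''acc'' = (\<lambda>_. 0)"
    using s by (simp add: agreeD[OF ag2] agreeD[OF ag1])
  obtain T3 t3 where 3: "exec (Seq scan levup) t2 T3 t3" "T3 \<le> 11 * W"
    and t3: "inp t3 \<and> agree {''e'', ''acc'', ''lev''} t2 t3 \<and> rmem t3 ''acc'' = (\<lambda>_. 0) \<and>
      rmem t3 ''lev'' = (\<lambda>i. rmem t2 ''lev'' i + rmem t2 ''sig'' 0 * (rowdot (rmem t2 ''w'') m i)\<^sup>2)"
    by (rule runsE[OF runs_pass[OF inp2 acc2]])
  have ag3: "agree {''e'', ''acc'', ''lev''} t2 t3"
    using t3 by auto
  show ?thesis
    unfolding update_def
  proof (rule runsI)
    show "exec (Seq (for_loop ''q'' (nvar ''d'')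
       (RAssign ''y'' (nvar ''q'') (RMul (rvar ''sig'') (RCell ''w'' (nvar ''q'')))))
     (Seq (rank1 ''H'') (Seq scan levup))) s (T1 + (T2 + T3)) t3"
      by (intro exec_Seq[OF 1(1)] exec_Seq[OF 2(1) 3(1)])
    show "T1 + (T2 + T3) \<le> 28 * W"
      using 1 2 3 by linarith
    let ?X = "{''q'', ''y'', ''p'', ''b'', ''H'', ''e'', ''acc'', ''lev''}"
    have "agree ?X s t2"
      by (rule agree_trans[OF ag1 ag2]) auto
    then have "agree ?X s t3"
      by (rule agree_trans[OF _ ag3]) auto
    moreover have "rmem t3 ''H'' = rmem t2 ''H''" "rmem t1 ''H'' = rmem s ''H''" "rmem t1 ''w'' = rmem s ''w''"
      "rmem t2 ''lev'' = rmem s ''lev''" "rmem t2 ''sig'' = rmem s ''sig''" "rmem t2 ''w'' = rmem s ''w''"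
      by (simp_all add: agreeD[OF ag1] agreeD[OF ag2] agreeD[OF ag3])
    ultimately show "inp t3 \<and> agree ?X s t3 \<and> rmem t3 ''acc'' = (\<lambda>_. 0) \<and>
      (\<forall>p<d. \<forall>q<d. rmem t3 ''H'' (p * d + q) =
        rmem s ''H'' (p * d + q) + rmem s ''sig'' 0 * rmem s ''w'' p * rmem s ''w'' q) \<and>
      rmem t3 ''lev'' = (\<lambda>i. rmem s ''lev'' i + rmem s ''sig'' 0 * (rowdot (rmem s ''w'') m i)\<^sup>2)"
      using t1 t2 t3 by simp
  qed
qed

end

section \<open>The algorithm\<close>

definition next_row :: com where
  "next_row = nset ''kb'' (NAdd (nvar ''kb'') (nvar ''d''))"

definition init_T :: com where
  "init_T = for_loop ''k'' (nvar ''d'')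
     (Seq (RAssign ''T'' (NAdd (nvar ''kb'') (nvar ''k'')) (rconst 1)) next_row)"

definition pivoting :: com where
  "pivoting = Seq (nset ''kb'' (NConst 0)) (for_loop ''k'' (nvar ''d'')
     (Seq pivot_search
       (Seq (Cond (RLess (rconst 0) (rvar ''best'')) (Seq exchange push) Skip) next_row)))"

text \<open>\<open>H\<close> is built as a sum of \<open>d\<close> rank-one terms, one for each row
  of \<open>T\<close>; the leverages are accumulated along with it as sums of squares.\<close>

definition init_H :: com where
  "init_H = Seq (nset ''kb'' (NConst 0)) (for_loop ''k'' (nvar ''d'')
     (Seq copyrow (Seq (rset ''sig'' (rconst 1)) (Seq update next_row))))"

text \<open>Starting \<open>best\<close> at the threshold makes \<open>best > 1\<close> afterwards
  equivalent to the existence of a row of leverage above 1.\<close>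

definition search :: com where
  "search = Seq (rset ''best'' (rconst 1)) argmax"

definition copy_y :: com where
  "copy_y = for_loop ''q'' (nvar ''d'') (RAssign ''w'' (nvar ''q'') (RCell ''y'' (nvar ''q'')))"

text \<open>\<open>best\<close> is the leverage of row \<open>j\<close> and so supplies the
  denominator of the Sherman-Morrison formula. Constants are naturals, hence the subtraction from
  0.\<close>

definition extend :: com where
  "extend = Seq load (Seq (matvec ''H'') (Seq copy_y
     (Seq (rset ''sig'' (RDiv (RSub (rconst 0) (rconst 1)) (RAdd (rconst 1) (rvar ''best''))))
     (Seq update (Seq push search)))))"

definition greedy :: com where
  "greedy = Seq search (While (RLess (rconst 1) (rvar ''best'')) extend)"

definition spanner :: com where
  "spanner = Seq init_T (Seq pivoting (Seq init_H greedy))"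

lemma output_set_agree: "agree X s t \<Longrightarrow> X \<inter> {''out'', ''len''} = {} \<Longrightarrow> output_set t = output_set s"
  unfolding output_set_def by (simp add: agreeD)

context sparse_input
begin

definition matrix_at :: "string \<Rightarrow> store \<Rightarrow> nat \<Rightarrow> nat \<Rightarrow> real" where
  "matrix_at X t p q = rmem t X (p * d + q)"

lemma rowdot_cong: "(\<And>q. q < d \<Longrightarrow> w q = w' q) \<Longrightarrow> rowdot w m i = rowdot w' m i"
  unfolding rowdot_def by (rule sum.cong) (use entry in auto)

lemma exec_next_row:
  assumes "inp s"
  shows "exec next_row s 1 (nupdate ''kb'' 0 (nmem s ''kb'' 0 + d) s)"
  using exec_NAssign[of "''kb''" "NConst 0" "NAdd (nvar ''kb'') (nvar ''d'')" s] assms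
  by (simp add: next_row_def inp_def)

lemma runs_init_T:
  assumes "inp s" "rmem s ''T'' = (\<lambda>_. 0)" "nmem s ''kb'' 0 = 0"
  shows "runs init_T s (6 * W) (\<lambda>t. inp t \<and> agree {''k'', ''kb'', ''T''} s t \<and>
    (\<forall>p<d. \<forall>q<d. matrix_at ''T'' t p q = (if p = q then 1 else 0)))"
proof -
  define I where "I k t \<longleftrightarrow> inp t \<and> agree {''k'', ''kb'', ''T''} s t \<and> nmem t ''kb'' 0 = k * d \<and>
    (\<forall>p<d. \<forall>q<d. matrix_at ''T'' t p q = (if p = q \<and> p < k then 1 else 0))" for k t
  \<comment> \<open>Uniqueness of division with remainder: the diagonal cell written in step
    \<open>k\<close> is no other entry of the matrix.\<close>
  have digits: "p * d + q = k * d + k' \<longleftrightarrow> p = k \<and> q = k'" if "q < d" "k' < d" for p q k k'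
  proof
    assume eq: "p * d + q = k * d + k'"
    have "p = (p * d + q) div d" "q = (p * d + q) mod d"
      using that by auto
    then show "p = k \<and> q = k'"
      unfolding eq using that by auto
  qed auto
  show ?thesis
    unfolding init_T_def
  proof (rule runs_for[where N = d and B = 2 and I = I])
    fix k t
    assume k: "k < d" "nmem t ''k'' 0 = k" and I: "I k t"
    define t1 where "t1 = rupdate ''T'' (k * d + k) 1 t"
    have 1: "exec (RAssign ''T'' (NAdd (nvar ''kb'') (nvar ''k'')) (rconst 1)) t 1 t1"
      using exec_RAssign[of "''T''" "NAdd (nvar ''kb'') (nvar ''k'')" "rconst 1" t] k I
      by (simp add: t1_def I_def)
    have "inp t1"
      using I by (simp add: t1_def I_def)
    from exec_Seq[OF 1 exec_next_row[OF this]]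
    show "runs (Seq (RAssign ''T'' (NAdd (nvar ''kb'') (nvar ''k'')) (rconst 1)) next_row) t 2
        (\<lambda>t'. nmem t' ''k'' 0 = k \<and> I (Suc k) (nupdate ''k'' 0 (Suc k) t'))"
      by (rule runsI) (use k I in \<open>auto simp: I_def t1_def matrix_at_def digits\<close>)
  next
    show "I 0 (nupdate ''k'' 0 0 s)"
      using assms by (simp add: I_def matrix_at_def)
  qed (use W in \<open>auto simp: I_def inp_def\<close>)
qed

text \<open>\<open>\<sigma>\<close> and \<open>F\<close> are ghost data; memory holds only
  \<open>T\<close>. The zero arrays are the starting point for the construction of \<open>H\<close>
  and the leverages.\<close>

definition pivot_state :: "nat \<Rightarrow> store \<Rightarrow> bool" where
  "pivot_state k t \<longleftrightarrow> inp t \<and> rmem t ''acc'' = (\<lambda>_. 0) \<and> rmem t ''lev'' = (\<lambda>_. 0) \<and>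
     rmem t ''H'' = (\<lambda>_. 0) \<and> nmem t ''kb'' 0 = k * d \<and>
     (\<exists>\<sigma> F. pivot_inv d n b k (matrix_at ''T'' t) \<sigma> F \<and> output_set t = \<sigma> ` {..<d} \<inter> {..<n})"

lemma runs_pivot_body:
  assumes k: "k < d" "nmem t ''k'' 0 = k" and I: "pivot_state k t"
  shows "runs (Seq pivot_search
       (Seq (Cond (RLess (rconst 0) (rvar ''best'')) (Seq exchange push) Skip) next_row)) t (76 * W)
     (\<lambda>t'. nmem t' ''k'' 0 = k \<and> pivot_state (Suc k) (nupdate ''k'' 0 (Suc k) t'))"
proof -
  define T where "T = matrix_at ''T'' t"
  have t: "inp t" "rmem t ''acc'' = (\<lambda>_. 0)" "rmem t ''lev'' = (\<lambda>_. 0)" "rmem t ''H'' = (\<lambda>_. 0)" "nmem t ''kb'' 0 = k * d"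
    using I by (auto simp: pivot_state_def)
  obtain \<sigma> F where inv: "pivot_inv d n b k T \<sigma> F" and out: "output_set t = \<sigma> ` {..<d} \<inter> {..<n}"
    using I by (auto simp: pivot_state_def T_def)
  have Tk: "T k q = rmem t ''T'' (nmem t ''kb'' 0 + q)" for q
    by (simp add: T_def matrix_at_def t)
  obtain T1 t1 where 1: "exec pivot_search t T1 t1" "T1 \<le> 30 * W"
    and t1: "inp t1 \<and>
    agree {''q'', ''w'', ''e'', ''acc'', ''lev'', ''sig'', ''best'', ''j''} t t1 \<and>
    rmem t1 ''acc'' = (\<lambda>_. 0) \<and> rmem t1 ''lev'' = (\<lambda>_. 0) \<and> (\<forall>q<d. rmem t1 ''w'' q = T k q) \<and>
    (rmem t1 ''best'' 0 \<le> 0 \<longrightarrow> (\<forall>i<n. ip d (T k) (b i) = 0)) \<and>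
    (0 < rmem t1 ''best'' 0 \<longrightarrow> nmem t1 ''j'' 0 < n \<and> ip d (T k) (b (nmem t1 ''j'' 0)) \<noteq> 0 \<and>
      (\<forall>i<n. \<bar>ip d (T k) (b i)\<bar> \<le> \<bar>ip d (T k) (b (nmem t1 ''j'' 0))\<bar>))"
    by (rule runsE[OF runs_pivot_search[OF t(1-3) Tk]])
  have ag1: "agree {''q'', ''w'', ''e'', ''acc'', ''lev'', ''sig'', ''best'', ''j''} t t1" and inp1: "inp t1"
    using t1 by auto
  have same1: "rmem t1 ''H'' = (\<lambda>_. 0)" "nmem t1 ''kb'' 0 = k * d" "nmem t1 ''k'' 0 = k"
      "rmem t1 ''T'' = rmem t ''T''" "output_set t1 = output_set t"
    using t k by (simp_all add: agreeD[OF ag1] output_set_agree[OF ag1])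
  have "\<exists>T2 t2. exec (Cond (RLess (rconst 0) (rvar ''best'')) (Seq exchange push) Skip) t1 T2 t2 \<and>
      T2 \<le> 45 * W \<and> inp t2 \<and> rmem t2 ''acc'' = (\<lambda>_. 0) \<and> rmem t2 ''lev'' = (\<lambda>_. 0) \<and>
      rmem t2 ''H'' = (\<lambda>_. 0) \<and> nmem t2 ''kb'' 0 = k * d \<and> nmem t2 ''k'' 0 = k \<and>
      (\<exists>\<sigma> F. pivot_inv d n b (Suc k) (matrix_at ''T'' t2) \<sigma> F \<and> output_set t2 = \<sigma> ` {..<d} \<inter> {..<n})"
  proof (cases "0 < rmem t1 ''best'' 0")
    case True
    define j where "j = nmem t1 ''j'' 0"
    have j: "j < n" "ip d (T k) (b j) \<noteq> 0" "\<And>i. i < n \<Longrightarrow> \<bar>ip d (T k) (b i)\<bar> \<le> \<bar>ip d (T k) (b j)\<bar>"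
      using t1 True by (auto simp: j_def)
    have T1: "T p q = rmem t1 ''T'' (p * d + q)" for p q
      by (simp add: T_def matrix_at_def same1)
    obtain T2 t2 where 2: "exec exchange t1 T2 t2" "T2 \<le> 42 * W"
      and t2: "inp t2 \<and> agree {''q'', ''e'', ''v'', ''p'', ''b'', ''y'', ''piv'', ''T''} t1 t2 \<and>
        (\<forall>l<d. \<forall>q<d. rmem t2 ''T'' (l * d + q) =
          T l q - (ip d (T l) (b j) - (if l = k then 1 else 0)) / ip d (T k) (b j) * rmem t1 ''w'' q)"
      by (rule runsE[OF runs_exchange[OF inp1 j_def[symmetric] j(1) same1(3) k(1) T1]])
    have ag2: "agree {''q'', ''e'', ''v'', ''p'', ''b'', ''y'', ''piv'', ''T''} t1 t2" and inp2: "inp t2"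
      using t2 by auto
    obtain T3 t3 where 3: "exec push t2 T3 t3" "T3 \<le> 2"
      and t3: "agree {''out'', ''len''} t2 t3 \<and> output_set t3 = insert (nmem t2 ''j'' 0) (output_set t2)"
      by (rule runsE[OF runs_push])
    have ag3: "agree {''out'', ''len''} t2 t3"
      using t3 by auto
    have inp3: "inp t3"
      by (rule inp_agree[OF inp2 ag3]) auto
    have "\<exists>F'. pivot_inv d n b (Suc k) (matrix_at ''T'' t3) (\<sigma>(k := j)) F'"
    proof (rule pivot_inv_pivot[OF inv k(1) j])
      fix l q assume "l < d" "q < d"
      then show "matrix_at ''T'' t3 l q =
          T l q - (ip d (T l) (b j) - (if l = k then 1 else 0)) / ip d (T k) (b j) * T k q"
        using t1 t2 by (simp add: matrix_at_def agreeD[OF ag3])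
    qed
    moreover have "output_set t3 = (\<sigma>(k := j)) ` {..<d} \<inter> {..<n}"
    proof -
      have "output_set t3 = insert j (output_set t)"
        using t3 by (simp add: output_set_agree[OF ag2] same1 agreeD[OF ag2] j_def)
      \<comment> \<open>Slot \<open>k\<close> still holds a unit vector, so replacing it removes no
        row from the output.\<close>
      moreover have "n \<le> \<sigma> k"
        using pivot_invD(1)[OF inv k(1)] by auto
      ultimately show ?thesis
        using k(1) j(1) by (auto simp: out)
    qed
    moreover have "exec (Cond (RLess (rconst 0) (rvar ''best'')) (Seq exchange push) Skip) t1 (T2 + T3 + 1) t3"
      by (rule exec_CondTrue[OF _ exec_Seq[OF 2(1) 3(1)]]) (use True in simp)
    moreover have "T2 + T3 + 1 \<le> 45 * W"
      using 2 3 W by linarith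
    moreover have "rmem t3 ''acc'' = (\<lambda>_. 0)" "rmem t3 ''lev'' = (\<lambda>_. 0)" "rmem t3 ''H'' = (\<lambda>_. 0)"
        "nmem t3 ''kb'' 0 = k * d" "nmem t3 ''k'' 0 = k"
      using t1 same1 by (simp_all add: agreeD[OF ag3] agreeD[OF ag2])
    ultimately show ?thesis
      using inp3 by blast
  next
    case False
    then have "\<exists>F'. pivot_inv d n b (Suc k) T \<sigma> F'"
      using t1 by (intro pivot_inv_skip[OF inv k(1)]) auto
    moreover have "matrix_at ''T'' t1 = T"
      by (simp add: fun_eq_iff matrix_at_def T_def same1)
    moreover have "exec (Cond (RLess (rconst 0) (rvar ''best'')) (Seq exchange push) Skip) t1 (1 + 1) t1"
      by (rule exec_CondFalse[OF _ exec_Skip]) (use False in simp)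
    moreover have "(1::nat) + 1 \<le> 45 * W"
      using W by linarith
    ultimately show ?thesis
      using t1 same1 out by metis
  qed
  then obtain T2 t2 where 2: "exec (Cond (RLess (rconst 0) (rvar ''best'')) (Seq exchange push) Skip) t1 T2 t2"
      "T2 \<le> 45 * W" and t2: "inp t2" "rmem t2 ''acc'' = (\<lambda>_. 0)" "rmem t2 ''lev'' = (\<lambda>_. 0)"
      "rmem t2 ''H'' = (\<lambda>_. 0)" "nmem t2 ''kb'' 0 = k * d" "nmem t2 ''k'' 0 = k"
      "\<exists>\<sigma> F. pivot_inv d n b (Suc k) (matrix_at ''T'' t2) \<sigma> F \<and> output_set t2 = \<sigma> ` {..<d} \<inter> {..<n}"
    by blast
  show ?thesis
  proof (rule runsI)
    show "exec (Seq pivot_search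
       (Seq (Cond (RLess (rconst 0) (rvar ''best'')) (Seq exchange push) Skip) next_row)) t (T1 + (T2 + 1))
       (nupdate ''kb'' 0 (nmem t2 ''kb'' 0 + d) t2)"
      by (rule exec_Seq[OF 1(1) exec_Seq[OF 2(1) exec_next_row[OF t2(1)]]])
    show "T1 + (T2 + 1) \<le> 76 * W"
      using 1 2 W by linarith
    have "matrix_at ''T'' (nupdate a i x u) = matrix_at ''T'' u" for a i x u
      by (simp add: fun_eq_iff matrix_at_def)
    moreover have "output_set (nupdate ''k'' i x u) = output_set u" "output_set (nupdate ''kb'' i x u) = output_set u" for i x u
      by (simp_all add: output_set_def)
    ultimately show "nmem (nupdate ''kb'' 0 (nmem t2 ''kb'' 0 + d) t2) ''k'' 0 = k \<and>
        pivot_state (Suc k) (nupdate ''k'' 0 (Suc k) (nupdate ''kb'' 0 (nmem t2 ''kb'' 0 + d) t2))"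
      using t2 by (simp add: pivot_state_def)
  qed
qed

text \<open>The loop overhead \<open>2 * d + 3\<close> is at most \<open>5 * (d * W)\<close>, which
  explains the gap of 5.\<close>

lemma loop_bound:
  assumes "c1 + 5 \<le> c2"
  shows "d * (c1 * W + 2) + 2 + 1 \<le> c2 * (d * W)"
proof -
  have "d \<le> d * W" "1 \<le> d * W"
    using W(4) d by simp_all
  then have "2 * d + 3 \<le> 5 * (d * W)"
    by linarith
  then have "d * (c1 * W + 2) + 2 + 1 \<le> (c1 + 5) * (d * W)"
    by (simp add: distrib_left distrib_right mult.left_commute)
  also have "\<dots> \<le> c2 * (d * W)"
    using assms by (rule mult_le_mono1)
  finally show ?thesis .
qed

lemma runs_pivoting:
  assumes s: "inp s" "rmem s ''acc'' = (\<lambda>_. 0)" "rmem s ''lev'' = (\<lambda>_. 0)" "rmem s ''H'' = (\<lambda>_. 0)"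
    and T: "\<forall>p<d. \<forall>q<d. matrix_at ''T'' s p q = (if p = q then 1 else 0)" and out: "output_set s = {}"
  shows "runs pivoting s (81 * (d * W)) (pivot_state d)"
  unfolding pivoting_def
proof (rule runs_Seq)
  show "runs (nset ''kb'' (NConst 0)) s 1 (\<lambda>t. t = nupdate ''kb'' 0 0 s)"
    by (rule runs_NAssign) auto
  fix t assume t: "t = nupdate ''kb'' 0 0 s"
  show "runs (for_loop ''k'' (nvar ''d'') (Seq pivot_search
       (Seq (Cond (RLess (rconst 0) (rvar ''best'')) (Seq exchange push) Skip) next_row))) t
     (d * (76 * W + 2) + 2) (pivot_state d)"
  proof (rule runs_for[where N = d and B = "76 * W" and I = pivot_state])
    have "matrix_at ''T'' (nupdate ''k'' 0 0 t) = matrix_at ''T'' s"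
      by (simp add: fun_eq_iff matrix_at_def t)
    moreover have "pivot_inv d n b 0 (matrix_at ''T'' s) (\<lambda>l. n + l) (matrix_at ''T'' s)"
      by (rule pivot_inv_init) (use unit T in auto)
    moreover have "output_set (nupdate ''k'' 0 0 t) = (\<lambda>l. n + l) ` {..<d} \<inter> {..<n}"
      using out by (auto simp: t output_set_def)
    ultimately show "pivot_state 0 (nupdate ''k'' 0 0 t)"
      using s by (auto simp: pivot_state_def t)
  next
    fix k t assume "k < d" "pivot_state k t" "nmem t ''k'' 0 = k"
    then show "runs (Seq pivot_search
        (Seq (Cond (RLess (rconst 0) (rvar ''best'')) (Seq exchange push) Skip) next_row)) t (76 * W)
        (\<lambda>t'. nmem t' ''k'' 0 = k \<and> pivot_state (Suc k) (nupdate ''k'' 0 (Suc k) t'))"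
      by (intro runs_pivot_body)
  next
    show "nval (nvar ''d'') t = d" if "pivot_state k t" for k t
      using that by (simp add: pivot_state_def inp_def)
  qed simp_all
qed (use loop_bound[of 76 81] in simp)

lemma runs_init_H:
  assumes s: "inp s" "rmem s ''acc'' = (\<lambda>_. 0)" "rmem s ''lev'' = (\<lambda>_. 0)" "rmem s ''H'' = (\<lambda>_. 0)"
    and T: "T = matrix_at ''T'' s"
  shows "runs init_H s (40 * (d * W)) (\<lambda>t. inp t \<and> rmem t ''acc'' = (\<lambda>_. 0) \<and> output_set t = output_set s \<and>
    (\<forall>p<d. \<forall>q<d. matrix_at ''H'' t p q = (\<Sum>l<d. T l p * T l q)) \<and>
    (\<forall>i<n. rmem t ''lev'' i = leverage d (matrix_at ''H'' t) (b i)))"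
proof -
  define I where "I k t \<longleftrightarrow> inp t \<and> rmem t ''acc'' = (\<lambda>_. 0) \<and> output_set t = output_set s \<and>
    rmem t ''T'' = rmem s ''T'' \<and> nmem t ''kb'' 0 = k * d \<and>
    (\<forall>p<d. \<forall>q<d. matrix_at ''H'' t p q = (\<Sum>l<k. T l p * T l q)) \<and>
    rmem t ''lev'' = (\<lambda>i. \<Sum>l<k. (rowdot (T l) m i)\<^sup>2)" for k t
  have I_update: "I k (nupdate ''k'' i x t) = I k t" for k i x t
    by (simp add: I_def output_set_def matrix_at_def)
  show ?thesis
    unfolding init_H_def
  proof (rule runs_Seq)
    show "runs (nset ''kb'' (NConst 0)) s 1 (\<lambda>t. t = nupdate ''kb'' 0 0 s)"
      by (rule runs_NAssign) auto
    fix s' assume s': "s' = nupdate ''kb'' 0 0 s"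
    show "runs (for_loop ''k'' (nvar ''d'') (Seq copyrow (Seq (rset ''sig'' (rconst 1)) (Seq update next_row)))) s'
       (d * (35 * W + 2) + 2) (\<lambda>t. inp t \<and> rmem t ''acc'' = (\<lambda>_. 0) \<and> output_set t = output_set s \<and>
        (\<forall>p<d. \<forall>q<d. matrix_at ''H'' t p q = (\<Sum>l<d. T l p * T l q)) \<and>
        (\<forall>i<n. rmem t ''lev'' i = leverage d (matrix_at ''H'' t) (b i)))"
    proof (rule runs_for[where N = d and B = "35 * W" and I = I])
      show "I 0 (nupdate ''k'' 0 0 s')"
        using s by (simp add: I_update) (simp add: I_def s' output_set_def matrix_at_def)
      fix k t
      assume k: "k < d" "nmem t ''k'' 0 = k" and I: "I k t"
      then have inpt: "inp t"
        by (simp add: I_def)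
      obtain T1 t1 where 1: "exec copyrow t T1 t1" "T1 \<le> 5 * W"
        and t1: "inp t1 \<and> agree {''q'', ''w''} t t1 \<and>
          (\<forall>q<d. rmem t1 ''w'' q = rmem t ''T'' (nmem t ''kb'' 0 + q))"
        by (rule runsE[OF runs_copyrow[OF inpt]])
      have ag1: "agree {''q'', ''w''} t t1" and inp1: "inp t1"
        using t1 by auto
      define t2 where "t2 = rupdate ''sig'' 0 1 t1"
      have 2: "exec (rset ''sig'' (rconst 1)) t1 1 t2"
        using exec_RAssign[of "''sig''" "NConst 0" "rconst 1" t1] by (simp add: t2_def)
      have inp2: "inp t2" and acc2: "rmem t2 ''acc'' = (\<lambda>_. 0)"
        using inp1 I by (simp_all add: t2_def agreeD[OF ag1] I_def)
      have w2: "rmem t2 ''w'' q = T k q" if "q < d" for q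
        using t1 that I by (simp add: t2_def I_def T matrix_at_def)
      have rd: "rowdot (rmem t2 ''w'') m i = rowdot (T k) m i" for i
        by (rule rowdot_cong) (rule w2)
      obtain T3 t3 where 3: "exec update t2 T3 t3" "T3 \<le> 28 * W"
        and t3: "inp t3 \<and>
          agree {''q'', ''y'', ''p'', ''b'', ''H'', ''e'', ''acc'', ''lev''} t2 t3 \<and> rmem t3 ''acc'' = (\<lambda>_. 0) \<and>
          (\<forall>p<d. \<forall>q<d. rmem t3 ''H'' (p * d + q) =
            rmem t2 ''H'' (p * d + q) + rmem t2 ''sig'' 0 * rmem t2 ''w'' p * rmem t2 ''w'' q) \<and>
          rmem t3 ''lev'' = (\<lambda>i. rmem t2 ''lev'' i + rmem t2 ''sig'' 0 * (rowdot (rmem t2 ''w'') m i)\<^sup>2)"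
        by (rule runsE[OF runs_update[OF inp2 acc2]])
      have ag3: "agree {''q'', ''y'', ''p'', ''b'', ''H'', ''e'', ''acc'', ''lev''} t2 t3" and inp3: "inp t3"
        using t3 by auto
      have same2: "rmem t2 ''H'' = rmem t ''H''" "rmem t2 ''lev'' = rmem t ''lev''" "rmem t2 ''sig'' 0 = 1"
          "rmem t2 ''T'' = rmem t ''T''" "nmem t2 ''kb'' = nmem t ''kb''" "nmem t2 ''k'' = nmem t ''k''"
          "output_set t2 = output_set t"
        by (simp_all add: t2_def agreeD[OF ag1] output_set_agree[OF ag1] output_set_def)
      have same3: "rmem t3 ''T'' = rmem t ''T''" "nmem t3 ''kb'' = nmem t ''kb''" "nmem t3 ''k'' = nmem t ''k''"
          "output_set t3 = output_set t"
        by (simp_all add: agreeD[OF ag3] output_set_agree[OF ag3] same2)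
      have lev3: "rmem t3 ''lev'' = (\<lambda>i. \<Sum>l<Suc k. (rowdot (T l) m i)\<^sup>2)"
        using t3 I by (simp add: same2 rd I_def)
      have H3: "matrix_at ''H'' t3 p q = (\<Sum>l<Suc k. T l p * T l q)" if "p < d" "q < d" for p q
        using t3 I that by (simp add: same2 w2 I_def matrix_at_def)
      show "runs (Seq copyrow (Seq (rset ''sig'' (rconst 1)) (Seq update next_row))) t (35 * W)
          (\<lambda>t'. nmem t' ''k'' 0 = k \<and> I (Suc k) (nupdate ''k'' 0 (Suc k) t'))"
      proof (rule runsI)
        show "exec (Seq copyrow (Seq (rset ''sig'' (rconst 1)) (Seq update next_row))) t (T1 + (1 + (T3 + 1)))
            (nupdate ''kb'' 0 (nmem t3 ''kb'' 0 + d) t3)"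
          by (rule exec_Seq[OF 1(1) exec_Seq[OF 2 exec_Seq[OF 3(1) exec_next_row[OF inp3]]]])
        show "T1 + (1 + (T3 + 1)) \<le> 35 * W"
          using 1 3 W by linarith
        have "matrix_at ''H'' (nupdate ''kb'' i x t3) = matrix_at ''H'' t3"
            "output_set (nupdate ''kb'' i x t3) = output_set t3" for i x
          by (simp_all add: fun_eq_iff matrix_at_def output_set_def)
        then show "nmem (nupdate ''kb'' 0 (nmem t3 ''kb'' 0 + d) t3) ''k'' 0 = k \<and>
            I (Suc k) (nupdate ''k'' 0 (Suc k) (nupdate ''kb'' 0 (nmem t3 ''kb'' 0 + d) t3))"
          unfolding I_update using I k inp3 t3 lev3 H3 same3 by (simp add: I_def)
      qed
    next
      fix t assume I: "I d t"
      then have H: "\<forall>p<d. \<forall>q<d. matrix_at ''H'' t p q = (\<Sum>l<d. T l p * T l q)"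
        by (simp add: I_def)
      have "rmem t ''lev'' i = leverage d (matrix_at ''H'' t) (b i)" if "i < n" for i
        unfolding leverage_factor[OF H] using I that by (simp add: I_def rowdot_ip ip_commute)
      then show "inp t \<and> rmem t ''acc'' = (\<lambda>_. 0) \<and> output_set t = output_set s \<and>
          (\<forall>p<d. \<forall>q<d. matrix_at ''H'' t p q = (\<Sum>l<d. T l p * T l q)) \<and>
          (\<forall>i<n. rmem t ''lev'' i = leverage d (matrix_at ''H'' t) (b i))"
        using I H by (simp add: I_def)
    qed (auto simp: I_def inp_def)
  qed (use loop_bound[of 35 40] in simp)
qed

text \<open>The run is ghost data for the length bound; memory holds only the current inverse and
  leverages. The orthogonality clause is about the unit vectors, which belong to \<open>S N\<close>
  but never to the output.\<close>

definition greedy_state :: "nat set \<Rightarrow> nat \<Rightarrow> store \<Rightarrow> bool" where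
  "greedy_state S0 N t \<longleftrightarrow> inp t \<and> rmem t ''acc'' = (\<lambda>_. 0) \<and>
     (\<exists>S H j. greedy_run d n b N S H j \<and> S 0 = S0 \<and> H N = matrix_at ''H'' t \<and>
        (\<forall>s\<in>S N. n \<le> s \<longrightarrow> (\<forall>i<n. ip d (b s) (mv d (H N) (b i)) = 0)) \<and>
        output_set t = S N \<inter> {..<n}) \<and>
     (\<forall>i<n. rmem t ''lev'' i = leverage d (matrix_at ''H'' t) (b i))"

text \<open>\<open>j\<close> is meaningful only if the search exceeded its initial value 1;
  otherwise it may be left over from an earlier search.\<close>

definition searched :: "store \<Rightarrow> bool" where
  "searched t \<longleftrightarrow> (\<forall>i<n. rmem t ''lev'' i \<le> rmem t ''best'' 0) \<and>
     (1 < rmem t ''best'' 0 \<longrightarrow> nmem t ''j'' 0 < n \<and> rmem t ''best'' 0 = rmem t ''lev'' (nmem t ''j'' 0))"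

lemma leverage_empty_row:
  assumes "i < n" "i \<notin> R ` {..<m}"
  shows "leverage d H (b i) = 0"
proof -
  have "b i q = 0" if "q < d" for q
    using complete[OF assms(1) that] assms(2) by blast
  then show ?thesis
    by (simp add: leverage_def ip_def)
qed

lemma runs_search:
  assumes I: "greedy_state S0 N s"
  shows "runs search s (8 * W) (\<lambda>t. greedy_state S0 N t \<and> searched t)"
proof -
  define s1 where "s1 = rupdate ''best'' 0 1 s"
  have 1: "exec (rset ''best'' (rconst 1)) s 1 s1"
    using exec_RAssign[of "''best''" "NConst 0" "rconst 1" s] by (simp add: s1_def)
  have inp1: "inp s1"
    using I by (simp add: s1_def greedy_state_def)
  obtain T2 t where 2: "exec argmax s1 T2 t" "T2 \<le> 7 * W"
    and t: "inp t \<and> agree {''e'', ''best'', ''j''} s1 t \<and>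
      (\<forall>e<m. rmem s1 ''lev'' (R e) \<le> rmem t ''best'' 0) \<and> rmem s1 ''best'' 0 \<le> rmem t ''best'' 0 \<and>
      (rmem t ''best'' 0 = rmem s1 ''best'' 0 \<or>
        (nmem t ''j'' 0 < n \<and> rmem t ''best'' 0 = rmem s1 ''lev'' (nmem t ''j'' 0)))"
    by (rule runsE[OF runs_argmax[OF inp1]])
  have ag: "agree {''e'', ''best'', ''j''} s1 t"
    using t by auto
  have same: "rmem t ''lev'' = rmem s ''lev''" "rmem t ''acc'' = rmem s ''acc''" "rmem t ''H'' = rmem s ''H''"
      "output_set t = output_set s"
    by (simp_all add: agreeD[OF ag] output_set_agree[OF ag] s1_def output_set_def)
  have "matrix_at ''H'' t = matrix_at ''H'' s"
    by (simp add: fun_eq_iff matrix_at_def same)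
  then have state: "greedy_state S0 N t"
    using I t by (simp add: greedy_state_def same)
  have "rmem t ''lev'' i \<le> rmem t ''best'' 0" if "i < n" for i
  proof (cases "i \<in> R ` {..<m}")
    case True
    then show ?thesis
      using t by (auto simp: same s1_def)
  next
    case False
    then show ?thesis
      using state t leverage_empty_row[OF that] that by (simp add: greedy_state_def s1_def)
  qed
  then have "searched t"
    using t by (auto simp: searched_def same s1_def)
  then show ?thesis
    unfolding search_def using state 2 W by (intro runsI[OF exec_Seq[OF 1 2(1)]]) auto
qed

lemma runs_copy_y:
  assumes "inp s"
  shows "runs copy_y s (5 * W) (\<lambda>t. inp t \<and> agree {''q'', ''w''} s t \<and> (\<forall>q<d. rmem t ''w'' q = rmem s ''y'' q))"
proof -
  define I where "I k t \<longleftrightarrow> inp t \<and> agree {''q'', ''w''} s t \<and> (\<forall>q<k. rmem t ''w'' q = rmem s ''y'' q)" for k t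
  show ?thesis
    unfolding copy_y_def
  proof (rule runs_for[where N = d and B = 1 and I = I])
    fix k t
    assume k: "k < d" "nmem t ''q'' 0 = k" and I: "I k t"
    then have ag: "agree {''q'', ''w''} s t"
      by (simp add: I_def)
    show "runs (RAssign ''w'' (nvar ''q'') (RCell ''y'' (nvar ''q''))) t 1
        (\<lambda>t'. nmem t' ''q'' 0 = k \<and> I (Suc k) (nupdate ''q'' 0 (Suc k) t'))"
      by (rule runs_RAssign) (use k I in \<open>auto simp: I_def less_Suc_eq agreeD[OF ag]\<close>)
  qed (use assms W in \<open>auto simp: I_def inp_def\<close>)
qed

lemma runs_extend:
  assumes I: "greedy_state S0 N s" and best: "searched s" "1 < rmem s ''best'' 0"
  shows "runs extend s (67 * W) (\<lambda>t. greedy_state S0 (Suc N) t \<and> searched t)"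
proof -
  define x where "x = b (nmem s ''j'' 0)"
  define i where "i = nmem s ''j'' 0"
  define Hs where "Hs = matrix_at ''H'' s"
  have inps: "inp s"
    using I by (simp add: greedy_state_def)
  obtain S H j where run: "greedy_run d n b N S H j" and S: "S 0 = S0" "H N = Hs"
      "\<forall>s\<in>S N. n \<le> s \<longrightarrow> (\<forall>i<n. ip d (b s) (mv d (H N) (b i)) = 0)" "output_set s = S N \<inter> {..<n}"
      and lev: "\<And>i. i < n \<Longrightarrow> rmem s ''lev'' i = leverage d Hs (b i)"
    using I by (auto simp: greedy_state_def Hs_def)
  have i: "i < n" "rmem s ''best'' 0 = leverage d Hs x" "\<And>i'. i' < n \<Longrightarrow> leverage d Hs (b i') \<le> leverage d Hs x"
    using best lev by (auto simp: searched_def i_def x_def)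
  obtain T1 t1 where 1: "exec load s T1 t1" "T1 \<le> 11 * W"
    and t1: "inp t1 \<and> agree {''q'', ''e'', ''v''} s t1 \<and> (\<forall>q<d. rmem t1 ''v'' q = b (nmem s ''j'' 0) q)"
    by (rule runsE[OF runs_load[OF inps i(1)[unfolded i_def]]])
  have ag1: "agree {''q'', ''e'', ''v''} s t1" and inp1: "inp t1"
    using t1 by auto
  obtain T2 t2 where 2: "exec (matvec ''H'') t1 T2 t2" "T2 \<le> 12 * W"
    and t2: "inp t2 \<and> agree {''p'', ''q'', ''b'', ''y''} t1 t2 \<and>
      (\<forall>p<d. rmem t2 ''y'' p = (\<Sum>q<d. rmem t1 ''H'' (p * d + q) * rmem t1 ''v'' q))"
    by (rule runsE[OF runs_matvec[OF inp1, of "''H''"]]) simp_all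
  have ag2: "agree {''p'', ''q'', ''b'', ''y''} t1 t2" and inp2: "inp t2"
    using t2 by auto
  have y2: "rmem t2 ''y'' p = mv d Hs x p" if "p < d" for p
    using t1 t2 that by (simp add: mv_def ip_def x_def Hs_def matrix_at_def agreeD[OF ag1])
  obtain T3 t3 where 3: "exec copy_y t2 T3 t3" "T3 \<le> 5 * W"
    and t3: "inp t3 \<and> agree {''q'', ''w''} t2 t3 \<and> (\<forall>q<d. rmem t3 ''w'' q = rmem t2 ''y'' q)"
    by (rule runsE[OF runs_copy_y[OF inp2]])
  have ag3: "agree {''q'', ''w''} t2 t3" and inp3: "inp t3"
    using t3 by auto
  define sig where "sig = - 1 / (1 + leverage d Hs x)"
  define t4 where "t4 = rupdate ''sig'' 0 sig t3"
  have 4: "exec (rset ''sig'' (RDiv (RSub (rconst 0) (rconst 1)) (RAdd (rconst 1) (rvar ''best'')))) t3 1 t4"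
    using exec_RAssign[of "''sig''" "NConst 0" "RDiv (RSub (rconst 0) (rconst 1)) (RAdd (rconst 1) (rvar ''best''))" t3]
    by (simp add: t4_def sig_def i(2)[symmetric] agreeD[OF ag3] agreeD[OF ag2] agreeD[OF ag1])
  have same4: "rmem t4 ''acc'' = rmem s ''acc''" "rmem t4 ''lev'' = rmem s ''lev''" "rmem t4 ''H'' = rmem s ''H''"
      "nmem t4 ''j'' = nmem s ''j''" "output_set t4 = output_set s" "rmem t4 ''sig'' 0 = sig"
    by (simp_all add: t4_def output_set_def agreeD[OF ag3] agreeD[OF ag2] agreeD[OF ag1])
  have inp4: "inp t4" and acc4: "rmem t4 ''acc'' = (\<lambda>_. 0)"
    using inp3 I same4 by (simp_all add: t4_def greedy_state_def)
  have w4: "rmem t4 ''w'' p = mv d Hs x p" if "p < d" for p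
    using t3 y2 that by (simp add: t4_def)
  obtain T5 t5 where 5: "exec update t4 T5 t5" "T5 \<le> 28 * W"
    and t5: "inp t5 \<and>
      agree {''q'', ''y'', ''p'', ''b'', ''H'', ''e'', ''acc'', ''lev''} t4 t5 \<and> rmem t5 ''acc'' = (\<lambda>_. 0) \<and>
      (\<forall>p<d. \<forall>q<d. rmem t5 ''H'' (p * d + q) =
        rmem t4 ''H'' (p * d + q) + rmem t4 ''sig'' 0 * rmem t4 ''w'' p * rmem t4 ''w'' q) \<and>
      rmem t5 ''lev'' = (\<lambda>i. rmem t4 ''lev'' i + rmem t4 ''sig'' 0 * (rowdot (rmem t4 ''w'') m i)\<^sup>2)"
    by (rule runsE[OF runs_update[OF inp4 acc4]])
  have ag5: "agree {''q'', ''y'', ''p'', ''b'', ''H'', ''e'', ''acc'', ''lev''} t4 t5" and inp5: "inp t5"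
    using t5 by auto
  obtain T6 t6 where 6: "exec push t5 T6 t6" "T6 \<le> 2"
    and t6: "agree {''out'', ''len''} t5 t6 \<and> output_set t6 = insert (nmem t5 ''j'' 0) (output_set t5)"
    by (rule runsE[OF runs_push])
  have ag6: "agree {''out'', ''len''} t5 t6"
    using t6 by auto
  have inp6: "inp t6"
    by (rule inp_agree[OF inp5 ag6]) auto
  define H' where "H' = matrix_at ''H'' t6"
  have step: "rank_one_step d Hs x H'"
    unfolding rank_one_step_def
  proof (intro allI impI)
    fix p q assume "p < d" "q < d"
    then show "H' p q = Hs p q - mv d Hs x p * mv d Hs x q / (1 + leverage d Hs x)"
      using t5 by (simp add: H'_def Hs_def matrix_at_def agreeD[OF ag6] w4 same4 sig_def)
  qed
  have lev6: "rmem t6 ''lev'' i' = leverage d H' (b i')" if "i' < n" for i'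
  proof -
    have "rowdot (rmem t4 ''w'') m i' = ip d (b i') (mv d Hs x)"
      unfolding rowdot_ip[OF that] by (rule ip_cong) (use w4 in auto)
    then show ?thesis
      using t5 lev[OF that] by (simp add: agreeD[OF ag6] rank_one_step_leverage[OF step] same4 sig_def)
  qed
  have "greedy_run d n b (Suc N) (S(Suc N := insert i (S N))) (H(Suc N := H')) (j(N := i))"
    by (rule greedy_run_extend[OF run]) (use i best step S(2) in \<open>auto simp: i_def x_def\<close>)
  moreover have "\<forall>s\<in>insert i (S N). n \<le> s \<longrightarrow> (\<forall>i'<n. ip d (b s) (mv d H' (b i')) = 0)"
  proof (intro ballI allI impI)
    fix s i' assume s: "s \<in> insert i (S N)" "n \<le> s" "i' < n"
    then have "s \<in> S N"
      using i(1) by auto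
    then show "ip d (b s) (mv d H' (b i')) = 0"
      using S(2,3) s i(1) by (intro rank_one_step_orthogonal[OF step]) (auto simp: x_def i_def)
  qed
  moreover have "output_set t6 = insert i (S N) \<inter> {..<n}"
    using t6 S(4) i(1) by (simp add: output_set_agree[OF ag5] agreeD[OF ag5] same4 i_def)
  moreover have "rmem t6 ''acc'' = (\<lambda>_. 0)"
    using t5 by (simp add: agreeD[OF ag6])
  ultimately have "greedy_state S0 (Suc N) t6"
    unfolding greedy_state_def using inp6 S(1) lev6
    by (intro conjI exI[of _ "S(Suc N := insert i (S N))"] exI[of _ "H(Suc N := H')"] exI[of _ "j(N := i)"])
      (auto simp: H'_def)
  from runs_search[OF this] obtain T7 t7 where 7: "exec search t6 T7 t7" "T7 \<le> 8 * W"
    and t7: "greedy_state S0 (Suc N) t7 \<and> searched t7"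
    by (rule runsE)
  show ?thesis
    unfolding extend_def
  proof (rule runsI)
    show "exec (Seq load (Seq (matvec ''H'') (Seq copy_y
     (Seq (rset ''sig'' (RDiv (RSub (rconst 0) (rconst 1)) (RAdd (rconst 1) (rvar ''best''))))
     (Seq update (Seq push search)))))) s (T1 + (T2 + (T3 + (1 + (T5 + (T6 + T7)))))) t7"
      by (intro exec_Seq[OF 1(1)] exec_Seq[OF 2(1)] exec_Seq[OF 3(1)] exec_Seq[OF 4] exec_Seq[OF 5(1)]
          exec_Seq[OF 6(1) 7(1)])
    show "T1 + (T2 + (T3 + (1 + (T5 + (T6 + T7))))) \<le> 67 * W"
      using 1 2 3 5 6 7 W by linarith
  qed (rule t7)
qed

text \<open>The hypothesis bounds every greedy run from \<open>S0\<close>. Each state of the loop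
  carries such a run of length equal to the number of iterations, so the loop stops within
  \<open>K\<close> of them.\<close>

lemma runs_greedy:
  assumes I: "greedy_state S0 0 s"
    and bound: "\<And>N S H j. greedy_run d n b N S H j \<Longrightarrow> S 0 = S0 \<Longrightarrow> N \<le> K"
  shows "runs greedy s (9 * W + 68 * (K * W)) (\<lambda>t. \<exists>N. greedy_state S0 N t \<and> searched t \<and> rmem t ''best'' 0 \<le> 1)"
  unfolding greedy_def
proof (rule runs_Seq[OF runs_search[OF I]])
  fix t assume t: "greedy_state S0 0 t \<and> searched t"
  show "runs (While (RLess (rconst 1) (rvar ''best'')) extend) t (K * (67 * W + 1) + 1)
      (\<lambda>t. \<exists>N. greedy_state S0 N t \<and> searched t \<and> rmem t ''best'' 0 \<le> 1)"
  proof (rule runs_While[where I = "\<lambda>N t. greedy_state S0 N t \<and> searched t"])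
    show "greedy_state S0 0 t \<and> searched t"
      by (rule t)
    show "runs extend t (67 * W) (\<lambda>t. greedy_state S0 (Suc N) t \<and> searched t)"
      if "greedy_state S0 N t \<and> searched t" "bval (RLess (rconst 1) (rvar ''best'')) t" for N t
      using that by (intro runs_extend) auto
    show "N \<le> K" if "greedy_state S0 N t \<and> searched t" for N t
      using that bound unfolding greedy_state_def by blast
  qed (auto simp: not_less)
next
  have "K * 1 \<le> K * W"
    using W by (intro mult_le_mono) auto
  moreover have "K * (67 * W + 1) = 67 * (K * W) + K * 1"
    by (simp add: algebra_simps)
  ultimately show "8 * W + (K * (67 * W + 1) + 1) \<le> 9 * W + 68 * (K * W)"
    using W(4) by linarith
qed

lemma runs_spanner:
  assumes s: "inp s" "\<And>X. X \<in> {''T'', ''H'', ''acc'', ''lev''} \<Longrightarrow> rmem s X = (\<lambda>_. 0)"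
      "nmem s ''kb'' 0 = 0" "nmem s ''len'' 0 = 0"
    and K: "K = nat \<lfloor>14 * real d * max 1 (ln (ln (real d)))\<rfloor>"
  shows "runs spanner s (136 * (d * W) + 68 * (K * W)) (\<lambda>t. \<exists>S H. inverse_gram d b S H \<and> finite S \<and>
    card S \<le> d + K \<and> output_set t = S \<inter> {..<n} \<and>
    (\<forall>s\<in>S. n \<le> s \<longrightarrow> (\<forall>i<n. ip d (b s) (mv d H (b i)) = 0)) \<and> (\<forall>i<n. leverage d H (b i) \<le> 1))"
proof -
  have 0: "rmem s ''T'' = (\<lambda>_. 0)" "rmem s ''H'' = (\<lambda>_. 0)" "rmem s ''acc'' = (\<lambda>_. 0)" "rmem s ''lev'' = (\<lambda>_. 0)"
    using s(2) by auto
  obtain T1 t1 where 1: "exec init_T s T1 t1" "T1 \<le> 6 * W"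
    and t1: "inp t1 \<and> agree {''k'', ''kb'', ''T''} s t1 \<and>
      (\<forall>p<d. \<forall>q<d. matrix_at ''T'' t1 p q = (if p = q then 1 else 0))"
    by (rule runsE[OF runs_init_T[OF s(1) 0(1) s(3)]])
  have ag1: "agree {''k'', ''kb'', ''T''} s t1"
    using t1 by auto
  have "runs pivoting t1 (81 * (d * W)) (pivot_state d)"
    by (rule runs_pivoting) (use t1 0 s(4) in \<open>simp_all add: agreeD[OF ag1] output_set_def\<close>)
  then obtain T2 t2 where 2: "exec pivoting t1 T2 t2" "T2 \<le> 81 * (d * W)" and t2: "pivot_state d t2"
    by (rule runsE)
  obtain \<sigma> F where inv: "pivot_inv d n b d (matrix_at ''T'' t2) \<sigma> F"
      and out: "output_set t2 = \<sigma> ` {..<d} \<inter> {..<n}"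
    using t2 by (auto simp: pivot_state_def)
  define S0 where "S0 = \<sigma> ` {..<d}"
  have pt2: "inp t2" "rmem t2 ''acc'' = (\<lambda>_. 0)" "rmem t2 ''lev'' = (\<lambda>_. 0)" "rmem t2 ''H'' = (\<lambda>_. 0)"
    using t2 by (auto simp: pivot_state_def)
  obtain T3 t3 where 3: "exec init_H t2 T3 t3" "T3 \<le> 40 * (d * W)"
    and t3: "inp t3 \<and> rmem t3 ''acc'' = (\<lambda>_. 0) \<and> output_set t3 = output_set t2 \<and>
      (\<forall>p<d. \<forall>q<d. matrix_at ''H'' t3 p q = (\<Sum>l<d. matrix_at ''T'' t2 l p * matrix_at ''T'' t2 l q)) \<and>
      (\<forall>i<n. rmem t3 ''lev'' i = leverage d (matrix_at ''H'' t3) (b i))"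
    by (rule runsE[OF runs_init_H[OF pt2 refl]])
  then have H3: "\<forall>p<d. \<forall>q<d. matrix_at ''H'' t3 p q = (\<Sum>l<d. matrix_at ''T'' t2 l p * matrix_at ''T'' t2 l q)"
    by blast
  note pivot = pivot_inverse_gram[OF inv S0_def H3] pivot_fdet[OF inv S0_def H3]
    pivot_bounded[OF inv S0_def H3] pivot_card[OF inv S0_def H3] pivot_orthogonal[OF inv S0_def H3]
  have length: "N \<le> K" if run: "greedy_run d n b N S H j" and S: "S 0 = S0" for N S H j
  proof -
    have "real N \<le> 14 * real d * max 1 (ln (ln (real d)))"
      by (rule run_length[OF _ run]) (use d S pivot(2,3,4) in auto)
    then show ?thesis
      unfolding K by (simp add: le_nat_floor)
  qed
  have "greedy_run d n b 0 (\<lambda>_. S0) (\<lambda>_. matrix_at ''H'' t3) (\<lambda>_. 0)"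
    using pivot(1) by (simp add: greedy_run_def S0_def)
  then have "greedy_state S0 0 t3"
    unfolding greedy_state_def using t3 pivot(5) out
    by (intro conjI exI[of _ "\<lambda>_. S0"] exI[of _ "\<lambda>_. matrix_at ''H'' t3"] exI[of _ "\<lambda>_. 0"])
      (auto simp: S0_def)
  from runs_greedy[OF this length] obtain T4 t4 where 4: "exec greedy t3 T4 t4" "T4 \<le> 9 * W + 68 * (K * W)"
    and t4: "\<exists>N. greedy_state S0 N t4 \<and> searched t4 \<and> rmem t4 ''best'' 0 \<le> 1"
    by (rule runsE)
  then obtain N where N: "greedy_state S0 N t4" "searched t4" "rmem t4 ''best'' 0 \<le> 1"
    by blast
  from N(1) obtain S H j where run: "greedy_run d n b N S H j" and HN: "H N = matrix_at ''H'' t4"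
      and S: "S 0 = S0" "\<forall>s\<in>S N. n \<le> s \<longrightarrow> (\<forall>i<n. ip d (b s) (mv d (H N) (b i)) = 0)"
        "output_set t4 = S N \<inter> {..<n}"
    unfolding greedy_state_def by (elim conjE exE) (rule that)
  have lev: "leverage d (H N) (b i) \<le> 1" if "i < n" for i
  proof -
    have "leverage d (H N) (b i) = rmem t4 ''lev'' i"
      using N(1) that by (simp add: greedy_state_def HN)
    also have "\<dots> \<le> rmem t4 ''best'' 0"
      using N(2) that by (simp add: searched_def)
    finally show ?thesis
      using N(3) by linarith
  qed
  show ?thesis
    unfolding spanner_def
  proof (rule runsI)
    show "exec (Seq init_T (Seq pivoting (Seq init_H greedy))) s (T1 + (T2 + (T3 + T4))) t4"
      by (rule exec_Seq[OF 1(1) exec_Seq[OF 2(1) exec_Seq[OF 3(1) 4(1)]]])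
    \<comment> \<open>The phases cost \<open>6 + 81 + 40 + 9 = 136\<close> units after rounding
      \<open>W\<close> up to \<open>d * W\<close>, besides the \<open>K\<close> greedy
      iterations.\<close>
    have "1 * W \<le> d * W"
      using d by (rule mult_le_mono1)
    then show "T1 + (T2 + (T3 + T4)) \<le> 136 * (d * W) + 68 * (K * W)"
      using 1 2 3 4 by linarith
    have inv: "inverse_gram d b (S N) (H N)" "finite (S N)"
      using run unfolding greedy_run_def by auto
    have "S 0 \<subseteq> S N" "card (S N - S 0) = N"
      using run_sets[OF _ run, of 0 N] d by auto
    then have "card (S N) = card (S 0) + N"
      using inv(2) card_Diff_subset[of "S 0" "S N"] card_mono[of "S N" "S 0"] finite_subset[of "S 0" "S N"]
      by simp
    then have "card (S N) \<le> d + K"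
      using length[OF run S(1)] pivot(4) by (simp add: S)
    then show "\<exists>S H. inverse_gram d b S H \<and> finite S \<and> card S \<le> d + K \<and> output_set t4 = S \<inter> {..<n} \<and>
        (\<forall>s\<in>S. n \<le> s \<longrightarrow> (\<forall>i<n. ip d (b s) (mv d H (b i)) = 0)) \<and> (\<forall>i<n. leverage d H (b i) \<le> 1)"
      using inv S(2,3) lev by blast
  qed
qed

end

section \<open>The main result\<close>

lemma coordinate_listing_entry:
  assumes "coordinate_listing A es" "e < length es" "es ! e = (i, j, v)"
  shows "i < dim_row A" "j < dim_col A" "v = A $$ (i, j)"
proof -
  have "(i, j, v) \<in> set es"
    using assms by (metis nth_mem)
  then show "i < dim_row A" "j < dim_col A" "v = A $$ (i, j)"
    using assms(1) by (auto simp: coordinate_listing_def)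
qed

lemma coordinate_listing_nnz:
  assumes "coordinate_listing A es"
  shows "nnz A = length es"
proof -
  let ?N = "{(i, j). i < dim_row A \<and> j < dim_col A \<and> A $$ (i, j) \<noteq> 0}"
  have "set es = (\<lambda>(i, j). (i, j, A $$ (i, j))) ` ?N"
    using assms by (auto simp: coordinate_listing_def image_def)
  moreover have "inj_on (\<lambda>(i, j). (i, j, A $$ (i, j))) ?N"
    by (rule inj_onI) auto
  ultimately have "card (set es) = card ?N"
    by (simp add: card_image)
  moreover have "card (set es) = length es"
    using assms distinct_card unfolding coordinate_listing_def by blast
  ultimately show ?thesis
    by (simp add: nnz_def)
qed

lemma sparse_input_listing:
  assumes A: "A \<in> carrier_mat n d" and d: "1 \<le> d" and es: "coordinate_listing A es"
  shows "sparse_input n d (length es) (\<lambda>e. fst (es ! e)) (\<lambda>e. fst (snd (es ! e))) (\<lambda>e. snd (snd (es ! e)))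
    (\<lambda>s q. if s < n then A $$ (s, q) else if q = s - n then 1 else 0)"
proof
  show "1 \<le> d" by (rule d)
  have entry: "fst (es ! e) < n \<and> fst (snd (es ! e)) < d \<and>
      snd (snd (es ! e)) = A $$ (fst (es ! e), fst (snd (es ! e)))" if "e < length es" for e
    using coordinate_listing_entry[OF es that] A by (cases "es ! e") auto
  then show "fst (es ! e) < n \<and> fst (snd (es ! e)) < d \<and> snd (snd (es ! e)) =
      (if fst (es ! e) < n then A $$ (fst (es ! e), fst (snd (es ! e)))
       else if fst (snd (es ! e)) = fst (es ! e) - n then 1 else 0)" if "e < length es" for e
    using that by simp
  show "\<exists>e<length es. fst (es ! e) = i \<and> fst (snd (es ! e)) = q"
    if "i < n" "q < d" "(if i < n then A $$ (i, q) else if q = i - n then 1 else 0) \<noteq> 0" for i q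
  proof -
    have "(i, q, A $$ (i, q)) \<in> set es"
      using that A es by (auto simp: coordinate_listing_def)
    then obtain e where "e < length es" "es ! e = (i, q, A $$ (i, q))"
      by (auto simp: in_set_conv_nth)
    then show ?thesis
      by (intro exI[of _ e]) simp
  qed
  show "e = e'" if "e < length es" "e' < length es" "fst (es ! e) = fst (es ! e')"
      "fst (snd (es ! e)) = fst (snd (es ! e'))" for e e'
  proof -
    have "es ! e = es ! e'"
      using entry[OF that(1)] entry[OF that(2)] that(3,4) by (simp add: prod_eq_iff)
    then show ?thesis
      using es that(1,2) by (simp add: coordinate_listing_def nth_eq_iff_index_eq)
  qed
qed auto

theorem corollary3p5:
  shows "\<exists>(P :: com) (C :: real) (C' :: real) (k :: nat).
    \<forall>(n :: nat) (d :: nat) (A :: real mat) (\<epsilon> :: real) (es :: (nat \<times> nat \<times> real) list).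
      1 \<le> d \<longrightarrow> A \<in> carrier_mat n d \<longrightarrow> 0 < \<epsilon> \<longrightarrow> coordinate_listing A es \<longrightarrow>
      (\<exists>S \<subseteq> {..<n}.
         real (card S) \<le> C * (real d * max 1 (ln (ln (real d))) + real d / \<epsilon>) \<and>
         computes_within P (input_store n d es \<epsilon>) S
           (soft_O_bound C' k (real d * max 1 (1 / \<epsilon>) * (real (nnz A) + (real d)\<^sup>2))) \<and>
         well_conditioned_spanning_set A S (1 + \<epsilon>))"
proof (rule exI[of _ spanner], rule exI[of _ 15], rule exI[of _ 1088], rule exI[of _ 1], intro allI impI)
  fix n d :: nat and A :: "real mat" and \<epsilon> :: real and es :: "(nat \<times> nat \<times> real) list"
  assume d: "1 \<le> d" and A: "A \<in> carrier_mat n d" and \<epsilon>: "0 < \<epsilon>" and es: "coordinate_listing A es"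
  define R C V where "R e = fst (es ! e)" and "C e = fst (snd (es ! e))" and "V e = snd (snd (es ! e))" for e
  define b where "b s q = (if s < n then A $$ (s, q) else if q = s - n then 1 else 0)" for s q
  define s where "s = input_store n d es \<epsilon>"
  define M where "M = max 1 (ln (ln (real d)))"
  define K where "K = nat \<lfloor>14 * real d * M\<rfloor>"
  interpret sparse_input n d "length es" R C V b
    using sparse_input_listing[OF A d es] by (simp add: R_def[abs_def] C_def[abs_def] V_def[abs_def] b_def[abs_def])
  have M: "1 \<le> M"
    by (simp add: M_def)
  have K: "real K \<le> 14 * real d * M"
    unfolding K_def using M by (intro of_nat_floor) simp
  have "inp s"
    by (auto simp: inp_def s_def input_store_def scalar_def array_def R_def C_def V_def split: prod.split)
  then have "runs spanner s (136 * (d * W) + 68 * (K * W)) (\<lambda>t. \<exists>S H. inverse_gram d b S H \<and> finite S \<and>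
    card S \<le> d + K \<and> output_set t = S \<inter> {..<n} \<and>
    (\<forall>s\<in>S. n \<le> s \<longrightarrow> (\<forall>i<n. ip d (b s) (mv d H (b i)) = 0)) \<and> (\<forall>i<n. leverage d H (b i) \<le> 1))"
    by (rule runs_spanner) (auto simp: s_def input_store_def K_def M_def)
  then obtain T t S H where exec: "exec spanner s T t" "T \<le> 136 * (d * W) + 68 * (K * W)"
    and inv: "inverse_gram d b S H" and fin: "finite S" and card: "card S \<le> d + K"
    and out: "output_set t = S \<inter> {..<n}"
    and orth: "\<And>s i. s \<in> S \<Longrightarrow> n \<le> s \<Longrightarrow> i < n \<Longrightarrow> ip d (b s) (mv d H (b i)) = 0"
    and lev: "\<And>i. i < n \<Longrightarrow> leverage d H (b i) \<le> 1"
    unfolding runs_def by blast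
  show "\<exists>S\<subseteq>{..<n}. real (card S) \<le> 15 * (real d * max 1 (ln (ln (real d))) + real d / \<epsilon>) \<and>
      computes_within spanner (input_store n d es \<epsilon>) S
        (soft_O_bound 1088 1 (real d * max 1 (1 / \<epsilon>) * (real (nnz A) + (real d)\<^sup>2))) \<and>
      well_conditioned_spanning_set A S (1 + \<epsilon>)"
  proof (intro exI[of _ "S \<inter> {..<n}"] conjI)
    show "S \<inter> {..<n} \<subseteq> {..<n}"
      by blast
    have dM: "real d \<le> real d * M"
      using M by (simp add: mult_le_cancel_left1)
    have "card (S \<inter> {..<n}) \<le> d + K"
      using card card_mono[OF fin, of "S \<inter> {..<n}"] by simp
    then have "real (card (S \<inter> {..<n})) \<le> real d + real K"
      by (metis of_nat_add of_nat_le_iff)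
    also have "\<dots> \<le> 15 * (real d * M + real d / \<epsilon>)"
    proof -
      have "0 \<le> real d / \<epsilon>"
        using \<epsilon> by simp
      then show ?thesis
        using K dM by (simp add: mult.assoc)
    qed
    finally show "real (card (S \<inter> {..<n})) \<le> 15 * (real d * max 1 (ln (ln (real d))) + real d / \<epsilon>)"
      by (simp add: M_def)
    show "computes_within spanner (input_store n d es \<epsilon>) (S \<inter> {..<n})
        (soft_O_bound 1088 1 (real d * max 1 (1 / \<epsilon>) * (real (nnz A) + (real d)\<^sup>2)))"
    proof -
      define f where "f = real d * max 1 (1 / \<epsilon>) * (real (nnz A) + (real d)\<^sup>2)"
      have rW: "real W = real (nnz A) + (real d)\<^sup>2"
        by (simp add: W_def coordinate_listing_nnz[OF es] power2_eq_square)
      have f: "real d * real W \<le> f"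
        unfolding f_def rW[symmetric] by (intro mult_right_mono) (auto simp: mult_le_cancel_left1)
      have "real d * 1 \<le> real d * real W"
        using W(4) by (intro mult_left_mono) auto
      then have fd: "real d \<le> f"
        using f by linarith
      \<comment> \<open>A single logarithm pays for the factor \<open>M\<close>:
        \<open>ln (ln d) \<le> ln d\<close> and \<open>d \<le> f\<close>, while
        \<open>2 + f \<ge> 3\<close> handles the maximum with 1.\<close>
      have "M \<le> ln (2 + f)"
      proof -
        have "ln (ln (real d)) \<le> ln (real d)"
        proof (cases "1 < d")
          case True
          then have "0 < ln (real d)"
            by simp
          then show ?thesis
            using ln_le_minus_one[of "ln (real d)"] by linarith
        next
          case False
          \<comment> \<open>Here \<open>ln (ln 1) = ln 0\<close>, whose default value is 0.\<close>
          then have "d = 1"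
            using d by simp
          then show ?thesis
            by simp
        qed
        also have "\<dots> \<le> ln (2 + f)"
          using fd d by simp
        finally have "ln (ln (real d)) \<le> ln (2 + f)" .
        moreover have "exp 1 \<le> 2 + f"
          using exp_le fd d by linarith
        then have "1 \<le> ln (2 + f)"
          using fd by (simp add: ln_ge_iff)
        ultimately show ?thesis
          by (simp add: M_def)
      qed
      have "real T \<le> real (136 * (d * W) + 68 * (K * W))"
        using exec(2) by (simp only: of_nat_le_iff)
      also have "\<dots> = 136 * (real d * real W) + 68 * (real K * real W)"
        by simp
      also have "\<dots> \<le> 136 * (real d * M * real W) + 68 * (14 * real d * M * real W)"
        using K dM by (intro add_mono mult_left_mono mult_right_mono) auto
      \<comment> \<open>\<open>1088 = 136 + 68 * 14\<close>, where 14 comes from the bound on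
        \<open>K\<close>.\<close>
      also have "\<dots> = 1088 * ((real d * real W) * M)"
        by simp
      also have "\<dots> \<le> 1088 * (f * ln (2 + f))"
        using f \<open>M \<le> ln (2 + f)\<close> M fd by (intro mult_left_mono mult_mono) auto
      finally have "real T \<le> soft_O_bound 1088 1 f"
        by (simp add: soft_O_bound_def)
      then show ?thesis
        unfolding computes_within_def f_def using exec(1) out s_def by blast
    qed
    show "well_conditioned_spanning_set A (S \<inter> {..<n}) (1 + \<epsilon>)"
    proof (rule well_conditioned_spanning_setI[OF A])
      fix i assume i: "i < n"
      define c where "c s = ip d (b s) (mv d H (b i))" for s
      have zero: "c s = 0" if "s \<in> S - S \<inter> {..<n}" for s
        using orth[of s i] that i by (auto simp: c_def)
      have "A $$ (i, q) = (\<Sum>s\<in>S \<inter> {..<n}. c s * A $$ (s, q))" if "q < d" for q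
      proof -
        have "A $$ (i, q) = b i q"
          using i by (simp add: b_def)
        also have "\<dots> = (\<Sum>s\<in>S. c s * b s q)"
          unfolding c_def by (rule inverse_gram_expansion[OF inv that])
        also have "\<dots> = (\<Sum>s\<in>S \<inter> {..<n}. c s * b s q)"
          by (rule sum.mono_neutral_right) (use fin zero in auto)
        also have "\<dots> = (\<Sum>s\<in>S \<inter> {..<n}. c s * A $$ (s, q))"
          by (rule sum.cong) (auto simp: b_def)
        finally show ?thesis .
      qed
      moreover have "(\<Sum>s\<in>S \<inter> {..<n}. (c s)\<^sup>2) \<le> 1"
      proof -
        have "(\<Sum>s\<in>S \<inter> {..<n}. (c s)\<^sup>2) \<le> (\<Sum>s\<in>S. (c s)\<^sup>2)"
          by (rule sum_mono2) (use fin in auto)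
        also have "\<dots> = leverage d H (b i)"
          unfolding c_def by (rule leverage_sum_squares[OF inv, symmetric])
        finally show ?thesis
          using lev[OF i] by simp
      qed
      ultimately show "\<exists>c. (\<forall>q<d. A $$ (i, q) = (\<Sum>s\<in>S \<inter> {..<n}. c s * A $$ (s, q))) \<and>
          (\<Sum>s\<in>S \<inter> {..<n}. (c s)\<^sup>2) \<le> 1"
        by blast
    qed (use \<epsilon> in auto)
  qed
qed

end
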